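(* Let $F$ be an element of the second Wiener chaos such that $\mathbb E(F^2)=\kappa_2(F)=1$ and $\mathbb E(F^4)\ge9$ (equivalently $\kappa_4(F)\ge6$). Let $N_1,N_2$ be independent $\mathscr N(0,1)$. Then for every integer $r\ge1$ $$\mu_{2r}(F):=\mathbb E(F^{2r})\ \ge\ \mu_{2r}(N_1\times N_2)=\big((2r-1)!!\big)^2=\Big(\frac{(2r)!}{r!\,2^r}\Big)^2 .$$ If this inequality is an equality for some $r\ge3$, it is an equality for all $r\ge1$. In such a case also $\mathbb E(F^{2r+1})=\kappa_{2r+1}(F)=0$ for all $r\ge1$, and necessarily $F\overset{law}{=}N_1\times N_2$.
   Context: Let $W$ be an isonormal Gaussian process over a real separable Hilbert space $\mathfrak H$. The second Wiener chaos is $\mathscr H_2=\{I_2(f): f\in\mathfrak H^{\odot2}\}$ ($I_2$ the double Wiener integral). Equivalently, every $F\in\mathscr H_2$ can be written $F=\sum_{z\in\mathbb Z}\lambda_z(N_z^2-1)/\sqrt2$ with $(N_z)$ i.i.d. standard Gaussian and $\sum_z\lambda_z^2=\mathbb E(F^2)<\infty$. $\kappa_r(F)$ denotes the $r$-th cumulant. *)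

theory Defs
  imports "HOL-Probability.Probability"
begin

section \<open>Isonormal Gaussian processes\<close>

text \<open>Degenerate Gaussian laws (zero variance) are included.\<close>

definition gaussian_rv :: "'a measure \<Rightarrow> ('a \<Rightarrow> real) \<Rightarrow> bool" where
  "gaussian_rv M X \<longleftrightarrow> X \<in> borel_measurable M \<and>
     (\<exists>m. distr M borel X = return borel m \<or>
          (\<exists>\<sigma>>0. distr M borel X = density lborel (normal_density m \<sigma>)))"

definition isonormal :: "'a measure \<Rightarrow> ('h::{real_inner, polish_space} \<Rightarrow> 'a \<Rightarrow> real) \<Rightarrow> bool" where
  "isonormal M W \<longleftrightarrow> prob_space M \<and>
     (\<forall>S c. finite S \<longrightarrow> gaussian_rv M (\<lambda>x. \<Sum>h\<in>S. c h * W h x)) \<and>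
     (\<forall>h. prob_space.expectation M (W h) = 0) \<and>
     (\<forall>g h. prob_space.expectation M (\<lambda>x. W g x * W h x) = g \<bullet> h)"


section \<open>The second Wiener chaos\<close>

text \<open>The symmetric Hilbert tensor square of \<open>'h\<close> is realised, through the canonical isometric
  isomorphism, as the space of self-adjoint Hilbert--Schmidt operators on \<open>'h\<close>; the elementary
  tensor of \<open>h\<close> with itself is the operator \<open>x \<mapsto> (x \<bullet> h) h\<close>.\<close>

definition tensor_square :: "'h::real_inner \<Rightarrow> 'h \<Rightarrow>\<^sub>L 'h" where
  "tensor_square h = blinfun_scaleR_left h o\<^sub>L blinfun_inner_left h"

lemma tensor_square_apply [simp]: "blinfun_apply (tensor_square h) x = (x \<bullet> h) *\<^sub>R h"
  by (simp add: tensor_square_def)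

text \<open>The squared Hilbert--Schmidt norm. Taking the supremum over all finite orthonormal sets gives
  the sum over any orthonormal basis (possibly infinite).\<close>

definition hs_norm_sq :: "('h::real_inner \<Rightarrow>\<^sub>L 'h) \<Rightarrow> ennreal" where
  "hs_norm_sq A = (SUP E\<in>{E. finite E \<and> pairwise orthogonal E \<and> (\<forall>e\<in>E. norm e = 1)}.
     \<Sum>e\<in>E. ennreal ((norm (blinfun_apply A e))\<^sup>2))"

definition sym_tensor2 :: "('h::{real_inner, polish_space} \<Rightarrow>\<^sub>L 'h) set" where
  "sym_tensor2 = {f. (\<forall>x y. blinfun_apply f x \<bullet> y = x \<bullet> blinfun_apply f y) \<and> hs_norm_sq f < \<infinity>}"

text \<open>\<open>double_wiener_integral M W f F\<close> says that \<open>F\<close> is a version of \<open>I\<^sub>2(f)\<close>. Here \<open>I\<^sub>2\<close> is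
  the continuous linear extension of \<open>h \<otimes> h \<mapsto> H\<^sub>2(W(h)) = W(h)\<^sup>2 - 1\<close>, \<open>norm h = 1\<close>, which
  is an isometry up to the factor \<open>\<surd>2\<close> from the linear span of such tensors (dense in the
  symmetric tensor square) into \<open>L\<^sup>2\<close>. It is a relation, since \<open>I\<^sub>2(f)\<close> is only determined
  almost surely.\<close>

definition double_wiener_integral ::
  "'a measure \<Rightarrow> ('h::{real_inner, polish_space} \<Rightarrow> 'a \<Rightarrow> real) \<Rightarrow> ('h \<Rightarrow>\<^sub>L 'h) \<Rightarrow> ('a \<Rightarrow> real) \<Rightarrow> bool"
  where
  "double_wiener_integral M W f F \<longleftrightarrow> F \<in> borel_measurable M \<and>
     (\<exists>(S :: nat \<Rightarrow> 'h set) (c :: nat \<Rightarrow> 'h \<Rightarrow> real).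
        (\<forall>n. finite (S n) \<and> (\<forall>h\<in>S n. norm h = 1)) \<and>
        (\<lambda>n. hs_norm_sq ((\<Sum>h\<in>S n. c n h *\<^sub>R tensor_square h) - f)) \<longlonglongrightarrow> 0 \<and>
        (\<lambda>n. \<integral>\<^sup>+x. ennreal (((\<Sum>h\<in>S n. c n h * ((W h x)\<^sup>2 - 1)) - F x)\<^sup>2) \<partial>M) \<longlonglongrightarrow> 0)"

definition second_wiener_chaos ::
  "'a measure \<Rightarrow> ('h::{real_inner, polish_space} \<Rightarrow> 'a \<Rightarrow> real) \<Rightarrow> ('a \<Rightarrow> real) set" where
  "second_wiener_chaos M W = {F. \<exists>f\<in>sym_tensor2. double_wiener_integral M W f F}"


section \<open>Moments, cumulants, double factorials\<close>

definition moment :: "'a measure \<Rightarrow> ('a \<Rightarrow> real) \<Rightarrow> nat \<Rightarrow> real" where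
  "moment M X r = prob_space.expectation M (\<lambda>x. X x ^ r)"

text \<open>\<open>\<kappa>\<^sub>r(X) = (-\<i>)\<^sup>r (d/dt)\<^sup>r log E[exp(\<i> t X)]\<close> at \<open>t = 0\<close>. The characteristic function is
  near \<open>1\<close> for small \<open>t\<close>, so the principal logarithm is the right one there. The value is
  real whenever the derivative exists; \<open>Re\<close> only changes the type.\<close>

definition cumulant :: "'a measure \<Rightarrow> ('a \<Rightarrow> real) \<Rightarrow> nat \<Rightarrow> real" where
  "cumulant M X r = Re ((- \<i>) ^ r *
     (((\<lambda>g t. vector_derivative g (at t)) ^^ r) (\<lambda>t. Ln (char (distr M borel X) t))) 0)"

fun double_fact :: "nat \<Rightarrow> nat" where
  "double_fact 0 = 1"
| "double_fact (Suc 0) = 1"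
| "double_fact (Suc (Suc n)) = Suc (Suc n) * double_fact n"

end

theory Submission
  imports Defs
begin

text \<open>An element of the second chaos is an \<open>L\<^sup>2\<close>-limit of finite quadratic forms
  \<open>\<Sum>\<^sub>b \<lambda>\<^sub>b (N\<^sub>b\<^sup>2 - 1)\<close>, whose cumulants are \<open>2\<^bsup>r-1\<^esup> (r-1)! p\<^sub>r\<close> with \<open>p\<^sub>r = \<Sum>\<^sub>b \<lambda>\<^sub>b\<^bsup>r\<^esup>\<close>;
  moments, and hence the power sums, pass to the limit. The normal product has \<open>\<lambda> = \<plusminus>1/2\<close>. If
  \<open>p\<^sub>2 = 1/2\<close> and \<open>p\<^sub>4 \<ge> 1/8\<close>, then \<open>4\<^bsup>j\<^esup> p\<^bsub>2j\<^esub>\<close> is convex and initially nondecreasing in \<open>j\<close>, so the even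
  cumulants dominate those of the normal product, while the odd power sums all have the sign of the
  eigenvalue of largest absolute value. Since moments are polynomials with nonnegative coefficients in the
  cumulants, the even moments dominate too. Equality of one of them beyond the fourth forces
  \<open>p\<^sub>4 = 1/8\<close>, \<open>p\<^sub>6 = 1/32\<close>, \<open>p\<^sub>3 = 0\<close>, hence \<open>\<Sum>\<^sub>b \<lambda>\<^sub>b\<^sup>2 (4 \<lambda>\<^sub>b\<^sup>2 - 1)\<^sup>2 = 0\<close> and all cumulants agree; the law is then
  determined by its moments, which grow at most like \<open>r! a\<^bsup>r\<^esup>\<close>.\<close>

section \<open>Diagonalisation of quadratic forms\<close>

text \<open>The limiting eigenvalues are never constructed. Only the limits of their power sums are
  available, so every argument has to be stable under limits: inequalities are limits of sums of
  squares, the location of the eigenvalues in the equality case becomes a Cauchy-Schwarz estimate,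
  and the sign of the odd sums, which may vary with the stage of the approximation, is selected
  along a subsequence. Logarithms of generating functions are avoided too. A moment series
  \<open>f\<close> and the derivative \<open>d\<close> of its cumulant series are tied by the formal
  equation \<open>f' = d f\<close>, whose coefficient recursion carries bounds, limits, comparison
  and rigidity. Taylor estimates and analytic continuation enter only to identify \<open>d\<close>
  with the cumulants and to pass from moments to laws. The constants come from
  \<open>N1 N2 = (U^2 - V^2) / 2\<close> with \<open>U\<close>, \<open>V\<close> independent
  standard normal: the eigenvalues 1/2 and -1/2 have power sums 1/2, 1/8, 1/32 at the exponents 2,
  4, 6, and \<open>4 x^2 - 1\<close> vanishes at both.\<close>

definition orthonormal :: "'h::real_inner set \<Rightarrow> bool" where
  "orthonormal B \<longleftrightarrow> finite B \<and> (\<forall>a\<in>B. \<forall>b\<in>B. a \<bullet> b = (if a = b then 1 else 0))"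

lemma orthonormal_inner_sum:
  assumes "orthonormal B" "a \<in> B"
  shows "a \<bullet> (\<Sum>b\<in>B. f b *\<^sub>R b) = f a"
proof -
  have fin: "finite B" using assms by (simp add: orthonormal_def)
  have "a \<bullet> (\<Sum>b\<in>B. f b *\<^sub>R b) = (\<Sum>b\<in>B. f b * (a \<bullet> b))"
    by (simp add: inner_sum_right)
  also have "\<dots> = (\<Sum>b\<in>B. if b = a then f b else 0)"
    by (rule sum.cong) (use assms in \<open>auto simp: orthonormal_def\<close>)
  finally show ?thesis using fin assms by simp
qed

lemma orthonormal_card_le:
  assumes "orthonormal B" "finite A" "B \<subseteq> span A"
  shows "card B \<le> card A"
proof -
  have "independent B"
  proof (rule pairwise_orthogonal_independent)
    show "pairwise orthogonal B"
      using assms by (auto simp: pairwise_def orthogonal_def orthonormal_def)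
    show "0 \<notin> B" using assms by (force simp: orthonormal_def)
  qed
  then show ?thesis using independent_span_bound assms by blast
qed

text \<open>Relative compactness of bounded subsets of a finite-dimensional subspace; the ambient space is
  not Euclidean, so the library results on closed bounded sets do not apply.\<close>

lemma compact_box:
  fixes B :: "'h::real_inner set"
  assumes "finite B"
  shows "compact {x. \<exists>f. (\<forall>b\<in>B. f b \<in> {-1..1::real}) \<and> x = (\<Sum>b\<in>B. f b *\<^sub>R b)}" (is "compact (?C B)")
  using assms
proof induction
  case empty
  have "?C {} = {0}" by auto
  then show ?case by simp
next
  case (insert a B)
  have "?C (insert a B) = (\<lambda>(x, s). x + s *\<^sub>R a) ` (?C B \<times> {-1..1})"
  proof (intro equalityI subsetI)
    fix x assume "x \<in> ?C (insert a B)"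
    then obtain f where f: "\<forall>b\<in>insert a B. f b \<in> {-1..1}" "x = (\<Sum>b\<in>insert a B. f b *\<^sub>R b)"
      by blast
    have "x = (\<Sum>b\<in>B. f b *\<^sub>R b) + f a *\<^sub>R a"
      using f(2) insert by simp
    then show "x \<in> (\<lambda>(x, s). x + s *\<^sub>R a) ` (?C B \<times> {-1..1})"
      using f(1) by (intro image_eqI[where x = "(\<Sum>b\<in>B. f b *\<^sub>R b, f a)"]) auto
  next
    fix x assume "x \<in> (\<lambda>(x, s). x + s *\<^sub>R a) ` (?C B \<times> {-1..1})"
    then obtain f s where f: "\<forall>b\<in>B. f b \<in> {-1..1}" "s \<in> {-1..1}" "x = (\<Sum>b\<in>B. f b *\<^sub>R b) + s *\<^sub>R a"
      by auto
    have "x = (\<Sum>b\<in>insert a B. (f(a := s)) b *\<^sub>R b)"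
      using insert f(3) by (simp add: add.commute) (intro sum.cong, auto)
    moreover have "\<forall>b\<in>insert a B. (f(a := s)) b \<in> {-1..1}" using f by auto
    ultimately show "x \<in> ?C (insert a B)" by blast
  qed
  moreover have "compact (\<dots>)"
    by (intro compact_continuous_image compact_Times insert.IH)
       (auto intro!: continuous_intros simp: split_beta)
  ultimately show ?case by simp
qed

lemma orthonormal_expand_span:
  assumes "orthonormal B" "x \<in> span B"
  shows "x = (\<Sum>b\<in>B. (x \<bullet> b) *\<^sub>R b)"
proof -
  have "finite B" using assms by (simp add: orthonormal_def)
  then obtain f where f: "x = (\<Sum>b\<in>B. f b *\<^sub>R b)"
    using assms(2) by (auto simp: span_finite)
  have "x \<bullet> b = f b" if "b \<in> B" for b
    using orthonormal_inner_sum[OF assms(1) that, of f] f by (simp add: inner_commute)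
  then show ?thesis using f by simp
qed

lemma orthonormal_abs_inner_le:
  assumes "orthonormal B" "b \<in> B"
  shows "\<bar>x \<bullet> b\<bar> \<le> norm x"
proof -
  have "b \<bullet> b = 1" using assms by (simp add: orthonormal_def)
  then have "norm b = 1" by (simp add: norm_eq_sqrt_inner)
  then show ?thesis using Cauchy_Schwarz_ineq2[of x b] by simp
qed

lemma orthonormal_residual:
  assumes "orthonormal B" "x \<in> span A" "B \<subseteq> span A"
  defines "v \<equiv> x - (\<Sum>b\<in>B. (x \<bullet> b) *\<^sub>R b)"
  shows "v \<in> span A" "b \<in> B \<Longrightarrow> v \<bullet> b = 0"
proof -
  show "v \<in> span A" unfolding v_def
    using assms by (intro span_diff span_sum span_scale) auto
  show "v \<bullet> b = 0" if "b \<in> B"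
    using orthonormal_inner_sum[OF assms(1) that, of "\<lambda>b. x \<bullet> b"]
    by (simp add: v_def inner_diff_right inner_commute[of _ b])
qed

text \<open>Maximal families take the place of an induction on dimension: the orthonormal basis and
  the eigenbasis below are families of greatest cardinality, and each proof shows that a family
  which does not span could be enlarged by one vector.\<close>

lemma max_card_ex:
  assumes "P X" "\<And>B. P B \<Longrightarrow> card B \<le> (n::nat)"
  shows "\<exists>B. P B \<and> (\<forall>C. P C \<longrightarrow> card C \<le> card B)"
  by (rule ex_has_greatest_nat[of P X card "Suc n"]) (use assms in \<open>auto simp: le_imp_less_Suc\<close>)

lemma orthonormal_insert:
  assumes "orthonormal B" "norm e = 1" "\<And>b. b \<in> B \<Longrightarrow> e \<bullet> b = 0"
  shows "orthonormal (insert e B)" "e \<notin> B"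
proof -
  have "e \<bullet> e = 1" using assms(2) by (simp add: norm_eq_1)
  then show "e \<notin> B" using assms(3) by force
  show "orthonormal (insert e B)"
    using assms \<open>e \<bullet> e = 1\<close> by (auto simp: orthonormal_def inner_commute)
qed

lemma orthonormal_basis_span:
  fixes A :: "'h::real_inner set"
  assumes "finite A"
  obtains B where "orthonormal B" "span B = span A"
proof -
  have "\<exists>B. (orthonormal B \<and> B \<subseteq> span A) \<and>
      (\<forall>C. orthonormal C \<and> C \<subseteq> span A \<longrightarrow> card C \<le> card B)"
    by (rule max_card_ex[of _ "{}" "card A"])
       (use orthonormal_card_le[OF _ assms] in \<open>auto simp: orthonormal_def\<close>)
  then obtain B where B: "orthonormal B \<and> B \<subseteq> span A"
    and max: "\<And>C. orthonormal C \<and> C \<subseteq> span A \<Longrightarrow> card C \<le> card B"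
    by blast
  have "A \<subseteq> span B"
  proof
    fix x assume "x \<in> A"
    define v where "v = x - (\<Sum>b\<in>B. (x \<bullet> b) *\<^sub>R b)"
    have v: "v \<in> span A" "\<And>b. b \<in> B \<Longrightarrow> v \<bullet> b = 0"
      using orthonormal_residual[of B x A] B assms \<open>x \<in> A\<close> by (auto simp: v_def span_base)
    have "v = 0"
    proof (rule ccontr)
      assume "v \<noteq> 0"
      define e where "e = v /\<^sub>R norm v"
      have "orthonormal (insert e B)" "e \<notin> B"
        by (rule orthonormal_insert; use B v \<open>v \<noteq> 0\<close> in \<open>simp add: e_def\<close>)+
      moreover have "e \<in> span A" using v by (simp add: e_def span_scale)
      ultimately have "card (insert e B) \<le> card B" using max[of "insert e B"] B by blast
      then show False using \<open>e \<notin> B\<close> B by (simp add: orthonormal_def)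
    qed
    then have "x = (\<Sum>b\<in>B. (x \<bullet> b) *\<^sub>R b)" by (simp add: v_def)
    then show "x \<in> span B" by (metis (no_types, lifting) span_base span_scale span_sum)
  qed
  then have "span B = span A" using B by (metis span_minimal subspace_span subset_antisym)
  then show ?thesis using that B by blast
qed

text \<open>The first-order condition at a maximum, in the form needed for perturbing a maximiser in
  a direction \<open>w\<close> by the amount \<open>s\<close>.\<close>

lemma linear_coeff_zero:
  fixes a b :: real
  assumes "\<And>s. 2 * s * a + s\<^sup>2 * b \<le> 0"
  shows "a = 0"
proof (rule ccontr)
  assume "a \<noteq> 0"
  \<comment> \<open>This \<open>d\<close> makes \<open>2 * d + b\<close> positive, so that at
    \<open>s = a / d\<close> the linear term outweighs the quadratic one.\<close>
  define d where "d = 1 + \<bar>b\<bar>"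
  define s where "s = a / d"
  have d: "d > 0" by (simp add: d_def add_pos_nonneg)
  have d2: "2 * d + b > 0" using abs_ge_minus_self[of b] d by (simp add: d_def)
  have a: "a = s * d" using d unfolding s_def by simp
  have "2 * s * a + s\<^sup>2 * b = s\<^sup>2 * (2 * d + b)"
    unfolding a power2_eq_square by algebra
  moreover have "s \<noteq> 0" using a \<open>a \<noteq> 0\<close> by force
  then have "s\<^sup>2 * (2 * d + b) > 0" using d2 by (intro mult_pos_pos) auto
  ultimately show False using assms[of s] by linarith
qed

text \<open>An eigenvector is found as a maximiser of the quadratic form on the unit sphere of the
  orthogonal complement of the eigenvectors found before.\<close>

lemma quadratic_form_diagonalise:
  fixes S :: "'h::real_inner set" and c :: "'h \<Rightarrow> real"
  assumes "finite S"
  obtains B where "orthonormal B" "S \<subseteq> span B"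
    "\<And>a b. a \<in> B \<Longrightarrow> b \<in> B \<Longrightarrow> a \<noteq> b \<Longrightarrow> (\<Sum>h\<in>S. c h * (h \<bullet> a) * (h \<bullet> b)) = 0"
proof -
  define \<beta> where "\<beta> x y = (\<Sum>h\<in>S. c h * (h \<bullet> x) * (h \<bullet> y))" for x y
  have \<beta>_sym: "\<beta> x y = \<beta> y x" for x y by (simp add: \<beta>_def mult_ac)
  have \<beta>_add: "\<beta> x (y + z) = \<beta> x y + \<beta> x z" for x y z
    by (simp add: \<beta>_def inner_add_right distrib_left sum.distrib)
  have \<beta>_scale: "\<beta> x (s *\<^sub>R y) = s * \<beta> x y" for x y s
    by (simp add: \<beta>_def sum_distrib_left mult_ac)
  have \<beta>_add': "\<beta> (y + z) x = \<beta> y x + \<beta> z x" for x y z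
    using \<beta>_add[of x y z] by (simp add: \<beta>_sym[of x])
  have \<beta>_scale': "\<beta> (s *\<^sub>R y) x = s * \<beta> y x" for x y s
    using \<beta>_scale[of x s y] by (simp add: \<beta>_sym[of x])
  \<comment> \<open>The second clause is the invariance of \<open>span B\<close> under the operator
    of the form: it pairs \<open>B\<close> to zero with the complement of \<open>B\<close>, so a new
    vector from that complement is automatically conjugate to the old ones.\<close>
  define D where "D B \<longleftrightarrow> orthonormal B \<and> B \<subseteq> span S \<and>
    (\<forall>b\<in>B. \<forall>v\<in>span S. (\<forall>a\<in>B. v \<bullet> a = 0) \<longrightarrow> \<beta> b v = 0) \<and>
    (\<forall>a\<in>B. \<forall>b\<in>B. a \<noteq> b \<longrightarrow> \<beta> a b = 0)" for B
  have "D {}" by (simp add: D_def orthonormal_def)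
  moreover have "card C \<le> card S" if "D C" for C
    using orthonormal_card_le[OF _ assms, of C] that by (simp add: D_def)
  ultimately obtain B where B: "D B" and max: "\<And>C. D C \<Longrightarrow> card C \<le> card B"
    using max_card_ex[of D "{}" "card S"] by blast
  have oB: "orthonormal B" and BS: "B \<subseteq> span S" using B by (auto simp: D_def)
  obtain A where A: "orthonormal A" "span A = span S" using orthonormal_basis_span[OF assms] .
  have "S \<subseteq> span B"
  proof (rule ccontr)
    assume "\<not> S \<subseteq> span B"
    then obtain x where x: "x \<in> S" "x \<notin> span B" by blast
    define v where "v = x - (\<Sum>b\<in>B. (x \<bullet> b) *\<^sub>R b)"
    have v: "v \<in> span S" "\<And>b. b \<in> B \<Longrightarrow> v \<bullet> b = 0"
      using orthonormal_residual[of B x S] oB BS assms x(1) by (auto simp: v_def span_base)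
    have "v \<noteq> 0"
    proof
      assume "v = 0"
      then have "x = (\<Sum>b\<in>B. (x \<bullet> b) *\<^sub>R b)" by (simp add: v_def)
      then show False using x(2) by (metis (no_types, lifting) span_base span_scale span_sum)
    qed
    \<comment> \<open>The unit sphere of the complement of \<open>B\<close> inside
      \<open>span S\<close>. Intersecting with a box in the coordinates of \<open>A\<close> makes it
      visibly compact and removes nothing, since coordinates of a unit vector are at most 1 in
      absolute value.\<close>
    define K where "K = {x. \<exists>f. (\<forall>b\<in>A. f b \<in> {-1..1::real}) \<and> x = (\<Sum>b\<in>A. f b *\<^sub>R b)}
      \<inter> ({x. norm x = 1} \<inter> (\<Inter>b\<in>B. {x. x \<bullet> b = 0}))"
    have memK: "y \<in> K \<longleftrightarrow> y \<in> span S \<and> norm y = 1 \<and> (\<forall>b\<in>B. y \<bullet> b = 0)" for y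
    proof
      assume "y \<in> K"
      then show "y \<in> span S \<and> norm y = 1 \<and> (\<forall>b\<in>B. y \<bullet> b = 0)"
        unfolding A(2)[symmetric]
        by (auto simp: K_def intro: span_sum span_scale span_base)
    next
      assume y: "y \<in> span S \<and> norm y = 1 \<and> (\<forall>b\<in>B. y \<bullet> b = 0)"
      have "y = (\<Sum>b\<in>A. (y \<bullet> b) *\<^sub>R b)" using orthonormal_expand_span[OF A(1)] A(2) y by blast
      moreover have "\<forall>b\<in>A. y \<bullet> b \<in> {-1..1}"
        using orthonormal_abs_inner_le[OF A(1), of _ y] y by (auto simp: abs_le_iff)
      ultimately show "y \<in> K" using y unfolding K_def by blast
    qed
    have cK: "compact K" unfolding K_def
    proof (rule compact_Int_closed)
      show "closed ({x. norm x = 1} \<inter> (\<Inter>b\<in>B. {x. x \<bullet> b = 0}))"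
        by (intro closed_Int closed_INT ballI closed_Collect_eq continuous_intros)
    next
      have "finite A" using A(1) by (simp add: orthonormal_def)
      then show "compact {x. \<exists>f. (\<forall>b\<in>A. f b \<in> {-1..1::real}) \<and> x = (\<Sum>b\<in>A. f b *\<^sub>R b)}"
        by (rule compact_box)
    qed
    have neK: "K \<noteq> {}"
    proof -
      have "v /\<^sub>R norm v \<in> K" using v \<open>v \<noteq> 0\<close> by (auto simp: memK span_scale)
      then show ?thesis by blast
    qed
    have "continuous_on K (\<lambda>x. \<beta> x x)" unfolding \<beta>_def by (intro continuous_intros)
    from continuous_attains_sup[OF cK neK this]
    obtain e where e: "e \<in> K" and emax: "\<And>y. y \<in> K \<Longrightarrow> \<beta> y y \<le> \<beta> e e"
      by blast
    have eS: "e \<in> span S" "norm e = 1" "\<And>b. b \<in> B \<Longrightarrow> e \<bullet> b = 0" using e by (auto simp: memK)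
    \<comment> \<open>The competitor is \<open>e + s w\<close>, normalised. As \<open>w\<close> is
      orthogonal to \<open>e\<close>, its squared norm is \<open>1 + s^2 |w|^2\<close>; clearing
      this denominator leaves a quadratic polynomial in \<open>s\<close> without constant
      term.\<close>
    have crit: "\<beta> e w = 0" if w: "w \<in> span S" "\<forall>a\<in>insert e B. w \<bullet> a = 0" for w
    proof (rule linear_coeff_zero)
      fix s
      define y where "y = e + s *\<^sub>R w"
      have "w \<bullet> e = 0" using w by simp
      then have ny: "(norm y)\<^sup>2 = 1 + s\<^sup>2 * (norm w)\<^sup>2"
        using eS(2) unfolding power2_norm_eq_inner y_def
        by (simp add: inner_add_left inner_add_right inner_commute norm_eq_1 power2_eq_square)
      have ny0: "norm y > 0"
      proof -
        have "(norm y)\<^sup>2 > 0" unfolding ny by (intro add_pos_nonneg) auto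
        then show ?thesis by simp
      qed
      moreover have "y \<in> span S" unfolding y_def using eS w by (intro span_add span_scale)
      moreover have "y \<bullet> b = 0" if "b \<in> B" for b
        using eS(3)[OF that] w that by (simp add: y_def inner_add_left)
      ultimately have "y /\<^sub>R norm y \<in> K" by (simp add: memK span_scale)
      then have "\<beta> (y /\<^sub>R norm y) (y /\<^sub>R norm y) \<le> \<beta> e e" by (rule emax)
      moreover have "\<beta> (y /\<^sub>R norm y) (y /\<^sub>R norm y) = \<beta> y y / (norm y)\<^sup>2"
        by (simp add: \<beta>_scale \<beta>_scale' divide_inverse power2_eq_square)
      ultimately have "\<beta> y y \<le> \<beta> e e * (norm y)\<^sup>2"
        using ny0 by (simp add: divide_le_eq)
      moreover have "\<beta> y y = \<beta> e e + 2 * s * \<beta> e w + s\<^sup>2 * \<beta> w w"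
        unfolding y_def
        by (simp add: \<beta>_add \<beta>_add' \<beta>_scale \<beta>_scale' \<beta>_sym[of w e] power2_eq_square distrib_left)
      ultimately show "2 * s * \<beta> e w + s\<^sup>2 * (\<beta> w w - \<beta> e e * (norm w)\<^sup>2) \<le> 0"
        unfolding ny by (simp add: algebra_simps)
    qed
    have ins: "orthonormal (insert e B)" "e \<notin> B"
      using orthonormal_insert[OF oB eS(2)] eS(3) by auto
    have \<beta>B: "\<beta> b w = 0" if "b \<in> B" "w \<in> span S" "\<forall>a\<in>B. w \<bullet> a = 0" for b w
      using B that by (auto simp: D_def)
    have "D (insert e B)"
      unfolding D_def
    proof (intro conjI ballI impI)
      show "orthonormal (insert e B)" by fact
      show "insert e B \<subseteq> span S" using BS eS by auto
      show "\<beta> b w = 0" if "b \<in> insert e B" "w \<in> span S" "\<forall>a\<in>insert e B. w \<bullet> a = 0" for b w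
        using crit \<beta>B that by auto
      show "\<beta> a b = 0" if "a \<in> insert e B" "b \<in> insert e B" "a \<noteq> b" for a b
        using that \<beta>B[of _ e] eS \<beta>_sym B by (auto simp: D_def)
    qed
    then have "card (insert e B) \<le> card B" by (rule max)
    then show False using \<open>e \<notin> B\<close> oB by (simp add: orthonormal_def)
  qed
  then show ?thesis using that[of B] B by (auto simp: D_def \<beta>_def)
qed

section \<open>Moments of Gaussian quadratic forms\<close>

text \<open>An algebra of random variables: closure under sums and products discharges all
  integrability conditions for the polynomial expressions below. Products are dominated through
  \<open>|a b| <= a^2 + b^2\<close>, applied to powers.\<close>

definition all_moments :: "'a measure \<Rightarrow> ('a \<Rightarrow> real) \<Rightarrow> bool" where
  "all_moments M X \<longleftrightarrow> X \<in> borel_measurable M \<and> (\<forall>n. integrable M (\<lambda>x. X x ^ n))"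

lemma all_moments_measurable: "all_moments M X \<Longrightarrow> X \<in> borel_measurable M"
  by (simp add: all_moments_def)

lemma all_moments_integrable: "all_moments M X \<Longrightarrow> integrable M X"
  unfolding all_moments_def by (metis (no_types, lifting) Bochner_Integration.integrable_cong power_one_right)

lemma all_moments_integrable_power: "all_moments M X \<Longrightarrow> integrable M (\<lambda>x. X x ^ n)"
  by (simp add: all_moments_def)

lemma all_moments_power:
  assumes "all_moments M X" shows "all_moments M (\<lambda>x. X x ^ k)"
  using assms by (auto simp: all_moments_def simp flip: power_mult)

lemma all_moments_mult:
  assumes "all_moments M X" "all_moments M Y" shows "all_moments M (\<lambda>x. X x * Y x)"
proof -
  have "integrable M (\<lambda>x. (X x * Y x) ^ n)" for n
  proof (rule Bochner_Integration.integrable_bound)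
    show "integrable M (\<lambda>x. X x ^ (2 * n) + Y x ^ (2 * n))"
      using assms by (simp add: all_moments_def)
    show "(\<lambda>x. (X x * Y x) ^ n) \<in> borel_measurable M"
      using assms by (auto simp: all_moments_def)
    have "\<bar>a * b\<bar> \<le> a\<^sup>2 + b\<^sup>2" for a b :: real
      using sum_squares_bound[of "\<bar>a\<bar>" "\<bar>b\<bar>"] abs_ge_zero[of "a * b"] unfolding abs_mult power2_abs by linarith
    from this[of "X _ ^ n" "Y _ ^ n"]
    show "AE x in M. norm ((X x * Y x) ^ n) \<le> norm (X x ^ (2 * n) + Y x ^ (2 * n))"
      by (intro always_eventually allI)
         (simp add: power_mult_distrib mult.commute[of 2] power_mult order.trans[OF _ abs_ge_self])
  qed
  then show ?thesis using assms by (auto simp: all_moments_def)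
qed

lemma all_moments_add:
  assumes "all_moments M X" "all_moments M Y" shows "all_moments M (\<lambda>x. X x + Y x)"
proof -
  have "integrable M (\<lambda>x. (X x + Y x) ^ n)" for n
    unfolding binomial_ring mult.assoc
    by (intro Bochner_Integration.integrable_sum integrable_mult_right all_moments_integrable
        all_moments_mult all_moments_power assms)
  then show ?thesis using assms by (auto simp: all_moments_def)
qed

lemma (in finite_measure) all_moments_const: "all_moments M (\<lambda>_. c)"
  by (simp add: all_moments_def)

lemma (in finite_measure) all_moments_sum:
  assumes "\<And>i. i \<in> A \<Longrightarrow> all_moments M (X i)"
  shows "all_moments M (\<lambda>x. \<Sum>i\<in>A. X i x)"
  using assms
proof (induction A rule: infinite_finite_induct)
  case (insert i A)
  then show ?case by (auto intro: all_moments_add)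
qed (auto intro: all_moments_const)

section \<open>Gaussian moments and formal moment series\<close>

definition gauss_moment :: "nat \<Rightarrow> real" where
  "gauss_moment n = (if even n then fact n / (2 ^ (n div 2) * fact (n div 2)) else 0)"

text \<open>The moment form of the fact that independent centred normal variables of variances
  \<open>s^2\<close> and \<open>a\<close> add up to one of variance \<open>a + s^2\<close>. Only
  even \<open>j\<close> contribute, and after cancellation of factorials the binomial theorem for
  \<open>(s^2 + a)^m\<close> with \<open>n = 2 m\<close> remains.\<close>

lemma gauss_moment_binomial:
  assumes "0 \<le> a"
  shows "gauss_moment n * sqrt (a + s\<^sup>2) ^ n =
    (\<Sum>j\<le>n. real (n choose j) * (gauss_moment j * s ^ j) * (gauss_moment (n - j) * sqrt a ^ (n - j)))"
proof (cases "even n")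
  case False
  then have "real (n choose j) * (gauss_moment j * s ^ j) * (gauss_moment (n - j) * sqrt a ^ (n - j)) = 0"
    if "j \<le> n" for j
    using that by (auto simp: gauss_moment_def)
  then have "(\<Sum>j\<le>n. real (n choose j) * (gauss_moment j * s ^ j) * (gauss_moment (n - j) * sqrt a ^ (n - j))) = 0"
    by (intro sum.neutral) auto
  then show ?thesis using False by (simp add: gauss_moment_def)
next
  case True
  then obtain m where m: "n = 2 * m" by blast
  define t where "t j = real (n choose j) * (gauss_moment j * s ^ j) * (gauss_moment (n - j) * sqrt a ^ (n - j))" for j
  have "(\<Sum>j\<le>n. t j) = (\<Sum>j\<in>(\<lambda>i. 2 * i) ` {..m}. t j)"
  proof (rule sum.mono_neutral_right)
    show "\<forall>i\<in>{..n} - (\<lambda>i. 2 * i) ` {..m}. t i = 0"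
    proof
      fix i assume i: "i \<in> {..n} - (\<lambda>i. 2 * i) ` {..m}"
      have "odd i"
      proof
        assume "even i"
        then obtain l where "i = 2 * l" by blast
        then show False using i m by auto
      qed
      then show "t i = 0" by (simp add: t_def gauss_moment_def)
    qed
  qed (use m in auto)
  also have "\<dots> = (\<Sum>i\<le>m. t (2 * i))"
    by (subst sum.reindex) (auto simp: inj_on_def)
  also have "\<dots> = (\<Sum>i\<le>m. gauss_moment n * (real (m choose i) * (s\<^sup>2) ^ i * a ^ (m - i)))"
  proof (rule sum.cong[OF refl])
    fix i assume "i \<in> {..m}"
    then have i: "i \<le> m" by simp
    have ev: "n - 2 * i = 2 * (m - i)" using m by simp
    have pw: "(2::real) ^ m = 2 ^ i * 2 ^ (m - i)" using i by (simp flip: power_add)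
    have b1: "real (n choose (2 * i)) = fact (2 * m) / (fact (2 * i) * fact (2 * (m - i)))"
      using i m by (simp add: binomial_fact ev[symmetric])
    have b2: "real (m choose i) = fact m / (fact i * fact (m - i))"
      using i by (simp add: binomial_fact)
    have sq: "sqrt a ^ (2 * (m - i)) = a ^ (m - i)" using assms by (simp add: power_mult)
    show "t (2 * i) = gauss_moment n * (real (m choose i) * (s\<^sup>2) ^ i * a ^ (m - i))"
      unfolding t_def ev b1 b2 sq by (simp add: gauss_moment_def m pw power_mult)
  qed
  also have "\<dots> = gauss_moment n * (s\<^sup>2 + a) ^ m"
    unfolding binomial_ring sum_distrib_left by simp
  also have "(s\<^sup>2 + a) ^ m = sqrt (a + s\<^sup>2) ^ n"
    using assms by (simp add: m power_mult add.commute)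
  finally show ?thesis by (simp add: t_def)
qed

lemma gauss_moment_add2: "gauss_moment (n + 2) = real (n + 1) * gauss_moment n"
proof (cases "even n")
  case True
  then obtain m where m: "n = 2 * m" by blast
  have "gauss_moment (n + 2) = (2 * real m + 2) * ((2 * real m + 1) * fact n) / ((2 * real m + 2) * (2 ^ m * fact m))"
    by (simp add: gauss_moment_def m algebra_simps)
  also have "\<dots> = ((2 * real m + 1) * fact n) / (2 ^ m * fact m)"
    by (rule mult_divide_mult_cancel_left) simp
  finally show ?thesis by (simp add: gauss_moment_def m)
qed (simp add: gauss_moment_def)

text \<open>The moment generating function as a formal series, so that no convergence has to be
  discussed while moments are being multiplied, compared or passed to a limit.\<close>

definition moment_fps :: "'a measure \<Rightarrow> ('a \<Rightarrow> real) \<Rightarrow> real fps" where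
  "moment_fps M X = Abs_fps (\<lambda>r. (\<integral>x. X x ^ r \<partial>M) / fact r)"

text \<open>Derivative of the cumulant generating function of \<open>l (N\<^sup>2 - 1)\<close>, \<open>N\<close> standard normal; the
  coefficient at \<open>k\<close> is \<open>\<kappa>\<^bsub>k+1\<^esub> / k!\<close>.\<close>

definition cumulant_deriv_fps :: "real \<Rightarrow> real fps" where
  "cumulant_deriv_fps l = Abs_fps (\<lambda>k. if k = 0 then 0 else 2 ^ k * l ^ (k + 1))"

text \<open>Jointly Gaussian families with identity covariance. Joint independence is not assumed and not
  derived: everything needed follows from the moments of the linear combinations.\<close>

locale gaussian_family = prob_space M for M :: "'a measure" +
  fixes B :: "'b set" and X :: "'b \<Rightarrow> 'a \<Rightarrow> real"
  assumes fin: "finite B"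
    and lin_all_moments: "all_moments M (\<lambda>x. \<Sum>b\<in>B. c b * X b x)"
    and lin_moment: "expectation (\<lambda>x. (\<Sum>b\<in>B. c b * X b x) ^ n) = gauss_moment n * sqrt (\<Sum>b\<in>B. (c b)\<^sup>2) ^ n"
begin

abbreviation L :: "('b \<Rightarrow> real) \<Rightarrow> 'a \<Rightarrow> real" where
  "L c x \<equiv> \<Sum>b\<in>B. c b * X b x"

lemma L_upd:
  assumes "e \<in> B" "c e = 0"
  shows "L (c(e := s)) x = s * X e x + L c x" "(\<Sum>b\<in>B. ((c(e := s)) b)\<^sup>2) = (\<Sum>b\<in>B. (c b)\<^sup>2) + s\<^sup>2"
proof -
  have "(\<Sum>b\<in>B - {e}. (c(e := s)) b * X b x) = (\<Sum>b\<in>B - {e}. c b * X b x)"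
    "(\<Sum>b\<in>B - {e}. ((c(e := s)) b)\<^sup>2) = (\<Sum>b\<in>B - {e}. (c b)\<^sup>2)"
    by (auto intro!: sum.cong)
  then show "L (c(e := s)) x = s * X e x + L c x"
    "(\<Sum>b\<in>B. ((c(e := s)) b)\<^sup>2) = (\<Sum>b\<in>B. (c b)\<^sup>2) + s\<^sup>2"
    using assms fin by (simp_all add: sum.remove[of B e])
qed

lemma X_all_moments: assumes "e \<in> B" shows "all_moments M (X e)"
proof -
  have "X e = L ((\<lambda>_. 0)(e := 1))" by (rule ext) (subst L_upd(1), use assms in auto)
  then show ?thesis using lin_all_moments[of "(\<lambda>_. 0)(e := 1)"] by simp
qed

lemma X_moment: assumes "e \<in> B" shows "expectation (\<lambda>x. X e x ^ n) = gauss_moment n"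
proof -
  have "X e = L ((\<lambda>_. 0)(e := 1))" by (rule ext) (subst L_upd(1), use assms in auto)
  moreover have "(\<Sum>b\<in>B. (((\<lambda>_. 0)(e := 1::real)) b)\<^sup>2) = 1"
    by (subst L_upd(2)) (use assms in auto)
  ultimately show ?thesis using lin_moment[of "(\<lambda>_. 0)(e := 1)" n] by simp
qed

text \<open>The hypothesis holds for every coefficient \<open>s\<close> of \<open>X e\<close>, and
  both of its sides are polynomials in \<open>s\<close>: the left by expanding
  \<open>(s X e + L c)^(k + n)\<close>, the right by \<open>gauss_moment_binomial\<close>. Comparing
  the coefficients of \<open>s^k\<close> separates \<open>X e\<close> from \<open>L c\<close>, which
  does the work of independence.\<close>

lemma product_moment_insert:
  assumes Y: "all_moments M Y" and e: "e \<in> B" "c e = 0"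
    and IH: "\<And>s. expectation (\<lambda>x. Y x * L (c(e := s)) x ^ (k + n))
      = expectation Y * expectation (\<lambda>x. L (c(e := s)) x ^ (k + n))"
  shows "expectation (\<lambda>x. Y x * X e x ^ k * L c x ^ n)
    = expectation Y * expectation (\<lambda>x. X e x ^ k) * expectation (\<lambda>x. L c x ^ n)"
proof -
  let ?N = "k + n" and ?v = "sqrt (\<Sum>b\<in>B. (c b)\<^sup>2)"
  have int: "integrable M (\<lambda>x. Y x * X e x ^ j * L c x ^ i)" for i j
    by (intro all_moments_integrable all_moments_mult all_moments_power Y X_all_moments e lin_all_moments)
  have "(\<Sum>j\<le>?N. (real (?N choose j) * expectation (\<lambda>x. Y x * X e x ^ j * L c x ^ (?N - j))) * s ^ j)
      = (\<Sum>j\<le>?N. (real (?N choose j) * (expectation Y * gauss_moment j * gauss_moment (?N - j) * ?v ^ (?N - j))) * s ^ j)" for s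
  proof -
    have "(\<Sum>j\<le>?N. (real (?N choose j) * expectation (\<lambda>x. Y x * X e x ^ j * L c x ^ (?N - j))) * s ^ j)
      = expectation (\<lambda>x. \<Sum>j\<le>?N. (real (?N choose j) * s ^ j) * (Y x * X e x ^ j * L c x ^ (?N - j)))"
      using int by (subst Bochner_Integration.integral_sum) (auto intro!: sum.cong)
    also have "\<dots> = expectation (\<lambda>x. Y x * L (c(e := s)) x ^ ?N)"
      unfolding L_upd(1)[where c = c, OF e] binomial_ring sum_distrib_left
      by (intro Bochner_Integration.integral_cong refl sum.cong) (simp add: power_mult_distrib)
    also have "\<dots> = expectation Y * (gauss_moment ?N * sqrt ((\<Sum>b\<in>B. (c b)\<^sup>2) + s\<^sup>2) ^ ?N)"
      unfolding IH lin_moment L_upd(2)[where c = c, OF e] by simp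
    also have "\<dots> = (\<Sum>j\<le>?N. (real (?N choose j) * (expectation Y * gauss_moment j * gauss_moment (?N - j) * ?v ^ (?N - j))) * s ^ j)"
      by (subst gauss_moment_binomial)
         (auto intro!: sum_nonneg sum.cong simp: sum_distrib_left)
    finally show ?thesis .
  qed
  then have "\<forall>j\<le>?N. real (?N choose j) * expectation (\<lambda>x. Y x * X e x ^ j * L c x ^ (?N - j))
      = real (?N choose j) * (expectation Y * gauss_moment j * gauss_moment (?N - j) * ?v ^ (?N - j))"
    by (intro polyfun_eq_coeffs[THEN iffD1] allI)
  from this[rule_format, of k] have "real (?N choose k) * expectation (\<lambda>x. Y x * X e x ^ k * L c x ^ n)
      = real (?N choose k) * (expectation Y * gauss_moment k * gauss_moment n * ?v ^ n)"
    by simp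
  then show ?thesis by (simp add: X_moment e lin_moment)
qed

text \<open>Partial forms over subsets \<open>A\<close> allow the eigenvectors to be added one at a
  time.\<close>

definition Q :: "('b \<Rightarrow> real) \<Rightarrow> 'b set \<Rightarrow> 'a \<Rightarrow> real" where
  "Q l A x = (\<Sum>b\<in>A. l b * ((X b x)\<^sup>2 - 1))"

lemma Z_all_moments: "e \<in> B \<Longrightarrow> all_moments M (\<lambda>x. l * ((X e x)\<^sup>2 - 1))"
  unfolding diff_conv_add_uminus
  by (intro all_moments_mult all_moments_add all_moments_const all_moments_power X_all_moments)

lemma Q_all_moments: "A \<subseteq> B \<Longrightarrow> all_moments M (Q l A)"
  unfolding Q_def[abs_def] by (intro all_moments_sum Z_all_moments) auto

text \<open>The factorisation against powers of linear forms supported off \<open>A\<close> is the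
  invariant of an induction on \<open>A\<close>. It must hold for all coefficients \<open>c\<close>:
  adding \<open>e\<close> uses it for \<open>A\<close> with an arbitrary coefficient at
  \<open>e\<close>. The second claim is the case of a trivial linear factor.\<close>

lemma Q_factor:
  assumes "A \<subseteq> B"
  shows "(\<forall>b\<in>A. c b = 0) \<Longrightarrow> expectation (\<lambda>x. Q l A x ^ i * L c x ^ n)
      = expectation (\<lambda>x. Q l A x ^ i) * expectation (\<lambda>x. L c x ^ n)"
    and "e \<in> B \<Longrightarrow> e \<notin> A \<Longrightarrow> expectation (\<lambda>x. Q l (insert e A) x ^ i)
      = (\<Sum>j\<le>i. real (i choose j) * (expectation (\<lambda>x. Q l A x ^ j)
          * expectation (\<lambda>x. (l e * ((X e x)\<^sup>2 - 1)) ^ (i - j))))"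
proof -
  have finA: "finite A" using assms fin finite_subset by blast
  have step: "expectation (\<lambda>x. Q l (insert e A) x ^ i * L c x ^ n)
      = (\<Sum>j\<le>i. real (i choose j) * (expectation (\<lambda>x. Q l A x ^ j)
          * expectation (\<lambda>x. (l e * ((X e x)\<^sup>2 - 1)) ^ (i - j)))) * expectation (\<lambda>x. L c x ^ n)"
    if A: "A \<subseteq> B" "finite A" and e: "e \<in> B" "e \<notin> A" "c e = 0" "\<forall>b\<in>A. c b = 0"
      and IH: "\<And>c i n. (\<forall>b\<in>A. c b = 0) \<Longrightarrow> expectation (\<lambda>x. Q l A x ^ i * L c x ^ n)
      = expectation (\<lambda>x. Q l A x ^ i) * expectation (\<lambda>x. L c x ^ n)"
    for A e c i n
  proof -
    note am = all_moments_integrable all_moments_mult all_moments_power Q_all_moments[OF A(1)]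
      X_all_moments[OF e(1)] lin_all_moments all_moments_const Z_all_moments[OF e(1)]
    define \<epsilon> where "\<epsilon> = expectation (\<lambda>x. L c x ^ n)"
    have fac: "expectation (\<lambda>x. Q l A x ^ j * X e x ^ k * L c x ^ n)
        = expectation (\<lambda>x. Q l A x ^ j) * expectation (\<lambda>x. X e x ^ k) * \<epsilon>" for j k
      unfolding \<epsilon>_def
      by (rule product_moment_insert) (use e in \<open>auto intro!: am IH\<close>)
    \<comment> \<open>Expanding the centred square into powers of \<open>X e\<close> reduces its
      factorisation to that of monomials, which \<open>product_moment_insert\<close>
      supplies.\<close>
    have Zexp: "(l e * ((X e x)\<^sup>2 - 1)) ^ m
        = (\<Sum>k\<le>m. (l e ^ m * real (m choose k) * (-1) ^ (m - k)) * X e x ^ (2 * k))" for x m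
      unfolding power_mult_distrib diff_conv_add_uminus binomial_ring sum_distrib_left
      by (intro sum.cong refl) (simp add: power_mult)
    have facZ: "expectation (\<lambda>x. Q l A x ^ j * (l e * ((X e x)\<^sup>2 - 1)) ^ m * L c x ^ n)
        = expectation (\<lambda>x. Q l A x ^ j) * expectation (\<lambda>x. (l e * ((X e x)\<^sup>2 - 1)) ^ m) * \<epsilon>" for j m
    proof -
      let ?a = "\<lambda>k. l e ^ m * real (m choose k) * (-1) ^ (m - k)"
      have "expectation (\<lambda>x. Q l A x ^ j * (l e * ((X e x)\<^sup>2 - 1)) ^ m * L c x ^ n)
          = expectation (\<lambda>x. \<Sum>k\<le>m. ?a k * (Q l A x ^ j * X e x ^ (2 * k) * L c x ^ n))"
        unfolding Zexp sum_distrib_left sum_distrib_right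
        by (intro Bochner_Integration.integral_cong refl sum.cong) (simp add: mult_ac)
      also have "\<dots> = (\<Sum>k\<le>m. ?a k * expectation (\<lambda>x. Q l A x ^ j * X e x ^ (2 * k) * L c x ^ n))"
        by (subst Bochner_Integration.integral_sum) (auto intro!: am integrable_mult_right)
      also have "\<dots> = expectation (\<lambda>x. Q l A x ^ j) * (\<Sum>k\<le>m. ?a k * expectation (\<lambda>x. X e x ^ (2 * k))) * \<epsilon>"
        unfolding fac sum_distrib_left sum_distrib_right by (intro sum.cong refl) (simp add: mult_ac)
      also have "(\<Sum>k\<le>m. ?a k * expectation (\<lambda>x. X e x ^ (2 * k)))
          = expectation (\<lambda>x. (l e * ((X e x)\<^sup>2 - 1)) ^ m)"
        unfolding Zexp
        by (subst Bochner_Integration.integral_sum) (auto intro!: am integrable_mult_right)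
      finally show ?thesis .
    qed
    have "Q l (insert e A) x = Q l A x + l e * ((X e x)\<^sup>2 - 1)" for x
      using A e by (simp add: Q_def)
    then have "expectation (\<lambda>x. Q l (insert e A) x ^ i * L c x ^ n)
        = expectation (\<lambda>x. \<Sum>j\<le>i. real (i choose j)
          * (Q l A x ^ j * (l e * ((X e x)\<^sup>2 - 1)) ^ (i - j) * L c x ^ n))"
      unfolding binomial_ring sum_distrib_right
      by (intro Bochner_Integration.integral_cong refl)
         (simp only: binomial_ring sum_distrib_right mult.assoc)
    also have "\<dots> = (\<Sum>j\<le>i. real (i choose j)
          * expectation (\<lambda>x. Q l A x ^ j * (l e * ((X e x)\<^sup>2 - 1)) ^ (i - j) * L c x ^ n))"
      by (subst Bochner_Integration.integral_sum) (auto intro!: am integrable_mult_right)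
    finally show ?thesis
      unfolding facZ sum_distrib_right \<epsilon>_def[symmetric] by (simp add: mult.assoc)
  qed
  have main: "expectation (\<lambda>x. Q l A x ^ i * L c x ^ n)
      = expectation (\<lambda>x. Q l A x ^ i) * expectation (\<lambda>x. L c x ^ n)" if "\<forall>b\<in>A. c b = 0" for c i n
    using finA assms that
  proof (induction A arbitrary: c i n)
    case empty
    then show ?case by (cases i) (simp_all add: Q_def prob_space)
  next
    case (insert e A)
    have *: "expectation (\<lambda>x. Q l (insert e A) x ^ i * L c x ^ n)
      = (\<Sum>j\<le>i. real (i choose j) * (expectation (\<lambda>x. Q l A x ^ j)
          * expectation (\<lambda>x. (l e * ((X e x)\<^sup>2 - 1)) ^ (i - j)))) * expectation (\<lambda>x. L c x ^ n)" for i n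
      by (rule step) (use insert in auto)
    show ?case using *[of i n] *[of i 0] by (simp add: prob_space)
  qed
  then show "(\<forall>b\<in>A. c b = 0) \<Longrightarrow> expectation (\<lambda>x. Q l A x ^ i * L c x ^ n)
      = expectation (\<lambda>x. Q l A x ^ i) * expectation (\<lambda>x. L c x ^ n)" by blast
  show "expectation (\<lambda>x. Q l (insert e A) x ^ i)
      = (\<Sum>j\<le>i. real (i choose j) * (expectation (\<lambda>x. Q l A x ^ j)
          * expectation (\<lambda>x. (l e * ((X e x)\<^sup>2 - 1)) ^ (i - j))))" if "e \<in> B" "e \<notin> A"
    using step[OF assms finA that, of "\<lambda>_. 0" i 0, OF _ _ main] by (simp add: prob_space)
qed

lemma moment_fps_insert:
  assumes "A \<subseteq> B" "e \<in> B" "e \<notin> A"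
  shows "moment_fps M (Q l (insert e A)) = moment_fps M (Q l A) * moment_fps M (\<lambda>x. l e * ((X e x)\<^sup>2 - 1))"
proof (rule fps_ext)
  fix i
  have "real (i choose j) * a / fact i = a / (fact j * fact (i - j))" if "j \<le> i" for j and a :: real
    using that by (simp add: binomial_fact)
  then show "fps_nth (moment_fps M (Q l (insert e A))) i
      = fps_nth (moment_fps M (Q l A) * moment_fps M (\<lambda>x. l e * ((X e x)\<^sup>2 - 1))) i"
    unfolding moment_fps_def fps_nth_Abs_fps fps_mult_nth Q_factor(2)[OF assms] sum_divide_distrib
    by (auto simp: atMost_atLeast0[symmetric] intro!: sum.cong)
qed

text \<open>Gaussian integration by parts, \<open>E[X g(X)] = E[g'(X)]\<close>, for
  \<open>g(x) = x^(2a+1) (x^2 - 1)^n\<close>, derived from the moments alone by induction on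
  \<open>n\<close>. For \<open>n = 0\<close> the truncated exponent \<open>n - 1\<close> is harmless
  because its factor vanishes.\<close>

lemma X_sq_stein:
  assumes "e \<in> B"
  shows "expectation (\<lambda>x. X e x ^ (2 * a + 2) * ((X e x)\<^sup>2 - 1) ^ n)
    = (2 * a + 1) * expectation (\<lambda>x. X e x ^ (2 * a) * ((X e x)\<^sup>2 - 1) ^ n)
      + 2 * n * expectation (\<lambda>x. X e x ^ (2 * a + 2) * ((X e x)\<^sup>2 - 1) ^ (n - 1))"
proof (induction n arbitrary: a)
  case 0
  show ?case using X_moment[OF assms, of "2 * a + 2"] X_moment[OF assms, of "2 * a"]
      gauss_moment_add2[of "2 * a"] by (simp del: power_Suc)
next
  case (Suc n)
  define f where "f a n = expectation (\<lambda>x. X e x ^ (2 * a) * ((X e x)\<^sup>2 - 1) ^ n)" for a n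
  have int: "integrable M (\<lambda>x. X e x ^ a * ((X e x)\<^sup>2 - 1) ^ n)" for a n
    using Z_all_moments[OF assms, of 1]
    by (intro all_moments_integrable all_moments_mult all_moments_power X_all_moments assms) simp
  have f_Suc: "f a (Suc n) = f (a + 1) n - f a n" for a n
  proof -
    have "f a (Suc n) = expectation (\<lambda>x. X e x ^ (2 * (a + 1)) * ((X e x)\<^sup>2 - 1) ^ n
        - X e x ^ (2 * a) * ((X e x)\<^sup>2 - 1) ^ n)"
      unfolding f_def
      by (intro Bochner_Integration.integral_cong refl) (simp add: power2_eq_square algebra_simps)
    then show ?thesis unfolding f_def by (simp only: Bochner_Integration.integral_diff[OF int int])
  qed
  have IH: "f (a + 1) n = (2 * a + 1) * f a n + 2 * n * f (a + 1) (n - 1)" for a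
    using Suc.IH[of a] by (simp add: f_def)
  have n: "real n * f (b + 1) (n - 1) = real n * (f b n + f b (n - 1))" for b
    using f_Suc[of b "n - 1"] by (cases n) auto
  have "f (a + 1) (Suc n) = (2 * a + 1) * f a (Suc n) + 2 * Suc n * f (a + 1) n"
    unfolding f_Suc[of "a + 1"] f_Suc[of a] IH[of "a + 1"] IH[of a]
    using n[of a] n[of "a + 1"] IH[of a] by (simp add: algebra_simps)
  then show ?case by (simp add: f_def)
qed

text \<open>The moment generating function is \<open>exp(-l t) (1 - 2 l t)^(-1/2)\<close>, with
  logarithmic derivative \<open>-l + l / (1 - 2 l t) = 2 l^2 t / (1 - 2 l t)\<close>. The formal
  proof multiplies through by \<open>1 - 2 l t\<close> and cancels it at the end.\<close>

lemma moment_fps_single: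
  assumes "e \<in> B"
  shows "fps_deriv (moment_fps M (\<lambda>x. l * ((X e x)\<^sup>2 - 1)))
    = cumulant_deriv_fps l * moment_fps M (\<lambda>x. l * ((X e x)\<^sup>2 - 1))"
proof -
  define m where "m = moment_fps M (\<lambda>x. l * ((X e x)\<^sup>2 - 1))"
  define z where "z n = expectation (\<lambda>x. ((X e x)\<^sup>2 - 1) ^ n)" for n
  have int: "integrable M (\<lambda>x. ((X e x)\<^sup>2 - 1) ^ n)" for n
    using Z_all_moments[OF assms, of 1]
    by (intro all_moments_integrable all_moments_power) simp
  have y: "expectation (\<lambda>x. (X e x)\<^sup>2 * ((X e x)\<^sup>2 - 1) ^ n) = z (Suc n) + z n" for n
  proof -
    have "expectation (\<lambda>x. (X e x)\<^sup>2 * ((X e x)\<^sup>2 - 1) ^ n)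
        = expectation (\<lambda>x. ((X e x)\<^sup>2 - 1) ^ Suc n + ((X e x)\<^sup>2 - 1) ^ n)"
      by (intro Bochner_Integration.integral_cong refl) (simp add: algebra_simps)
    then show ?thesis unfolding z_def by (simp only: Bochner_Integration.integral_add[OF int int])
  qed
  \<comment> \<open>Integration by parts with \<open>a = 0\<close>, after splitting
    \<open>X^2\<close> as \<open>(X^2 - 1) + 1\<close>.\<close>
  have z_Suc: "z (Suc n) = 2 * n * (z n + z (n - 1))" for n
  proof -
    have "expectation (\<lambda>x. (X e x)\<^sup>2 * ((X e x)\<^sup>2 - 1) ^ n)
      = z n + 2 * n * expectation (\<lambda>x. (X e x)\<^sup>2 * ((X e x)\<^sup>2 - 1) ^ (n - 1))"
      using X_sq_stein[OF assms, of 0 n] by (simp add: power2_eq_square z_def)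
    then show ?thesis unfolding y by (cases n) auto
  qed
  have nth: "fps_nth m n = l ^ n * z n / fact n" for n
    by (simp add: m_def moment_fps_def z_def power_mult_distrib)
  let ?u = "1 - fps_const (2 * l) * fps_X :: real fps"
  have "?u * fps_deriv m = fps_const (2 * l\<^sup>2) * (fps_X * m)"
  proof (rule fps_ext)
    fix n
    show "fps_nth (?u * fps_deriv m) n = fps_nth (fps_const (2 * l\<^sup>2) * (fps_X * m)) n"
    proof (cases n)
      case 0
      then show ?thesis using z_Suc[of 0] by (simp add: left_diff_distrib mult.assoc nth)
    next
      case (Suc k)
      have "z (Suc (Suc k)) = 2 * Suc k * (z (Suc k) + z k)" using z_Suc[of "Suc k"] by simp
      then show ?thesis
        by (simp add: left_diff_distrib mult.assoc nth Suc power2_eq_square divide_simps) (simp add: algebra_simps)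
    qed
  qed
  moreover have "?u * cumulant_deriv_fps l = fps_const (2 * l\<^sup>2) * fps_X"
  proof (rule fps_ext)
    fix n
    show "fps_nth (?u * cumulant_deriv_fps l) n = fps_nth (fps_const (2 * l\<^sup>2) * fps_X) n"
      by (cases n; cases "n - 1")
         (auto simp: left_diff_distrib mult.assoc cumulant_deriv_fps_def power2_eq_square)
  qed
  ultimately have "?u * fps_deriv m = ?u * (cumulant_deriv_fps l * m)"
    by (simp add: mult.assoc[symmetric])
  moreover have "?u \<noteq> 0"
  proof
    assume "?u = 0"
    then have "fps_nth ?u 0 = 0" by simp
    then show False by simp
  qed
  ultimately have "fps_deriv m = cumulant_deriv_fps l * m" by simp
  then show ?thesis by (simp only: m_def)
qed

text \<open>Logarithmic derivatives add when series are multiplied; stated as a product, no division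
  of series occurs.\<close>

lemma moment_fps_Q:
  "fps_deriv (moment_fps M (Q l B)) = (\<Sum>b\<in>B. cumulant_deriv_fps (l b)) * moment_fps M (Q l B)"
proof -
  have "fps_deriv (moment_fps M (Q l A)) = (\<Sum>b\<in>A. cumulant_deriv_fps (l b)) * moment_fps M (Q l A)"
    if "finite A" "A \<subseteq> B" for A
    using that
  proof (induction A)
    case empty
    have "moment_fps M (Q l {}) = 1"
    proof (rule fps_ext)
      show "fps_nth (moment_fps M (Q l {})) n = fps_nth 1 n" for n
        by (cases n) (simp_all add: moment_fps_def Q_def prob_space)
    qed
    then show ?case by simp
  next
    case (insert e A)
    then have "A \<subseteq> B" "e \<in> B" by auto
    then show ?case
      unfolding sum.insert[OF insert.hyps] moment_fps_insert[OF \<open>A \<subseteq> B\<close> \<open>e \<in> B\<close> insert.hyps(2)]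
        fps_deriv_mult moment_fps_single[OF \<open>e \<in> B\<close>] insert.IH[OF \<open>A \<subseteq> B\<close>]
      by (simp only: distrib_left distrib_right mult_ac add_ac)
  qed
  then show ?thesis using fin by blast
qed

end

text \<open>Scaling reduces the nondegenerate case to the standard one. In the degenerate case the
  mean forces the point mass to sit at 0, and the formula reads \<open>0 ^ n\<close>, which is 1 for
  \<open>n = 0\<close>.\<close>

lemma gaussian_rv_moments:
  assumes "prob_space M" "gaussian_rv M X" "integral\<^sup>L M X = 0"
  shows "all_moments M X"
    and "(\<integral>x. X x ^ n \<partial>M) = gauss_moment n * sqrt (\<integral>x. (X x)\<^sup>2 \<partial>M) ^ n"
proof -
  interpret prob_space M by fact
  have meas [measurable]: "X \<in> borel_measurable M" using assms by (simp add: gaussian_rv_def)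
  from assms(2) obtain m where m: "distr M borel X = return borel m \<or>
      (\<exists>\<sigma>>0. distr M borel X = density lborel (normal_density m \<sigma>))"
    by (auto simp: gaussian_rv_def)
  have result: "all_moments M X \<and>
    (\<forall>n. (\<integral>x. X x ^ n \<partial>M) = gauss_moment n * sqrt (\<integral>x. (X x)\<^sup>2 \<partial>M) ^ n)"
    using m
  proof (elim disjE exE conjE)
    assume d: "distr M borel X = return borel m"
    have "AE y in distr M borel X. y = m"
      unfolding d by (subst AE_return) auto
    then have ae: "AE x in M. X x = m" by (subst (asm) AE_distr_iff) auto
    have "integral\<^sup>L M X = (\<integral>x. m \<partial>M)" by (rule integral_cong_AE) (use ae in auto)
    then have "m = 0" using assms(3) by (simp add: prob_space)
    have aep: "AE x in M. X x ^ n = 0 ^ n" for n using ae \<open>m = 0\<close> by auto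
    have "integrable M (\<lambda>x. X x ^ n)" for n
      by (subst integrable_cong_AE[where g = "\<lambda>_. 0 ^ n"]) (use aep in auto)
    moreover have "(\<integral>x. X x ^ n \<partial>M) = 0 ^ n" for n
      by (subst integral_cong_AE[where g = "\<lambda>_. 0 ^ n"]) (use aep in \<open>auto simp: prob_space\<close>)
    ultimately show ?thesis by (auto simp: all_moments_def gauss_moment_def power_0_left)
  next
    fix \<sigma> :: real assume \<sigma>: "\<sigma> > 0" and d: "distr M borel X = density lborel (normal_density m \<sigma>)"
    have eq: "(\<integral>x. f (X x) \<partial>M) = (\<integral>y. normal_density m \<sigma> y * f y \<partial>lborel)"
      if [measurable]: "f \<in> borel_measurable borel" for f :: "real \<Rightarrow> real"
    proof -
      have "(\<integral>x. f (X x) \<partial>M) = (\<integral>y. f y \<partial>distr M borel X)" by (simp add: integral_distr)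
      then show ?thesis unfolding d by (simp add: integral_density)
    qed
    have int: "integrable M (\<lambda>x. f (X x)) \<longleftrightarrow> integrable lborel (\<lambda>y. normal_density m \<sigma> y * f y)"
      if [measurable]: "f \<in> borel_measurable borel" for f :: "real \<Rightarrow> real"
    proof -
      have "integrable M (\<lambda>x. f (X x)) \<longleftrightarrow> integrable (distr M borel X) f"
        by (simp add: integrable_distr_eq)
      then show ?thesis unfolding d by (simp add: integrable_density)
    qed
    have "m = 0" using eq[of "\<lambda>y. y"] assms(3) integral_normal_moment_nz_1[OF \<sigma>, of m] by simp
    have "integrable M (\<lambda>x. X x ^ n)" for n
      using int[of "\<lambda>y. y ^ n"] integrable_normal_moment[OF \<sigma>, of m n] \<open>m = 0\<close> by simp
    then have am: "all_moments M X" by (simp add: all_moments_def)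
    have mom: "(\<integral>x. X x ^ n \<partial>M) = gauss_moment n * \<sigma> ^ n" for n
    proof (cases "even n")
      case True
      then obtain k where "n = 2 * k" by blast
      then show ?thesis
        using eq[of "\<lambda>y. y ^ n"] integral_normal_moment_even[OF \<sigma>, of m k] \<open>m = 0\<close>
        by (simp add: gauss_moment_def power_divide power_mult)
    next
      case False
      then obtain k where "n = 2 * k + 1" by (blast elim: oddE)
      then show ?thesis
        using eq[of "\<lambda>y. y ^ n"] integral_normal_moment_odd[OF \<sigma>, of m k] \<open>m = 0\<close>
        by (simp add: gauss_moment_def)
    qed
    have "sqrt (\<integral>x. (X x)\<^sup>2 \<partial>M) = \<sigma>" using mom[of 2] \<sigma> by (simp add: gauss_moment_def)
    then show ?thesis using am mom by simp
  qed
  show "all_moments M X" by (rule conjunct1[OF result])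
  show "(\<integral>x. X x ^ n \<partial>M) = gauss_moment n * sqrt (\<integral>x. (X x)\<^sup>2 \<partial>M) ^ n"
    by (rule conjunct2[OF result, THEN spec])
qed

section \<open>Gaussian families and quadratic forms of an isonormal process\<close>

locale isonormal_process =
  fixes M :: "'a measure" and W :: "'h::{real_inner, polish_space} \<Rightarrow> 'a \<Rightarrow> real"
  assumes isonormal: "isonormal M W"
begin

sublocale prob_space M using isonormal by (simp add: isonormal_def)

lemma W_mean: "expectation (W h) = 0" and W_cov: "expectation (\<lambda>x. W g x * W h x) = g \<bullet> h"
  using isonormal by (auto simp: isonormal_def)

lemma W_gaussian: "finite S \<Longrightarrow> gaussian_rv M (\<lambda>x. \<Sum>h\<in>S. c h * W h x)"
  using isonormal by (auto simp: isonormal_def)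

lemma W_all_moments: "all_moments M (W h)"
proof -
  have "gaussian_rv M (W h)" using W_gaussian[of "{h}" "\<lambda>_. 1"] by simp
  then show ?thesis using gaussian_rv_moments(1)[OF prob_space_axioms] W_mean by blast
qed

lemma W_combination_mean: "expectation (\<lambda>x. \<Sum>h\<in>S. c h * W h x) = 0"
  by (subst Bochner_Integration.integral_sum)
     (auto intro!: integrable_mult_right all_moments_integrable W_all_moments simp: W_mean)

lemma W_combination_square:
  "expectation (\<lambda>x. (\<Sum>h\<in>S. c h * W h x)\<^sup>2) = (norm (\<Sum>h\<in>S. c h *\<^sub>R h))\<^sup>2"
proof -
  have int: "integrable M (\<lambda>x. c g * c h * (W g x * W h x))" for g h
    by (intro integrable_mult_right all_moments_integrable all_moments_mult W_all_moments)
  have "expectation (\<lambda>x. (\<Sum>h\<in>S. c h * W h x)\<^sup>2)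
      = expectation (\<lambda>x. \<Sum>g\<in>S. \<Sum>h\<in>S. c g * c h * (W g x * W h x))"
    unfolding power2_eq_square sum_product by (simp add: mult_ac)
  also have "\<dots> = (\<Sum>g\<in>S. \<Sum>h\<in>S. c g * c h * (g \<bullet> h))"
    by (subst Bochner_Integration.integral_sum, intro Bochner_Integration.integrable_sum int,
        subst Bochner_Integration.integral_sum, intro int) (simp add: W_cov)
  also have "\<dots> = (norm (\<Sum>h\<in>S. c h *\<^sub>R h))\<^sup>2"
    unfolding power2_norm_eq_inner inner_sum_left inner_sum_right
    by (intro sum.cong refl) (simp add: inner_commute)
  finally show ?thesis .
qed

lemma norm_orthonormal_combination:
  assumes "orthonormal B"
  shows "(norm (\<Sum>h\<in>B. c h *\<^sub>R h))\<^sup>2 = (\<Sum>h\<in>B. (c h)\<^sup>2)"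
  unfolding power2_norm_eq_inner inner_sum_left
  by (intro sum.cong refl) (simp add: orthonormal_inner_sum[OF assms] power2_eq_square)

lemma gaussian_family:
  assumes "orthonormal B"
  shows "gaussian_family M B W"
proof
  show fB: "finite B" using assms by (simp add: orthonormal_def)
  show "all_moments M (\<lambda>x. \<Sum>b\<in>B. c b * W b x)" for c
    by (rule gaussian_rv_moments(1)[OF prob_space_axioms W_gaussian[OF fB] W_combination_mean])
  show "expectation (\<lambda>x. (\<Sum>b\<in>B. c b * W b x) ^ n) = gauss_moment n * sqrt (\<Sum>b\<in>B. (c b)\<^sup>2) ^ n" for c n
    by (subst gaussian_rv_moments(2)[OF prob_space_axioms W_gaussian[OF fB] W_combination_mean])
       (simp add: W_combination_square norm_orthonormal_combination[OF assms])
qed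

text \<open>Linearity of \<open>W\<close> is not part of \<open>isonormal\<close> but follows almost
  surely from the covariance: the mean square of the difference is
  \<open>|h|^2 - 2 |h|^2 + |h|^2 = 0\<close>.\<close>

lemma W_expand_AE:
  assumes "orthonormal B" "h \<in> span B"
  shows "AE x in M. W h x = (\<Sum>b\<in>B. (h \<bullet> b) * W b x)"
proof -
  have fB: "finite B" using assms by (simp add: orthonormal_def)
  define Y where "Y x = (\<Sum>b\<in>B. (h \<bullet> b) * W b x)" for x
  have h: "(\<Sum>b\<in>B. (h \<bullet> b) *\<^sub>R b) = h" using orthonormal_expand_span[OF assms] by simp
  have Ym: "all_moments M Y"
    unfolding Y_def[abs_def] by (intro all_moments_sum all_moments_mult all_moments_const W_all_moments)
  have i1: "integrable M (\<lambda>x. (W h x)\<^sup>2)" and i2: "integrable M (\<lambda>x. 2 * (W h x * Y x))"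
    and i3: "integrable M (\<lambda>x. (Y x)\<^sup>2)"
    by (intro integrable_mult_right all_moments_integrable all_moments_mult all_moments_power W_all_moments Ym)+
  have "expectation (\<lambda>x. W h x * Y x) = (\<Sum>b\<in>B. (h \<bullet> b) * (h \<bullet> b))"
  proof -
    have "expectation (\<lambda>x. W h x * Y x) = expectation (\<lambda>x. \<Sum>b\<in>B. (h \<bullet> b) * (W h x * W b x))"
      by (simp add: Y_def sum_distrib_left mult_ac)
    also have "\<dots> = (\<Sum>b\<in>B. (h \<bullet> b) * (h \<bullet> b))"
      by (subst Bochner_Integration.integral_sum)
         (auto intro!: integrable_mult_right all_moments_integrable all_moments_mult W_all_moments simp: W_cov)
    finally show ?thesis .
  qed
  also have "\<dots> = (norm h)\<^sup>2"
    using norm_orthonormal_combination[OF assms(1), of "\<lambda>b. h \<bullet> b"] h by (simp add: power2_eq_square)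
  finally have e2: "expectation (\<lambda>x. W h x * Y x) = (norm h)\<^sup>2" .
  have e1: "expectation (\<lambda>x. (W h x)\<^sup>2) = (norm h)\<^sup>2"
    using W_cov[of h h] by (simp add: power2_eq_square dot_square_norm)
  have e3: "expectation (\<lambda>x. (Y x)\<^sup>2) = (norm h)\<^sup>2"
    unfolding Y_def W_combination_square h ..
  have sq: "(W h x - Y x)\<^sup>2 = (W h x)\<^sup>2 - 2 * (W h x * Y x) + (Y x)\<^sup>2" for x
    by (simp add: power2_eq_square algebra_simps)
  have int: "integrable M (\<lambda>x. (W h x - Y x)\<^sup>2)"
    unfolding sq by (intro Bochner_Integration.integrable_add Bochner_Integration.integrable_diff i1 i2 i3)
  have "expectation (\<lambda>x. (W h x - Y x)\<^sup>2) = 0"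
    unfolding sq using i1 i2 i3 by (simp add: e1 e2 e3)
  then have "AE x in M. (W h x - Y x)\<^sup>2 = 0"
    using integral_nonneg_eq_0_iff_AE[OF int] by simp
  then show ?thesis unfolding Y_def by eventually_elim simp
qed

lemma quadratic_form_normal_form:
  assumes "finite S" "\<And>h. h \<in> S \<Longrightarrow> norm h = 1"
  obtains B l where "orthonormal B"
    "AE x in M. (\<Sum>h\<in>S. c h * ((W h x)\<^sup>2 - 1)) = (\<Sum>b\<in>B. l b * ((W b x)\<^sup>2 - 1))"
proof -
  obtain B where B: "orthonormal B" "S \<subseteq> span B"
    and diag: "\<And>a b. a \<in> B \<Longrightarrow> b \<in> B \<Longrightarrow> a \<noteq> b \<Longrightarrow> (\<Sum>h\<in>S. c h * (h \<bullet> a) * (h \<bullet> b)) = 0"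
    using quadratic_form_diagonalise[OF assms(1)] by metis
  have fB: "finite B" using B by (simp add: orthonormal_def)
  define l where "l b = (\<Sum>h\<in>S. c h * (h \<bullet> b) * (h \<bullet> b))" for b
  have form: "(\<Sum>h\<in>S. c h * (\<Sum>b\<in>B. (h \<bullet> b) * y b)\<^sup>2) = (\<Sum>b\<in>B. l b * (y b)\<^sup>2)" for y :: "'h \<Rightarrow> real"
  proof -
    have "(\<Sum>h\<in>S. c h * (\<Sum>b\<in>B. (h \<bullet> b) * y b)\<^sup>2)
        = (\<Sum>h\<in>S. \<Sum>a\<in>B. \<Sum>b\<in>B. c h * (h \<bullet> a) * (h \<bullet> b) * (y a * y b))"
      unfolding power2_eq_square sum_product
      unfolding sum_distrib_left by (simp only: mult_ac)
    also have "\<dots> = (\<Sum>a\<in>B. \<Sum>b\<in>B. \<Sum>h\<in>S. c h * (h \<bullet> a) * (h \<bullet> b) * (y a * y b))"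
      by (subst sum.swap) (intro sum.cong refl sum.swap)
    also have "\<dots> = (\<Sum>a\<in>B. \<Sum>b\<in>B. (\<Sum>h\<in>S. c h * (h \<bullet> a) * (h \<bullet> b)) * (y a * y b))"
      by (simp only: sum_distrib_right)
    also have "\<dots> = (\<Sum>a\<in>B. \<Sum>b\<in>B. if b = a then l a * (y a)\<^sup>2 else 0)"
      by (intro sum.cong refl) (auto simp: l_def power2_eq_square diag)
    finally show ?thesis using fB by simp
  qed
  \<comment> \<open>Equality of traces. It matches the constants subtracted from the squares on both
    sides, and rests on every \<open>h\<close> in \<open>S\<close> being a unit vector.\<close>
  have "(\<Sum>b\<in>B. l b) = (\<Sum>h\<in>S. c h)"
  proof -
    have "(\<Sum>b\<in>B. l b) = (\<Sum>h\<in>S. \<Sum>b\<in>B. c h * (h \<bullet> b)\<^sup>2)"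
      unfolding l_def by (subst sum.swap) (simp add: power2_eq_square mult.assoc)
    also have "\<dots> = (\<Sum>h\<in>S. c h)"
    proof (rule sum.cong[OF refl])
      fix h assume "h \<in> S"
      then have "(\<Sum>b\<in>B. (h \<bullet> b)\<^sup>2) = (norm h)\<^sup>2"
        using norm_orthonormal_combination[OF B(1), of "\<lambda>b. h \<bullet> b"] orthonormal_expand_span[OF B(1), of h] B(2)
        by (metis subsetD)
      then show "(\<Sum>b\<in>B. c h * (h \<bullet> b)\<^sup>2) = c h"
        using assms(2)[OF \<open>h \<in> S\<close>] by (simp flip: sum_distrib_left)
    qed
    finally show ?thesis .
  qed
  moreover have "AE x in M. \<forall>h\<in>S. W h x = (\<Sum>b\<in>B. (h \<bullet> b) * W b x)"
    by (intro AE_finite_allI assms(1) W_expand_AE[OF B(1)]) (use B(2) in auto)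
  ultimately have "AE x in M. (\<Sum>h\<in>S. c h * ((W h x)\<^sup>2 - 1)) = (\<Sum>b\<in>B. l b * ((W b x)\<^sup>2 - 1))"
    by (auto elim!: eventually_mono simp: right_diff_distrib sum_subtractf form)
  then show ?thesis using that[OF B(1)] by blast
qed

end

section \<open>Power sums of eigenvalues\<close>

text \<open>The index sets may change with \<open>n\<close>, and the limits \<open>P r\<close> need
  not be presented as power sums. Exponent 1 is excluded because traces need not converge. The
  normalisation corresponds to variance \<open>2 P 2 = 1\<close> and fourth cumulant
  \<open>48 P 4 >= 6\<close>.\<close>

locale spectral_limit =
  fixes B :: "nat \<Rightarrow> 'b set" and lam :: "nat \<Rightarrow> 'b \<Rightarrow> real" and P :: "nat \<Rightarrow> real"
  assumes fin: "finite (B n)"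
    and lim: "2 \<le> r \<Longrightarrow> (\<lambda>n. \<Sum>b\<in>B n. lam n b ^ r) \<longlonglongrightarrow> P r"
    and P2: "P 2 = 1/2" and P4: "P 4 \<ge> 1/8"
begin

abbreviation p :: "nat \<Rightarrow> nat \<Rightarrow> real" where
  "p n r \<equiv> \<Sum>b\<in>B n. lam n b ^ r"

text \<open>Each approximating expression is a sum of squares \<open>x^(2j) (4 x^2 - 1)^2\<close>
  over the eigenvalues \<open>x\<close>. Up to the factor \<open>4^j\<close>, the limit is the
  second difference of \<open>4^j P (2j)\<close>.\<close>

lemma even_convex:
  assumes "1 \<le> j"
  shows "0 \<le> 16 * P (2 * j + 4) - 8 * P (2 * j + 2) + P (2 * j)"
proof (rule LIMSEQ_le_const)
  show "(\<lambda>n. 16 * p n (2 * j + 4) - 8 * p n (2 * j + 2) + p n (2 * j))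
      \<longlonglongrightarrow> 16 * P (2 * j + 4) - 8 * P (2 * j + 2) + P (2 * j)"
    by (intro tendsto_intros lim) (use assms in auto)
  have "16 * p n (2 * j + 4) - 8 * p n (2 * j + 2) + p n (2 * j)
      = (\<Sum>b\<in>B n. (lam n b ^ j * (4 * (lam n b)\<^sup>2 - 1))\<^sup>2)" for n
    unfolding sum_distrib_left sum_subtractf[symmetric] sum.distrib[symmetric]
    by (intro sum.cong refl)
       (simp add: power_mult_distrib power_add power_mult power2_eq_square power4_eq_xxxx algebra_simps)
  then show "\<exists>N. \<forall>n\<ge>N. 0 \<le> 16 * p n (2 * j + 4) - 8 * p n (2 * j + 2) + p n (2 * j)"
    by (auto intro!: sum_nonneg)
qed

lemma even_lower:
  assumes "1 \<le> j"
  shows "2 / 4 ^ j \<le> P (2 * j)"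
proof -
  \<comment> \<open>Monotonicity is carried along with the bound, since convexity passes a
    nonnegative increment on to the next index. Both start from \<open>4 P 2 = 2\<close> and
    \<open>16 P 4 >= 2\<close>.\<close>
  have "2 \<le> 4 ^ j * P (2 * j) \<and> 4 ^ j * P (2 * j) \<le> 4 ^ Suc j * P (2 * Suc j)"
    using assms
  proof (induction j rule: nat_induct_at_least)
    case base
    show ?case using P2 P4 by simp
  next
    case (Suc j)
    define x y z where "x = 4 ^ j * P (2 * j)" "y = 4 ^ j * (4 * P (2 * j + 2))"
      "z = 4 ^ j * (16 * P (2 * j + 4))"
    have "0 \<le> 4 ^ j * (16 * P (2 * j + 4) - 8 * P (2 * j + 2) + P (2 * j))"
      by (intro mult_nonneg_nonneg even_convex Suc.hyps) simp
    then have "0 \<le> z - 2 * y + x" by (simp add: x_y_z_def algebra_simps)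
    moreover have "2 \<le> x" "x \<le> y" using Suc.IH by (simp_all add: x_y_z_def)
    ultimately have "2 \<le> y \<and> y \<le> z" by linarith
    moreover have "4 ^ Suc j * P (2 * Suc j) = y" "4 ^ Suc (Suc j) * P (2 * Suc (Suc j)) = z"
      by (simp_all add: x_y_z_def eval_nat_numeral)
    ultimately show ?case by simp
  qed
  then show ?thesis by (simp add: field_simps)
qed

text \<open>The largest eigenvalue in absolute value carries at least half of the sum of squares, because
  \<open>p\<^sub>4 \<le> a\<^sup>2 p\<^sub>2\<close>; all the others together can then not outweigh it in an odd power sum.\<close>

lemma odd_power_sum_lower:
  fixes l :: "'c \<Rightarrow> real"
  assumes "finite A" "A \<noteq> {}"
  shows "\<exists>s\<in>{1, -1}. \<forall>k\<ge>3. odd k \<longrightarrow>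
    s * (\<Sum>b\<in>A. l b ^ k) \<ge> sqrt ((\<Sum>b\<in>A. l b ^ 4) / (\<Sum>b\<in>A. l b ^ 2)) ^ k
      - sqrt ((\<Sum>b\<in>A. l b ^ 2) - (\<Sum>b\<in>A. l b ^ 4) / (\<Sum>b\<in>A. l b ^ 2)) ^ k"
proof -
  define p2 where "p2 = (\<Sum>b\<in>A. l b ^ 2)"
  define q where "q = (\<Sum>b\<in>A. l b ^ 4) / p2"
  obtain m where m: "m \<in> A" "\<And>b. b \<in> A \<Longrightarrow> \<bar>l b\<bar> \<le> \<bar>l m\<bar>"
  proof -
    have "Max ((\<lambda>b. \<bar>l b\<bar>) ` A) \<in> (\<lambda>b. \<bar>l b\<bar>) ` A" using assms by (intro Max_in) auto
    then obtain m where "m \<in> A" "Max ((\<lambda>b. \<bar>l b\<bar>) ` A) = \<bar>l m\<bar>" by auto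
    then show ?thesis using that[of m] assms by (metis Max_ge finite_imageI image_eqI)
  qed
  define s :: real where "s = (if l m \<ge> 0 then 1 else -1)"
  have sm: "s * l m ^ k = \<bar>l m\<bar> ^ k" if "odd k" for k
    using that by (auto simp: s_def power_minus_odd[symmetric] simp del: power_minus_odd)
  define c2 where "c2 = (\<Sum>b\<in>A - {m}. l b ^ 2)"
  have p2_split: "p2 = (l m)\<^sup>2 + c2"
    unfolding p2_def c2_def using assms m by (simp add: sum.remove)
  have c2_0: "c2 \<ge> 0" unfolding c2_def by (intro sum_nonneg) auto
  have "(\<Sum>b\<in>A. l b ^ 4) \<le> (\<Sum>b\<in>A. (l m)\<^sup>2 * (l b)\<^sup>2)"
  proof (rule sum_mono)
    fix b assume "b \<in> A"
    have "(l b)\<^sup>2 \<le> (l m)\<^sup>2" using m(2)[OF \<open>b \<in> A\<close>] by (simp add: abs_le_square_iff)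
    then have "(l b)\<^sup>2 * (l b)\<^sup>2 \<le> (l m)\<^sup>2 * (l b)\<^sup>2" by (intro mult_right_mono) auto
    then show "l b ^ 4 \<le> (l m)\<^sup>2 * (l b)\<^sup>2" by (simp flip: power_add)
  qed
  then have p4: "(\<Sum>b\<in>A. l b ^ 4) \<le> (l m)\<^sup>2 * p2" by (simp add: p2_def sum_distrib_left)
  have q_le: "q \<le> (l m)\<^sup>2"
  \<comment> \<open>When all eigenvalues vanish, division by zero makes \<open>q\<close> equal to
    0.\<close>
  proof (cases "p2 = 0")
    case False
    then have "p2 > 0" using p2_split c2_0 by (smt (verit) zero_le_power2)
    then show ?thesis using p4 by (simp add: q_def divide_le_eq)
  qed (simp add: q_def)
  have "c2 \<le> p2 - q" using q_le p2_split by simp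
  have q0: "0 \<le> q" unfolding q_def p2_def by (intro divide_nonneg_nonneg sum_nonneg) auto
  have "s * (\<Sum>b\<in>A. l b ^ k) \<ge> sqrt q ^ k - sqrt (p2 - q) ^ k" if k: "k \<ge> 3" "odd k" for k
  proof -
    have k2: "k = (k - 2) + 2" using k by simp
    \<comment> \<open>Of the \<open>k\<close> factors, \<open>k - 2\<close> are bounded by
      \<open>sqrt c2\<close>; the remaining squares add up to \<open>c2\<close>.\<close>
    have rest: "(\<Sum>b\<in>A - {m}. \<bar>l b\<bar> ^ k) \<le> sqrt c2 ^ k"
    proof -
      have "\<bar>l b\<bar> ^ k \<le> sqrt c2 ^ (k - 2) * (l b)\<^sup>2" if "b \<in> A - {m}" for b
      proof -
        have "(l b)\<^sup>2 \<le> c2" unfolding c2_def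
          using assms that by (intro member_le_sum) auto
        then have "\<bar>l b\<bar> \<le> sqrt c2" by (simp add: real_le_rsqrt)
        then have "\<bar>l b\<bar> ^ (k - 2) * \<bar>l b\<bar> ^ 2 \<le> sqrt c2 ^ (k - 2) * \<bar>l b\<bar> ^ 2"
          by (intro mult_right_mono power_mono) auto
        moreover have "\<bar>l b\<bar> ^ (k - 2) * \<bar>l b\<bar> ^ 2 = \<bar>l b\<bar> ^ k"
          by (metis k2 power_add)
        ultimately show ?thesis by simp
      qed
      then have "(\<Sum>b\<in>A - {m}. \<bar>l b\<bar> ^ k) \<le> (\<Sum>b\<in>A - {m}. sqrt c2 ^ (k - 2) * (l b)\<^sup>2)"
        by (rule sum_mono)
      also have "\<dots> = sqrt c2 ^ (k - 2) * c2"
        by (simp add: c2_def sum_distrib_left)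
      also have "\<dots> = sqrt c2 ^ (k - 2) * sqrt c2 ^ 2" using c2_0 by simp
      also have "\<dots> = sqrt c2 ^ k" by (metis k2 power_add)
      finally show ?thesis .
    qed
    have "\<bar>s * (\<Sum>b\<in>A - {m}. l b ^ k)\<bar> \<le> (\<Sum>b\<in>A - {m}. \<bar>l b\<bar> ^ k)"
      using sum_abs[of "\<lambda>b. l b ^ k" "A - {m}"] by (simp add: s_def power_abs abs_mult)
    moreover have "s * (\<Sum>b\<in>A. l b ^ k) = \<bar>l m\<bar> ^ k + s * (\<Sum>b\<in>A - {m}. l b ^ k)"
      using assms m sm[OF k(2)] by (simp add: sum.remove distrib_left)
    moreover have "sqrt q ^ k \<le> \<bar>l m\<bar> ^ k"
      using q_le q0 by (intro power_mono) (auto simp: real_le_lsqrt)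
    moreover have "sqrt c2 ^ k \<le> sqrt (p2 - q) ^ k"
      using \<open>c2 \<le> p2 - q\<close> c2_0 by (intro power_mono) auto
    ultimately show ?thesis using rest by linarith
  qed
  moreover have "s \<in> {1, -1}" by (simp add: s_def)
  ultimately show ?thesis unfolding q_def p2_def by blast
qed

text \<open>At a finite stage the condition on the fourth power sum may fail, so the bound
  \<open>g\<close> there can be negative; only its limit is nonnegative. The admissible sign may
  also depend on the stage. A sign admissible infinitely often survives in the limit, since a
  strictly negative \<open>s * P k\<close> would violate the bound at all late stages.\<close>

lemma odd_sign: "\<exists>s\<in>{1, -1}. \<forall>k\<ge>3. odd k \<longrightarrow> 0 \<le> s * P k"
proof -
  define g where "g n k = sqrt (p n 4 / p n 2) ^ k - sqrt (p n 2 - p n 4 / p n 2) ^ k" for n k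
  define ok where "ok n s \<longleftrightarrow> (\<forall>k\<ge>3. odd k \<longrightarrow> s * p n k \<ge> g n k)" for n and s :: real
  have "eventually (\<lambda>n. p n 2 > 0) sequentially"
    using lim[of 2] P2 by (intro order_tendstoD(1)) auto
  then have "eventually (\<lambda>n. ok n 1 \<or> ok n (-1)) sequentially"
  proof eventually_elim
    case (elim n)
    then have "B n \<noteq> {}" by auto
    then show ?case using odd_power_sum_lower[OF fin[of n], of "lam n"]
      unfolding ok_def g_def by blast
  qed
  \<comment> \<open>Since \<open>ok\<close> quantifies over all odd exponents, the sign selected
    here is common to all of them.\<close>
  then have "frequently (\<lambda>n. ok n 1 \<or> ok n (-1)) sequentially"
    by (rule eventually_frequently[OF sequentially_bot])
  then obtain s where s: "s \<in> {1, -1}" "frequently (\<lambda>n. ok n s) sequentially"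
    unfolding frequently_disj_iff by blast
  have "0 \<le> s * P k" if k: "k \<ge> 3" "odd k" for k
  proof (rule ccontr)
    assume neg: "\<not> 0 \<le> s * P k"
    have glim: "(\<lambda>n. g n k) \<longlonglongrightarrow> sqrt (P 4 / P 2) ^ k - sqrt (P 2 - P 4 / P 2) ^ k"
      unfolding g_def by (intro tendsto_intros lim) (use P2 in auto)
    \<comment> \<open>With \<open>P 2 = 1/2\<close> the radicands are \<open>1/2 - 2 P 4\<close> and
      \<open>2 P 4\<close>, and \<open>P 4 >= 1/8\<close> is exactly their order. A negative
      radicand is harmless: \<open>sqrt\<close> keeps its sign and so does the odd power.\<close>
    have "sqrt (P 2 - P 4 / P 2) ^ k \<le> sqrt (P 4 / P 2) ^ k"
    proof (cases "P 2 - P 4 / P 2 \<ge> 0")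
      case True
      have "P 4 / P 2 = 2 * P 4" unfolding P2 by simp
      then show ?thesis using P2 P4 True by (intro power_mono) (simp_all only: real_sqrt_le_iff real_sqrt_ge_0_iff)
    next
      case False
      then have "sqrt (P 2 - P 4 / P 2) \<le> 0" by simp
      then have "sqrt (P 2 - P 4 / P 2) ^ k \<le> 0" using k by (simp add: power_le_zero_eq)
      also have "0 \<le> sqrt (P 4 / P 2) ^ k" using P2 P4 by simp
      finally show ?thesis .
    qed
    moreover have "(\<lambda>n. s * p n k - g n k) \<longlonglongrightarrow>
        s * P k - (sqrt (P 4 / P 2) ^ k - sqrt (P 2 - P 4 / P 2) ^ k)"
      using k by (intro tendsto_intros lim glim) auto
    ultimately have "eventually (\<lambda>n. s * p n k - g n k < 0) sequentially"
      using neg by (intro order_tendstoD(2)) auto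
    then have "eventually (\<lambda>n. \<not> ok n s) sequentially"
      by eventually_elim (use k in \<open>auto simp: ok_def\<close>)
    then show False using s(2) by (simp add: frequently_def)
  qed
  then show ?thesis using s(1) by blast
qed

text \<open>The two values make \<open>16 P 6 - 8 P 4 + P 2\<close> vanish, which is the limit of
  the sums of \<open>(x (4 x^2 - 1))^2\<close>. Writing \<open>4 x^(k+2) - x^k\<close> as
  \<open>x (4 x^2 - 1)\<close> times \<open>x^(k-1)\<close>, Cauchy-Schwarz transfers this to every
  exponent; \<open>k >= 2\<close> keeps the second factor convergent.\<close>

lemma power_sums_rigid:
  assumes "P 4 = 1/8" "P 6 = 1/32" "2 \<le> k"
  shows "P (k + 2) = P k / 4"
proof -
  define e where "e n = (\<Sum>b\<in>B n. (lam n b * (4 * (lam n b)\<^sup>2 - 1))\<^sup>2)" for n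
  have e_eq: "e n = 16 * p n 6 - 8 * p n 4 + p n 2" for n
    unfolding e_def sum_distrib_left sum_subtractf[symmetric] sum.distrib[symmetric]
    by (intro sum.cong refl)
       (simp add: power_mult_distrib power2_eq_square eval_nat_numeral algebra_simps)
  have "e \<longlonglongrightarrow> 16 * P 6 - 8 * P 4 + P 2"
    unfolding e_eq by (intro tendsto_intros lim) auto
  then have e0: "e \<longlonglongrightarrow> 0" using assms P2 by simp
  have bound: "\<bar>4 * p n (k + 2) - p n k\<bar> \<le> sqrt (e n) * sqrt (p n (2 * (k - 1)))" for n
  proof -
    obtain i where i: "k = Suc i" using assms(3) by (cases k) auto
    have "4 * p n (k + 2) - p n k = (\<Sum>b\<in>B n. (lam n b * (4 * (lam n b)\<^sup>2 - 1)) * lam n b ^ i)"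
      unfolding sum_distrib_left sum_subtractf[symmetric] i
      by (intro sum.cong refl) (simp add: power2_eq_square algebra_simps)
    also have "\<bar>\<dots>\<bar> \<le> sqrt (e n) * sqrt (p n (2 * i))"
      using L2_set_mult_ineq[of "\<lambda>b. lam n b * (4 * (lam n b)\<^sup>2 - 1)" "\<lambda>b. lam n b ^ i" "B n"]
      unfolding L2_set_def e_def abs_mult[symmetric] power_mult[of _ i 2, symmetric] mult.commute[of i 2]
      by (rule order.trans[OF sum_abs])
    finally show ?thesis by (simp add: i)
  qed
  have "(\<lambda>n. sqrt (e n) * sqrt (p n (2 * (k - 1)))) \<longlonglongrightarrow> sqrt 0 * sqrt (P (2 * (k - 1)))"
    using assms by (intro tendsto_intros e0 lim) auto
  then have sq0: "(\<lambda>n. sqrt (e n) * sqrt (p n (2 * (k - 1)))) \<longlonglongrightarrow> 0" by simp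
  have 1: "(\<lambda>n. 4 * p n (k + 2) - p n k) \<longlonglongrightarrow> 0"
    by (rule Lim_null_comparison[OF always_eventually sq0]) (use bound in simp)
  have "(\<lambda>n. 4 * p n (k + 2) - p n k) \<longlonglongrightarrow> 4 * P (k + 2) - P k"
    using assms by (intro tendsto_intros lim) auto
  from LIMSEQ_unique[OF 1 this] show ?thesis by simp
qed

end

section \<open>Limits in the second chaos\<close>

text \<open>Square integrability of \<open>F\<close> comes from a single approximant at finite
  distance, by \<open>b^2 <= 2 (a - b)^2 + 2 a^2\<close>. Then the convergence of extended-valued
  integrals becomes one of real integrals.\<close>

lemma (in finite_measure) L2_limit:
  fixes F :: "'a \<Rightarrow> real" and G :: "nat \<Rightarrow> 'a \<Rightarrow> real"
  assumes [measurable]: "F \<in> borel_measurable M" "\<And>n. G n \<in> borel_measurable M"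
    and G_int: "\<And>n. integrable M (\<lambda>x. (G n x)\<^sup>2)"
    and L2: "(\<lambda>n. \<integral>\<^sup>+x. ennreal ((G n x - F x)\<^sup>2) \<partial>M) \<longlonglongrightarrow> 0"
  shows "integrable M (\<lambda>x. (F x)\<^sup>2)" "integrable M (\<lambda>x. (G n x - F x)\<^sup>2)"
    "(\<lambda>n. \<integral>x. (G n x - F x)\<^sup>2 \<partial>M) \<longlonglongrightarrow> 0"
proof -
  show F2: "integrable M (\<lambda>x. (F x)\<^sup>2)"
  proof -
    have "eventually (\<lambda>n. (\<integral>\<^sup>+x. ennreal ((G n x - F x)\<^sup>2) \<partial>M) < 1) sequentially"
      using L2 by (rule order_tendstoD) simp
    then obtain n where n: "(\<integral>\<^sup>+x. ennreal ((G n x - F x)\<^sup>2) \<partial>M) < 1"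
      using eventually_happens sequentially_bot by blast
    have int: "integrable M (\<lambda>x. (G n x - F x)\<^sup>2)"
    proof (rule integrableI_bounded)
      show "(\<integral>\<^sup>+x. ennreal (norm ((G n x - F x)\<^sup>2)) \<partial>M) < \<infinity>"
        using n by (simp add: less_trans[OF _ ennreal_one_less_top])
    qed simp
    show ?thesis
    proof (rule Bochner_Integration.integrable_bound)
      show "integrable M (\<lambda>x. 2 * (G n x - F x)\<^sup>2 + 2 * (G n x)\<^sup>2)"
        by (intro Bochner_Integration.integrable_add integrable_mult_right int G_int)
      have "(b::real)\<^sup>2 \<le> 2 * (a - b)\<^sup>2 + 2 * a\<^sup>2" for a b
        using zero_le_power2[of "2 * a - b"] by (simp add: power2_eq_square algebra_simps)
      then show "AE x in M. norm ((F x)\<^sup>2) \<le> norm (2 * (G n x - F x)\<^sup>2 + 2 * (G n x)\<^sup>2)"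
        by simp
    qed simp
  qed
  show D2: "integrable M (\<lambda>x. (G n x - F x)\<^sup>2)" for n
  proof (rule Bochner_Integration.integrable_bound)
    show "integrable M (\<lambda>x. 2 * (G n x)\<^sup>2 + 2 * (F x)\<^sup>2)"
      by (intro Bochner_Integration.integrable_add integrable_mult_right F2 G_int)
    have "(a - b)\<^sup>2 \<le> 2 * a\<^sup>2 + 2 * (b::real)\<^sup>2" for a b
      using zero_le_power2[of "a + b"] by (simp add: power2_eq_square algebra_simps)
    then show "AE x in M. norm ((G n x - F x)\<^sup>2) \<le> norm (2 * (G n x)\<^sup>2 + 2 * (F x)\<^sup>2)"
      by simp
  qed simp
  have "(\<lambda>n. enn2real (\<integral>\<^sup>+x. ennreal ((G n x - F x)\<^sup>2) \<partial>M)) \<longlonglongrightarrow> enn2real 0"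
    by (rule tendsto_enn2real[OF L2[unfolded ennreal_0[symmetric], THEN tendsto_eq_rhs]]) auto
  moreover have "(\<lambda>n. \<integral>x. (G n x - F x)\<^sup>2 \<partial>M)
      = (\<lambda>n. enn2real (\<integral>\<^sup>+x. ennreal ((G n x - F x)\<^sup>2) \<partial>M))"
    by (intro ext integral_eq_nn_integral) auto
  ultimately show "(\<lambda>n. \<integral>x. (G n x - F x)\<^sup>2 \<partial>M) \<longlonglongrightarrow> 0" by simp
qed

lemma (in finite_measure) L2_limit_bounded:
  fixes F :: "'a \<Rightarrow> real" and G :: "nat \<Rightarrow> 'a \<Rightarrow> real"
  assumes "F \<in> borel_measurable M" "\<And>n. G n \<in> borel_measurable M"
    and G_int: "\<And>n. integrable M (\<lambda>x. (G n x)\<^sup>2)"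
    and L2: "(\<lambda>n. \<integral>\<^sup>+x. ennreal ((G n x - F x)\<^sup>2) \<partial>M) \<longlonglongrightarrow> 0"
  shows "eventually (\<lambda>n. (\<integral>x. (G n x)\<^sup>2 \<partial>M) \<le> 2 + 2 * (\<integral>x. (F x)\<^sup>2 \<partial>M)) sequentially"
proof -
  note * = L2_limit[OF assms]
  have "eventually (\<lambda>n. (\<integral>x. (G n x - F x)\<^sup>2 \<partial>M) < 1) sequentially"
    using *(3) by (rule order_tendstoD) simp
  then show ?thesis
  proof eventually_elim
    case (elim n)
    have "(a::real)\<^sup>2 \<le> 2 * (a - b)\<^sup>2 + 2 * b\<^sup>2" for a b
      using zero_le_power2[of "a - 2 * b"] by (simp add: power2_eq_square algebra_simps)
    then have "(\<integral>x. (G n x)\<^sup>2 \<partial>M) \<le> (\<integral>x. 2 * (G n x - F x)\<^sup>2 + 2 * (F x)\<^sup>2 \<partial>M)"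
      by (intro integral_mono Bochner_Integration.integrable_add integrable_mult_right * G_int)
    also have "\<dots> = 2 * (\<integral>x. (G n x - F x)\<^sup>2 \<partial>M) + 2 * (\<integral>x. (F x)\<^sup>2 \<partial>M)"
      using * by simp
    finally show ?case using elim by linarith
  qed
qed

text \<open>Eventual bounds on even moments upgrade mean-square convergence to convergence of all
  moments. Fatou's lemma along an almost surely convergent subsequence gives the moments of
  \<open>F\<close>; the differences of powers are then estimated along the whole sequence.\<close>

lemma (in prob_space) moments_L2_limit:
  fixes F :: "'a \<Rightarrow> real" and G :: "nat \<Rightarrow> 'a \<Rightarrow> real"
  assumes F [measurable]: "F \<in> borel_measurable M"
    and G: "\<And>n. all_moments M (G n)"
    and L2: "(\<lambda>n. \<integral>\<^sup>+x. ennreal ((G n x - F x)\<^sup>2) \<partial>M) \<longlonglongrightarrow> 0"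
    and bounded: "\<And>k. \<exists>K. eventually (\<lambda>n. expectation (\<lambda>x. G n x ^ (2 * k)) \<le> K) sequentially"
  shows "all_moments M F" "(\<lambda>n. expectation (\<lambda>x. G n x ^ r)) \<longlonglongrightarrow> expectation (\<lambda>x. F x ^ r)"
proof -
  have G_meas [measurable]: "G n \<in> borel_measurable M" for n using G by (rule all_moments_measurable)
  have G_int: "integrable M (\<lambda>x. G n x ^ k)" for n k using G by (rule all_moments_integrable_power)
  note L2_limit = L2_limit[OF F G_meas G_int L2]
  define d where "d n = expectation (\<lambda>x. (G n x - F x)\<^sup>2)" for n
  have d0: "d n \<ge> 0" for n unfolding d_def by (intro Bochner_Integration.integral_nonneg) simp
  have d_lim: "d \<longlonglongrightarrow> 0" unfolding d_def[abs_def] by (rule L2_limit)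
  have D2: "integrable M (\<lambda>x. (G n x - F x)\<^sup>2)" for n by (rule L2_limit)
  obtain \<rho> :: "nat \<Rightarrow> nat" where \<rho>: "strict_mono \<rho>"
    and ae: "AE x in M. (\<lambda>n. (G (\<rho> n) x - F x)\<^sup>2) \<longlonglongrightarrow> 0"
    using tendsto_L1_AE_subseq[of M "\<lambda>n x. (G n x - F x)\<^sup>2", OF D2] d_lim by (auto simp: d_def[abs_def])
  have ae': "AE x in M. (\<lambda>n. G (\<rho> n) x) \<longlonglongrightarrow> F x"
    using ae
  proof eventually_elim
    case (elim x)
    have "(\<lambda>n. sqrt ((G (\<rho> n) x - F x)\<^sup>2)) \<longlonglongrightarrow> sqrt 0" by (intro tendsto_real_sqrt elim)
    then have "(\<lambda>n. \<bar>G (\<rho> n) x - F x\<bar>) \<longlonglongrightarrow> 0" by simp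
    then show ?case by (simp add: tendsto_rabs_zero_iff LIM_zero_iff)
  qed
  have F_even: "integrable M (\<lambda>x. F x ^ (2 * k))" for k
  proof (rule integrableI_bounded)
    obtain K where K: "eventually (\<lambda>n. expectation (\<lambda>x. G n x ^ (2 * k)) \<le> K) sequentially"
      using bounded by blast
    have "(\<integral>\<^sup>+x. ennreal (norm (F x ^ (2 * k))) \<partial>M)
        = (\<integral>\<^sup>+x. liminf (\<lambda>n. ennreal (G (\<rho> n) x ^ (2 * k))) \<partial>M)"
    proof (rule nn_integral_cong_AE)
      show "AE x in M. ennreal (norm (F x ^ (2 * k))) = liminf (\<lambda>n. ennreal (G (\<rho> n) x ^ (2 * k)))"
        using ae'
      proof eventually_elim
        case (elim x)
        have "(\<lambda>n. ennreal (G (\<rho> n) x ^ (2 * k))) \<longlonglongrightarrow> ennreal (F x ^ (2 * k))"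
          by (intro tendsto_ennrealI tendsto_power elim)
        then show ?case by (subst lim_imp_Liminf[OF trivial_limit_sequentially]) simp_all
      qed
    qed
    also have "\<dots> \<le> liminf (\<lambda>n. \<integral>\<^sup>+x. ennreal (G (\<rho> n) x ^ (2 * k)) \<partial>M)"
      by (rule nn_integral_liminf) simp
    also have "\<dots> \<le> ennreal K"
    proof (rule Liminf_le[OF trivial_limit_sequentially])
      have "eventually (\<lambda>n. expectation (\<lambda>x. G (\<rho> n) x ^ (2 * k)) \<le> K) sequentially"
        using eventually_subseq[OF \<rho> K] .
      then show "eventually (\<lambda>n. (\<integral>\<^sup>+x. ennreal (G (\<rho> n) x ^ (2 * k)) \<partial>M) \<le> ennreal K) sequentially"
        by eventually_elim (subst nn_integral_eq_integral, auto intro: G_int ennreal_leI)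
    qed
    finally show "(\<integral>\<^sup>+x. ennreal (norm (F x ^ (2 * k))) \<partial>M) < \<infinity>"
      by (simp add: le_less_trans)
  qed simp
  have F_int: "integrable M (\<lambda>x. F x ^ k)" for k
  proof (rule Bochner_Integration.integrable_bound)
    show "integrable M (\<lambda>x. 1 + F x ^ (2 * k))" by (intro Bochner_Integration.integrable_add F_even) simp
    have "\<bar>a\<bar> \<le> 1 + a\<^sup>2" for a :: real
      using zero_le_power2[of "\<bar>a\<bar> - 1"] by (simp add: power2_diff)
    from this[of "F _ ^ k"] show "AE x in M. norm (F x ^ k) \<le> norm (1 + F x ^ (2 * k))"
      by (intro always_eventually allI) (simp add: mult.commute[of 2] power_mult order.trans[OF _ abs_ge_self])
  qed simp
  then show am: "all_moments M F" by (simp add: all_moments_def)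
  show "(\<lambda>n. expectation (\<lambda>x. G n x ^ r)) \<longlonglongrightarrow> expectation (\<lambda>x. F x ^ r)"
  proof -
    obtain K where K: "eventually (\<lambda>n. expectation (\<lambda>x. G n x ^ (2 * (r - 1))) \<le> K) sequentially"
      using bounded by blast
    define K' where "K' = (real r)\<^sup>2 * (K + expectation (\<lambda>x. F x ^ (2 * (r - 1))))"
    \<comment> \<open>The added \<open>1 / (n + 1)\<close> keeps the weight positive even when
      \<open>d n = 0\<close>, while \<open>d n / e n <= sqrt (d n)\<close> still tends to 0.\<close>
    define e where "e n = sqrt (d n) + 1 / (real n + 1)" for n
    have e0: "e n > 0" for n using d0 by (simp add: e_def add_nonneg_pos)
    have e_lim: "e \<longlonglongrightarrow> 0"
    proof -
      have "e \<longlonglongrightarrow> sqrt 0 + 0"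
        unfolding e_def[abs_def] using LIMSEQ_inverse_real_of_nat
        by (intro tendsto_add tendsto_real_sqrt d_lim) (simp add: inverse_eq_divide add.commute)
      then show ?thesis by simp
    qed
    \<comment> \<open>Weighted arithmetic-geometric mean for the factorisation of
      \<open>a^r - b^r\<close> through \<open>a - b\<close>; the weight is later chosen as
      \<open>e n\<close>, so both summands become small after integration.\<close>
    have pt: "\<bar>a ^ r - b ^ r\<bar> \<le> (a - b)\<^sup>2 / \<epsilon> + \<epsilon> * ((real r)\<^sup>2 * (a ^ (2 * (r - 1)) + b ^ (2 * (r - 1))))"
      if "\<epsilon> > 0" for a b \<epsilon> :: real
    proof -
      define m where "m = max \<bar>a\<bar> \<bar>b\<bar>"
      define V where "V = (\<Sum>i<r. b ^ (r - Suc i) * a ^ i)"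
      have "\<bar>V\<bar> \<le> (\<Sum>i<r. m ^ (r - 1))"
        unfolding V_def
      proof (rule order.trans[OF sum_abs sum_mono])
        fix i assume i: "i \<in> {..<r}"
        have "\<bar>b ^ (r - Suc i) * a ^ i\<bar> \<le> m ^ (r - Suc i) * m ^ i"
          unfolding abs_mult power_abs by (intro mult_mono power_mono) (auto simp: m_def)
        also have "\<dots> = m ^ (r - 1)" using i by (simp flip: power_add)
        finally show "\<bar>b ^ (r - Suc i) * a ^ i\<bar> \<le> m ^ (r - 1)" .
      qed
      then have "\<bar>V\<bar>\<^sup>2 \<le> (real r * m ^ (r - 1))\<^sup>2" by (intro power_mono) auto
      then have "V\<^sup>2 \<le> (real r)\<^sup>2 * m ^ (2 * (r - 1))"
        by (simp add: power_mult_distrib mult.commute[of 2] power_mult)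
      also have "\<dots> \<le> (real r)\<^sup>2 * (a ^ (2 * (r - 1)) + b ^ (2 * (r - 1)))"
        by (intro mult_left_mono) (auto simp: m_def max_def power_even_abs)
      finally have V2: "V\<^sup>2 \<le> (real r)\<^sup>2 * (a ^ (2 * (r - 1)) + b ^ (2 * (r - 1)))" .
      have "\<bar>a - b\<bar> * \<bar>V\<bar> \<le> (a - b)\<^sup>2 / \<epsilon> + \<epsilon> * V\<^sup>2"
      proof -
        have "0 \<le> (\<bar>a - b\<bar> - \<epsilon> * \<bar>V\<bar>)\<^sup>2" by simp
        also have "\<dots> = (a - b)\<^sup>2 - 2 * \<epsilon> * (\<bar>a - b\<bar> * \<bar>V\<bar>) + \<epsilon>\<^sup>2 * V\<^sup>2"
          by (simp add: power2_diff power_mult_distrib)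
        finally have "2 * \<epsilon> * (\<bar>a - b\<bar> * \<bar>V\<bar>) \<le> (a - b)\<^sup>2 + \<epsilon>\<^sup>2 * V\<^sup>2" by simp
        moreover have "\<epsilon> * (\<bar>a - b\<bar> * \<bar>V\<bar>) \<ge> 0" using that by simp
        ultimately have "\<epsilon> * (\<bar>a - b\<bar> * \<bar>V\<bar>) \<le> (a - b)\<^sup>2 + \<epsilon>\<^sup>2 * V\<^sup>2" by linarith
        then show ?thesis using that by (simp add: field_simps power2_eq_square)
      qed
      moreover have "a ^ r - b ^ r = (a - b) * V" unfolding V_def by (rule power_diff_sumr2)
      moreover have "\<epsilon> * V\<^sup>2 \<le> \<epsilon> * ((real r)\<^sup>2 * (a ^ (2 * (r - 1)) + b ^ (2 * (r - 1))))"
        using that by (intro mult_left_mono V2) simp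
      ultimately show ?thesis by (simp only: abs_mult)
    qed
    have bound: "norm (expectation (\<lambda>x. G n x ^ r) - expectation (\<lambda>x. F x ^ r))
        \<le> sqrt (d n) + e n * K'" if "expectation (\<lambda>x. G n x ^ (2 * (r - 1))) \<le> K" for n
    proof -
      have "norm (expectation (\<lambda>x. G n x ^ r) - expectation (\<lambda>x. F x ^ r))
          = \<bar>expectation (\<lambda>x. G n x ^ r - F x ^ r)\<bar>"
        using F_int G_int by simp
      also have "\<dots> \<le> expectation (\<lambda>x. \<bar>G n x ^ r - F x ^ r\<bar>)"
        by (rule integral_abs_bound)
      also have "\<dots> \<le> expectation (\<lambda>x. (G n x - F x)\<^sup>2 / e n
          + e n * ((real r)\<^sup>2 * (G n x ^ (2 * (r - 1)) + F x ^ (2 * (r - 1)))))"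
        by (intro integral_mono integrable_abs Bochner_Integration.integrable_diff
            Bochner_Integration.integrable_add integrable_mult_right integrable_divide F_int G_int D2 pt e0)
      also have "\<dots> = d n / e n + e n * ((real r)\<^sup>2 *
          (expectation (\<lambda>x. G n x ^ (2 * (r - 1))) + expectation (\<lambda>x. F x ^ (2 * (r - 1)))))"
        using F_int G_int D2 by (simp add: d_def)
      also have "\<dots> \<le> sqrt (d n) + e n * K'"
      proof (intro add_mono mult_left_mono)
        have "d n \<le> sqrt (d n) * e n"
        proof -
          have "sqrt (d n) * sqrt (d n) \<le> sqrt (d n) * e n"
            using d0[of n] by (intro mult_left_mono) (auto simp: e_def)
          then show ?thesis using d0[of n] by simp
        qed
        then show "d n / e n \<le> sqrt (d n)" using e0[of n] by (simp add: divide_le_eq)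
        show "(real r)\<^sup>2 * (expectation (\<lambda>x. G n x ^ (2 * (r - 1))) + expectation (\<lambda>x. F x ^ (2 * (r - 1)))) \<le> K'"
          unfolding K'_def using that by (intro mult_left_mono) auto
      qed (use e0[of n] in auto)
      finally show ?thesis .
    qed
    have "(\<lambda>n. sqrt (d n) + e n * K') \<longlonglongrightarrow> sqrt 0 + 0 * K'"
      by (intro tendsto_intros d_lim e_lim)
    then have "(\<lambda>n. sqrt (d n) + e n * K') \<longlonglongrightarrow> 0" by simp
    then have "(\<lambda>n. expectation (\<lambda>x. G n x ^ r) - expectation (\<lambda>x. F x ^ r)) \<longlonglongrightarrow> 0"
      by (rule Lim_null_comparison[rotated]) (use K bound in \<open>auto elim!: eventually_mono\<close>)
    then show ?thesis by (simp add: LIM_zero_iff)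
  qed
qed

section \<open>The formal equation \<open>f' = d f\<close> and its coefficient recursion\<close>

lemma fps_deriv_eq_mult_nth:
  fixes f d :: "real fps"
  assumes "fps_deriv f = d * f"
  shows "real (Suc r) * fps_nth f (Suc r) = (\<Sum>k\<le>r. fps_nth d k * fps_nth f (r - k))"
proof -
  have "real (Suc r) * fps_nth f (Suc r) = fps_nth (fps_deriv f) r" by simp
  then show ?thesis unfolding assms fps_mult_nth by (simp only: atLeast0AtMost)
qed

text \<open>In the recursion the \<open>s + 1\<close> summands are each at most
  \<open>q (2q)^s\<close>, so the factor \<open>Suc s\<close> on the left absorbs their number. For
  quadratic forms this bounds every moment by the second one, in the role of
  hypercontractivity.\<close>

lemma fps_deriv_eq_mult_bound:
  fixes f d :: "real fps"
  assumes eq: "fps_deriv f = d * f" and f0: "fps_nth f 0 = 1"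
    and d: "\<And>k. \<bar>fps_nth d k\<bar> \<le> q * (2 * q) ^ k" and q: "0 \<le> q"
  shows "\<bar>fps_nth f r\<bar> \<le> (2 * q) ^ r"
proof (induction r rule: less_induct)
  case (less r)
  show ?case
  proof (cases r)
    case 0
    then show ?thesis by (simp add: f0)
  next
    case (Suc s)
    have "real (Suc s) * \<bar>fps_nth f (Suc s)\<bar> = \<bar>real (Suc s) * fps_nth f (Suc s)\<bar>"
      by (simp add: abs_mult)
    also have "\<dots> = \<bar>\<Sum>k\<le>s. fps_nth d k * fps_nth f (s - k)\<bar>"
      by (simp only: fps_deriv_eq_mult_nth[OF eq])
    also have "\<dots> \<le> (\<Sum>k\<le>s. q * (2 * q) ^ s)"
    proof (rule order.trans[OF sum_abs sum_mono])
      fix k assume "k \<in> {..s}"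
      then have k: "k \<le> s" by simp
      have "\<bar>fps_nth d k * fps_nth f (s - k)\<bar> \<le> (q * (2 * q) ^ k) * (2 * q) ^ (s - k)"
        unfolding abs_mult using q k Suc by (intro mult_mono d less.IH) auto
      also have "\<dots> = q * ((2 * q) ^ k * (2 * q) ^ (s - k))" by (simp only: mult.assoc)
      also have "(2 * q) ^ k * (2 * q) ^ (s - k) = (2 * q) ^ s"
        using k by (metis le_add_diff_inverse power_add)
      finally show "\<bar>fps_nth d k * fps_nth f (s - k)\<bar> \<le> q * (2 * q) ^ s" .
    qed
    also have "\<dots> = real (Suc s) * (q * (2 * q) ^ s)" by simp
    also have "\<dots> \<le> real (Suc s) * (2 * q) ^ Suc s"
      using q by (intro mult_left_mono) auto
    finally show ?thesis unfolding Suc by (simp only: mult_le_cancel_left_pos of_nat_0_less_iff zero_less_Suc)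
  qed
qed

lemma power_sum_bound:
  fixes l :: "'b \<Rightarrow> real"
  assumes "finite A" "2 \<le> r"
  shows "\<bar>\<Sum>b\<in>A. l b ^ r\<bar> \<le> sqrt (\<Sum>b\<in>A. (l b)\<^sup>2) ^ r"
proof -
  define q where "q = sqrt (\<Sum>b\<in>A. (l b)\<^sup>2)"
  have q2: "q\<^sup>2 = (\<Sum>b\<in>A. (l b)\<^sup>2)" unfolding q_def by (simp add: sum_nonneg)
  have r: "r = (r - 2) + 2" using assms by simp
  have "\<bar>\<Sum>b\<in>A. l b ^ r\<bar> \<le> (\<Sum>b\<in>A. q ^ (r - 2) * (l b)\<^sup>2)"
  proof (rule order.trans[OF sum_abs sum_mono])
    fix b assume b: "b \<in> A"
    have "(l b)\<^sup>2 \<le> (\<Sum>b\<in>A. (l b)\<^sup>2)" using assms b by (intro member_le_sum) auto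
    then have "\<bar>l b\<bar> \<le> q" unfolding q_def by (simp add: real_le_rsqrt)
    then have "\<bar>l b\<bar> ^ (r - 2) * (l b)\<^sup>2 \<le> q ^ (r - 2) * (l b)\<^sup>2"
      by (intro mult_right_mono power_mono) auto
    moreover have "\<bar>l b ^ r\<bar> = \<bar>l b\<bar> ^ (r - 2) * (l b)\<^sup>2"
      using r by (metis power2_abs power_abs power_add)
    ultimately show "\<bar>l b ^ r\<bar> \<le> q ^ (r - 2) * (l b)\<^sup>2" by simp
  qed
  also have "\<dots> = q ^ (r - 2) * q\<^sup>2" by (simp add: q2 sum_distrib_left)
  also have "\<dots> = q ^ r" using r by (metis power_add)
  finally show ?thesis by (simp add: q_def)
qed

text \<open>The entry at 0 stands for the mean, which is 0 because the forms are centred; it is set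
  separately since limits of power sums are only available from exponent 2 on.\<close>

definition limit_deriv_fps :: "(nat \<Rightarrow> real) \<Rightarrow> real fps" where
  "limit_deriv_fps P = Abs_fps (\<lambda>k. if k = 0 then 0 else 2 ^ k * P (k + 1))"

lemma sum_cumulant_deriv_fps:
  "(\<Sum>b\<in>A. cumulant_deriv_fps (l b)) = limit_deriv_fps (\<lambda>r. \<Sum>b\<in>A. l b ^ r)"
  by (rule fps_ext)
     (simp add: fps_sum_nth cumulant_deriv_fps_def limit_deriv_fps_def sum_distrib_left)

text \<open>In the recursion for the coefficients of \<open>f\<close>, the newest coefficient of \<open>d\<close> is multiplied by
  \<open>f\<^sub>0 = 1\<close>, so \<open>d\<close> can be recovered from \<open>f\<close> by a continuous operation.\<close>

lemma fps_deriv_eq_mult_limit: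
  fixes f d :: "nat \<Rightarrow> real fps" and g :: "real fps"
  assumes eq: "\<And>n. fps_deriv (f n) = d n * f n" and f0: "\<And>n. fps_nth (f n) 0 = 1"
    and lim: "\<And>r. (\<lambda>n. fps_nth (f n) r) \<longlonglongrightarrow> fps_nth g r"
  shows "(\<lambda>n. fps_nth (d n) k) \<longlonglongrightarrow> fps_nth (fps_deriv g / g) k"
    and "fps_deriv g = (fps_deriv g / g) * g"
proof -
  have "fps_nth g 0 = 1" using LIMSEQ_unique[OF lim[of 0]] by (simp add: f0)
  then have g0: "fps_nth g 0 \<noteq> 0" by simp
  then have unit: "g dvd 1" by (simp add: fps_is_unit_iff)
  show g: "fps_deriv g = (fps_deriv g / g) * g"
    using dvd_div_mult_self[OF dvd_trans[OF unit one_dvd], of "fps_deriv g"] by simp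
  show "(\<lambda>n. fps_nth (d n) k) \<longlonglongrightarrow> fps_nth (fps_deriv g / g) k"
  proof (induction k rule: less_induct)
    case (less k)
    have rec: "fps_nth D k = real (Suc k) * fps_nth h (Suc k) - (\<Sum>j<k. fps_nth D j * fps_nth h (k - j))"
      if "fps_deriv h = D * h" "fps_nth h 0 = 1" for D h :: "real fps"
      using fps_deriv_eq_mult_nth[OF that(1), of k] that(2)
      by (simp add: lessThan_Suc_atMost[symmetric] del: of_nat_Suc)
    have "fps_nth g 0 = 1" by fact
    show ?case
      unfolding rec[OF g \<open>fps_nth g 0 = 1\<close>] rec[OF eq f0]
      by (intro tendsto_diff tendsto_mult tendsto_const tendsto_sum lim less.IH) auto
  qed
qed

context isonormal_process
begin

text \<open>The values \<open>P r\<close> are read off from the logarithmic derivative of the moment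
  series of \<open>F\<close>, not from a spectral decomposition of its kernel. Boundedness of the
  moments has to precede their convergence, and follows from the second moments of the approximating
  forms.\<close>

lemma chaos_spectral_limit:
  assumes "F \<in> second_wiener_chaos M W" "expectation (\<lambda>x. (F x)\<^sup>2) = 1"
  obtains B :: "nat \<Rightarrow> 'h set" and l P where "\<And>n. finite (B n)"
    "\<And>r. 2 \<le> r \<Longrightarrow> (\<lambda>n. \<Sum>b\<in>B n. l n b ^ r) \<longlonglongrightarrow> P r" "P 2 = 1/2"
    "all_moments M F" "fps_deriv (moment_fps M F) = limit_deriv_fps P * moment_fps M F"
    "\<And>r. 2 \<le> r \<Longrightarrow> \<bar>P r\<bar> \<le> sqrt (1/2) ^ r"
proof -
  from assms(1) obtain S c where F [measurable]: "F \<in> borel_measurable M"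
    and S: "\<And>n::nat. finite (S n)" "\<And>n h. h \<in> S n \<Longrightarrow> norm h = 1"
    and L2: "(\<lambda>n. \<integral>\<^sup>+x. ennreal (((\<Sum>h\<in>S n. c n h * ((W h x)\<^sup>2 - 1)) - F x)\<^sup>2) \<partial>M) \<longlonglongrightarrow> 0"
    unfolding second_wiener_chaos_def double_wiener_integral_def by blast
  have "\<forall>n. \<exists>B l. orthonormal B \<and>
    (AE x in M. (\<Sum>h\<in>S n. c n h * ((W h x)\<^sup>2 - 1)) = (\<Sum>b\<in>B. l b * ((W b x)\<^sup>2 - 1)))"
  proof
    fix n
    obtain B' l' where "orthonormal B'"
      "AE x in M. (\<Sum>h\<in>S n. c n h * ((W h x)\<^sup>2 - 1)) = (\<Sum>b\<in>B'. l' b * ((W b x)\<^sup>2 - 1))"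
      by (rule quadratic_form_normal_form[OF S(1) S(2)])
    then show "\<exists>B l. orthonormal B \<and>
      (AE x in M. (\<Sum>h\<in>S n. c n h * ((W h x)\<^sup>2 - 1)) = (\<Sum>b\<in>B. l b * ((W b x)\<^sup>2 - 1)))"
      by blast
  qed
  from choice[OF this] obtain B where "\<forall>n. \<exists>l. orthonormal (B n) \<and>
    (AE x in M. (\<Sum>h\<in>S n. c n h * ((W h x)\<^sup>2 - 1)) = (\<Sum>b\<in>B n. l b * ((W b x)\<^sup>2 - 1)))" ..
  from choice[OF this] obtain l where B: "\<And>n. orthonormal (B n)"
    and ae: "\<And>n. AE x in M. (\<Sum>h\<in>S n. c n h * ((W h x)\<^sup>2 - 1)) = (\<Sum>b\<in>B n. l n b * ((W b x)\<^sup>2 - 1))"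
    by blast
  define G where "G n x = (\<Sum>b\<in>B n. l n b * ((W b x)\<^sup>2 - 1))" for n x
  define p where "p n r = (\<Sum>b\<in>B n. l n b ^ r)" for n r
  have finB: "finite (B n)" for n using B by (simp add: orthonormal_def)
  have GQ: "G n = gaussian_family.Q W (l n) (B n)" for n
    unfolding gaussian_family.Q_def[OF gaussian_family[OF B]] G_def[abs_def] ..
  have Gam: "all_moments M (G n)" for n
    unfolding GQ by (rule gaussian_family.Q_all_moments[OF gaussian_family[OF B[of n]]]) simp
  have [measurable]: "G n \<in> borel_measurable M" for n using Gam by (rule all_moments_measurable)
  have Geq: "fps_deriv (moment_fps M (G n)) = limit_deriv_fps (p n) * moment_fps M (G n)" for n
    using gaussian_family.moment_fps_Q[OF gaussian_family[OF B[of n]], of "l n"]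
    unfolding GQ p_def[abs_def] sum_cumulant_deriv_fps .
  have G0: "fps_nth (moment_fps M (G n)) 0 = 1" for n by (simp add: moment_fps_def prob_space)
  have GL2: "(\<lambda>n. \<integral>\<^sup>+x. ennreal ((G n x - F x)\<^sup>2) \<partial>M) \<longlonglongrightarrow> 0"
  proof -
    have "(\<integral>\<^sup>+x. ennreal (((\<Sum>h\<in>S n. c n h * ((W h x)\<^sup>2 - 1)) - F x)\<^sup>2) \<partial>M)
        = (\<integral>\<^sup>+x. ennreal ((G n x - F x)\<^sup>2) \<partial>M)" for n
      by (rule nn_integral_cong_AE) (use ae[of n] in \<open>auto simp: G_def\<close>)
    then show ?thesis using L2 by simp
  qed
  have G2: "expectation (\<lambda>x. (G n x)\<^sup>2) = 2 * p n 2" for n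
    using fps_deriv_eq_mult_nth[OF Geq[of n], of 1] fps_deriv_eq_mult_nth[OF Geq[of n], of 0] G0[of n]
    by (simp add: moment_fps_def limit_deriv_fps_def numeral_2_eq_2)
  have p_bound: "\<bar>p n r\<bar> \<le> sqrt (p n 2) ^ r" if "2 \<le> r" for n r
    unfolding p_def by (rule power_sum_bound[OF finB that])
  have p2: "p n 2 \<ge> 0" for n unfolding p_def by (intro sum_nonneg) simp
  have pD: "\<bar>fps_nth (limit_deriv_fps (p n)) k\<bar> \<le> sqrt (p n 2) * (2 * sqrt (p n 2)) ^ k" for n k
    using p_bound[of "k + 1" n] p2[of n]
    by (cases k) (auto simp: limit_deriv_fps_def abs_mult power_mult_distrib)
  have even_bound: "expectation (\<lambda>x. G n x ^ (2 * k)) \<le> fact (2 * k) * (4 * p n 2) ^ k" for n k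
  proof -
    have "\<bar>fps_nth (moment_fps M (G n)) (2 * k)\<bar> \<le> (2 * sqrt (p n 2)) ^ (2 * k)"
      by (rule fps_deriv_eq_mult_bound[OF Geq G0 pD]) (simp add: p2)
    also have "\<dots> = (4 * p n 2) ^ k" using p2[of n] by (simp add: power_mult power_mult_distrib)
    finally show ?thesis by (simp add: moment_fps_def divide_le_eq mult.commute)
  qed
  have G_int: "integrable M (\<lambda>x. (G n x)\<^sup>2)" for n by (rule all_moments_integrable_power[OF Gam])
  \<comment> \<open>The second moment \<open>2 * p n 2\<close> is eventually at most
    \<open>2 + 2 * 1\<close>.\<close>
  have p2_bdd: "eventually (\<lambda>n. p n 2 \<le> 2) sequentially"
    using L2_limit_bounded[of F G, OF _ _ G_int GL2] unfolding G2 assms(2)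
    by (rule eventually_mono) auto
  have bdd: "\<exists>K. eventually (\<lambda>n. expectation (\<lambda>x. G n x ^ (2 * k)) \<le> K) sequentially" for k
  proof (intro exI)
    show "eventually (\<lambda>n. expectation (\<lambda>x. G n x ^ (2 * k)) \<le> fact (2 * k) * (4 * 2) ^ k) sequentially"
      using p2_bdd
    proof eventually_elim
      case (elim n)
      have "(4 * p n 2) ^ k \<le> (4 * 2) ^ k" using elim p2[of n] by (intro power_mono) auto
      then show ?case by (intro order.trans[OF even_bound] mult_left_mono) auto
    qed
  qed
  have lim: "(\<lambda>n. expectation (\<lambda>x. G n x ^ r)) \<longlonglongrightarrow> expectation (\<lambda>x. F x ^ r)" for r
    by (rule moments_L2_limit(2)[OF F Gam GL2 bdd])
  have Fam: "all_moments M F" by (rule moments_L2_limit(1)[OF F Gam GL2 bdd])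
  have flim: "(\<lambda>n. fps_nth (moment_fps M (G n)) r) \<longlonglongrightarrow> fps_nth (moment_fps M F) r" for r
    unfolding moment_fps_def fps_nth_Abs_fps by (intro tendsto_divide lim tendsto_const) simp
  define D where "D = fps_deriv (moment_fps M F) / moment_fps M F"
  have Dlim: "(\<lambda>n. fps_nth (limit_deriv_fps (p n)) k) \<longlonglongrightarrow> fps_nth D k" for k
    unfolding D_def by (rule fps_deriv_eq_mult_limit(1)[OF Geq G0 flim])
  have Deq: "fps_deriv (moment_fps M F) = D * moment_fps M F"
    unfolding D_def by (rule fps_deriv_eq_mult_limit(2)[OF Geq G0 flim])
  define P where "P r = fps_nth D (r - 1) / 2 ^ (r - 1)" for r
  have Plim: "(\<lambda>n. p n r) \<longlonglongrightarrow> P r" if "2 \<le> r" for r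
  proof -
    have "(\<lambda>n. fps_nth (limit_deriv_fps (p n)) (r - 1) / 2 ^ (r - 1)) \<longlonglongrightarrow> P r"
      unfolding P_def by (intro tendsto_divide Dlim tendsto_const) simp
    moreover have "fps_nth (limit_deriv_fps (p n)) (r - 1) / 2 ^ (r - 1) = p n r" for n
      using that by (simp add: limit_deriv_fps_def)
    ultimately show ?thesis by simp
  qed
  have "D = limit_deriv_fps P"
  proof (rule fps_ext)
    fix k
    have "fps_nth D 0 = 0"
      using LIMSEQ_unique[OF Dlim[of 0]] by (simp add: limit_deriv_fps_def)
    then show "fps_nth D k = fps_nth (limit_deriv_fps P) k"
      by (simp add: limit_deriv_fps_def P_def)
  qed
  have "(\<lambda>n. 2 * p n 2) \<longlonglongrightarrow> 1" using lim[of 2] unfolding G2 assms(2) .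
  moreover have "(\<lambda>n. 2 * p n 2) \<longlonglongrightarrow> 2 * P 2" by (intro tendsto_intros Plim) simp
  ultimately have "1 = 2 * P 2" by (rule LIMSEQ_unique)
  then have "P 2 = 1/2" by simp
  have "\<bar>P r\<bar> \<le> sqrt (1/2) ^ r" if "2 \<le> r" for r
  proof (rule LIMSEQ_le)
    show "(\<lambda>n. \<bar>p n r\<bar>) \<longlonglongrightarrow> \<bar>P r\<bar>" by (intro tendsto_rabs Plim that)
    show "(\<lambda>n. sqrt (p n 2) ^ r) \<longlonglongrightarrow> sqrt (1/2) ^ r"
      unfolding \<open>P 2 = 1/2\<close>[symmetric] by (intro tendsto_power tendsto_real_sqrt Plim) simp
  qed (use p_bound[OF that] in auto)
  then show ?thesis
    using that[OF finB Plim[unfolded p_def] \<open>P 2 = 1/2\<close> Fam Deq[unfolded \<open>D = limit_deriv_fps P\<close>]] by blast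
qed

end

section \<open>Comparison with the normal product\<close>

text \<open>Nonnegativity of \<open>g\<close> travels with the comparison, because the products in
  the recursion are compared factor by factor.\<close>

lemma fps_deriv_eq_mult_mono:
  fixes f g d e :: "real fps"
  assumes f: "fps_deriv f = d * f" and g: "fps_deriv g = e * g"
    and 0: "fps_nth f 0 = 1" "fps_nth g 0 = 1"
    and e: "\<And>k. 0 \<le> fps_nth e k" and de: "\<And>k. fps_nth e k \<le> fps_nth d k"
  shows "0 \<le> fps_nth g r \<and> fps_nth g r \<le> fps_nth f r"
proof (induction r rule: less_induct)
  case (less r)
  show ?case
  proof (cases r)
    case 0
    then show ?thesis using assms(3,4) by simp
  next
    case (Suc s)
    have IH: "0 \<le> fps_nth g (s - k)" "fps_nth g (s - k) \<le> fps_nth f (s - k)" for k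
      using less.IH[of "s - k"] Suc by auto
    have "0 \<le> real (Suc s) * fps_nth g (Suc s)"
      unfolding fps_deriv_eq_mult_nth[OF g] by (intro sum_nonneg mult_nonneg_nonneg e IH)
    moreover have "real (Suc s) * fps_nth g (Suc s) \<le> real (Suc s) * fps_nth f (Suc s)"
      unfolding fps_deriv_eq_mult_nth[OF g] fps_deriv_eq_mult_nth[OF f]
      by (intro sum_mono mult_mono de IH e order.trans[OF e de])
    ultimately show ?thesis
      unfolding Suc by (simp add: zero_le_mult_iff mult_le_cancel_left del: of_nat_Suc)
  qed
qed

text \<open>The two recursions for the coefficient at \<open>Suc n\<close> differ by a sum of
  nonnegative terms. If the coefficients agree, each term vanishes: \<open>d\<close> and
  \<open>e\<close> agree wherever the accompanying coefficient of \<open>g\<close> is positive, and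
  where \<open>e\<close> vanishes a product with a coefficient of \<open>f\<close> does.\<close>

lemma fps_deriv_eq_mult_rigid:
  fixes f g d e :: "real fps"
  assumes f: "fps_deriv f = d * f" and g: "fps_deriv g = e * g"
    and 0: "fps_nth f 0 = 1" "fps_nth g 0 = 1"
    and e: "\<And>k. 0 \<le> fps_nth e k" and de: "\<And>k. fps_nth e k \<le> fps_nth d k"
    and eq: "fps_nth f (Suc n) = fps_nth g (Suc n)" and k: "k \<le> n"
  shows "fps_nth g (n - k) > 0 \<Longrightarrow> fps_nth d k = fps_nth e k"
    and "fps_nth e k = 0 \<Longrightarrow> fps_nth d k * fps_nth f (n - k) = 0"
proof -
  note mono = fps_deriv_eq_mult_mono[OF f g 0 e de]
  define t where "t j = fps_nth d j * fps_nth f (n - j) - fps_nth e j * fps_nth g (n - j)" for j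
  have t0: "0 \<le> t j" for j
    unfolding t_def using mono[of "n - j"] e[of j] de[of j]
    by (simp add: mult_mono)
  have "(\<Sum>j\<le>n. t j) = 0"
    unfolding t_def sum_subtractf fps_deriv_eq_mult_nth[OF f, symmetric]
      fps_deriv_eq_mult_nth[OF g, symmetric] eq by simp
  then have "t k = 0" using sum_nonneg_eq_0_iff[of "{..n}" t] t0 k by auto
  then have tk: "fps_nth d k * fps_nth f (n - k) = fps_nth e k * fps_nth g (n - k)"
    by (simp add: t_def)
  show "fps_nth d k * fps_nth f (n - k) = 0" if "fps_nth e k = 0" using tk that by simp
  show "fps_nth d k = fps_nth e k" if pos: "fps_nth g (n - k) > 0"
  proof -
    have "fps_nth d k * fps_nth g (n - k) \<le> fps_nth d k * fps_nth f (n - k)"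
      using mono[of "n - k"] e[of k] de[of k] by (intro mult_left_mono) auto
    then have "fps_nth d k * fps_nth g (n - k) \<le> fps_nth e k * fps_nth g (n - k)" using tk by simp
    then show ?thesis using pos de[of k] by simp
  qed
qed

text \<open>Keeping one term of the recursion; this shows that a nonzero third cumulant would make
  an odd coefficient positive.\<close>

lemma fps_deriv_eq_mult_ge_term:
  fixes f d :: "real fps"
  assumes f: "fps_deriv f = d * f" and d: "\<And>k. 0 \<le> fps_nth d k"
    and f0: "\<And>k. 0 \<le> fps_nth f k" and k: "k \<le> n"
  shows "fps_nth d k * fps_nth f (n - k) \<le> real (Suc n) * fps_nth f (Suc n)"
  unfolding fps_deriv_eq_mult_nth[OF f]
  by (rule member_le_sum) (use d f0 k in auto)

text \<open>The chain rule for \<open>f(s t)\<close>, which for moment series means replacing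
  \<open>X\<close> by \<open>s X\<close>. With \<open>s = -1\<close> it reverses the odd cumulants
  only.\<close>

lemma fps_deriv_eq_mult_dilate:
  fixes f d :: "real fps"
  assumes "fps_deriv f = d * f"
  shows "fps_deriv (Abs_fps (\<lambda>r. s ^ r * fps_nth f r))
    = Abs_fps (\<lambda>k. s ^ (k + 1) * fps_nth d k) * Abs_fps (\<lambda>r. s ^ r * fps_nth f r)"
proof (rule fps_ext)
  fix n
  have "fps_nth (fps_deriv (Abs_fps (\<lambda>r. s ^ r * fps_nth f r))) n
      = s ^ Suc n * (real (Suc n) * fps_nth f (Suc n))" by simp
  also have "\<dots> = (\<Sum>k\<le>n. (s ^ (k + 1) * fps_nth d k) * (s ^ (n - k) * fps_nth f (n - k)))"
    unfolding fps_deriv_eq_mult_nth[OF assms] sum_distrib_left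
  proof (rule sum.cong[OF refl])
    fix k assume "k \<in> {..n}"
    then have "s ^ Suc n = s ^ (k + 1) * s ^ (n - k)" by (simp flip: power_add)
    then show "s ^ Suc n * (fps_nth d k * fps_nth f (n - k))
        = (s ^ (k + 1) * fps_nth d k) * (s ^ (n - k) * fps_nth f (n - k))" by (simp only: mult_ac)
  qed
  finally show "fps_nth (fps_deriv (Abs_fps (\<lambda>r. s ^ r * fps_nth f r))) n
      = fps_nth (Abs_fps (\<lambda>k. s ^ (k + 1) * fps_nth d k) * Abs_fps (\<lambda>r. s ^ r * fps_nth f r)) n"
    by (simp add: fps_mult_nth atLeast0AtMost)
qed

section \<open>The series of the normal product\<close>

definition normal_product_fps :: "real fps" where
  "normal_product_fps = Abs_fps (\<lambda>n. (gauss_moment n)\<^sup>2 / fact n)"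

text \<open>The series of \<open>t / (1 - t^2)\<close>. It agrees with the eigenvalues 1/2 and -1/2,
  for which \<open>2^k (x^(k+1) + y^(k+1))\<close> is 1 for odd \<open>k\<close> and 0 for even
  \<open>k\<close>.\<close>

definition normal_product_deriv_fps :: "real fps" where
  "normal_product_deriv_fps = Abs_fps (\<lambda>k. if odd k then 1 else 0)"

lemma normal_product_fps_0 [simp]: "fps_nth normal_product_fps 0 = 1"
  by (simp add: normal_product_fps_def gauss_moment_def)

lemma normal_product_fps_even_pos: "0 < fps_nth normal_product_fps (2 * n)"
  by (simp add: normal_product_fps_def gauss_moment_def)

text \<open>The moment generating function is \<open>(1 - t^2)^(-1/2)\<close>. The recursion for
  Gaussian moments yields \<open>(1 - t^2) g' = t g\<close>, and the factor \<open>1 - t^2\<close>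
  is cancelled.\<close>

lemma normal_product_fps_deriv:
  "fps_deriv normal_product_fps = normal_product_deriv_fps * normal_product_fps"
proof -
  define g where "g = normal_product_fps"
  have g1: "fps_nth g (Suc 0) = 0" by (simp add: g_def normal_product_fps_def gauss_moment_def)
  have g2: "real (n + 2) * fps_nth g (n + 2) = real (n + 1) * fps_nth g n" for n
  proof -
    have "real (n + 2) * fps_nth g (n + 2)
        = real (n + 2) * (real (n + 1) * gauss_moment n)\<^sup>2 / (real (n + 2) * (real (n + 1) * fact n))"
      unfolding g_def normal_product_fps_def fps_nth_Abs_fps gauss_moment_add2 by simp
    also have "\<dots> = real (n + 1) * ((gauss_moment n)\<^sup>2 / fact n)"
      by (simp add: power2_eq_square)
    finally show ?thesis by (simp add: g_def normal_product_fps_def)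
  qed
  let ?u = "1 - fps_X\<^sup>2 :: real fps"
  have X2: "fps_X\<^sup>2 * h = fps_X * (fps_X * h)" for h :: "real fps"
    by (simp add: power2_eq_square mult.assoc)
  have "?u * fps_deriv g = fps_X * g"
  proof (rule fps_ext)
    fix n
    show "fps_nth (?u * fps_deriv g) n = fps_nth (fps_X * g) n"
    proof (cases n)
      case 0
      then show ?thesis by (simp add: left_diff_distrib X2 g1)
    next
      case (Suc k)
      then show ?thesis using g2[of k]
        by (cases k; simp add: left_diff_distrib X2; simp add: algebra_simps)
    qed
  qed
  moreover have "?u * normal_product_deriv_fps = fps_X"
  proof (rule fps_ext)
    fix n
    show "fps_nth (?u * normal_product_deriv_fps) n = fps_nth fps_X n"
      by (cases n; cases "n - 1") (auto simp: left_diff_distrib X2 normal_product_deriv_fps_def)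
  qed
  ultimately have "?u * fps_deriv g = ?u * (normal_product_deriv_fps * g)"
    by (simp add: mult.assoc[symmetric])
  moreover have "?u \<noteq> 0"
  proof -
    have "fps_nth ?u 0 \<noteq> fps_nth 0 0" by simp
    then show ?thesis by metis
  qed
  ultimately show ?thesis by (simp add: g_def)
qed

section \<open>Domination of the even moments and the equality case\<close>

context spectral_limit
begin

text \<open>After dilating by the common sign \<open>s\<close> of the odd power sums (that is, passing from \<open>F\<close> to
  \<open>s F\<close>), every cumulant dominates the corresponding one of the normal product.\<close>

lemma dominates_normal_product:
  obtains s where "s \<in> {1, -1}"
    "\<And>k. fps_nth normal_product_deriv_fps k \<le> s ^ (k + 1) * fps_nth (limit_deriv_fps P) k"
proof -
  obtain s where s: "s \<in> {1, -1}" "\<And>k. 3 \<le> k \<Longrightarrow> odd k \<Longrightarrow> 0 \<le> s * P k"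
    using odd_sign by blast
  have "fps_nth normal_product_deriv_fps k \<le> s ^ (k + 1) * fps_nth (limit_deriv_fps P) k" for k
  proof (cases "even k")
    case False
    then obtain i where i: "k = 2 * i + 1" by (rule oddE)
    have "2 / 4 ^ Suc i \<le> P (2 * Suc i)" by (rule even_lower) simp
    then have "1 \<le> 2 * 4 ^ i * P (k + 1)" by (simp add: i field_simps)
    moreover have "(2::real) ^ k = 2 * 4 ^ i" by (simp add: i power_mult)
    ultimately have "1 \<le> 2 ^ k * P (k + 1)" by simp
    moreover have "s ^ (k + 1) = 1" using s(1) i by (auto simp: power_mult)
    ultimately show ?thesis by (simp add: i normal_product_deriv_fps_def limit_deriv_fps_def)
  next
    case True
    show ?thesis
    proof (cases "k = 0")
      case False
      then have "0 \<le> s * P (k + 1)" using True by (intro s(2)) (auto elim: evenE)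
      moreover have "s ^ (k + 1) = s" using s(1) True by auto
      ultimately have "0 \<le> s ^ (k + 1) * P (k + 1)" by (simp only:)
      then have "0 \<le> 2 ^ k * (s ^ (k + 1) * P (k + 1))" by (rule mult_nonneg_nonneg[rotated]) simp
      then show ?thesis
        using True False by (simp add: normal_product_deriv_fps_def limit_deriv_fps_def mult_ac)
    qed (simp add: normal_product_deriv_fps_def limit_deriv_fps_def)
  qed
  then show ?thesis using that s(1) by blast
qed

context
  fixes f :: "real fps"
  assumes f: "fps_deriv f = limit_deriv_fps P * f" and f0: "fps_nth f 0 = 1"
begin

text \<open>The reflection needed to make the odd cumulants nonnegative leaves even coefficients
  unchanged, so the comparison made for the dilated series holds for \<open>f\<close>
  itself.\<close>

lemma normal_product_fps_le: "fps_nth normal_product_fps (2 * r) \<le> fps_nth f (2 * r)"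
proof -
  obtain s where s: "s \<in> {1, -1}"
    "\<And>k. fps_nth normal_product_deriv_fps k \<le> s ^ (k + 1) * fps_nth (limit_deriv_fps P) k"
    using dominates_normal_product by blast
  have "fps_nth normal_product_fps (2 * r) \<le> fps_nth (Abs_fps (\<lambda>r. s ^ r * fps_nth f r)) (2 * r)"
    by (rule fps_deriv_eq_mult_mono[OF fps_deriv_eq_mult_dilate[OF f] normal_product_fps_deriv, THEN conjunct2])
       (use s(2) f0 in \<open>auto simp: normal_product_deriv_fps_def\<close>)
  then show ?thesis using s(1) by (auto simp: power_mult)
qed

lemma normal_product_fps_eq:
  assumes "3 \<le> r" "fps_nth f (2 * r) = fps_nth normal_product_fps (2 * r)"
  shows "limit_deriv_fps P = normal_product_deriv_fps" "f = normal_product_fps"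
proof -
  let ?e = normal_product_deriv_fps
  obtain s where s: "s \<in> {1, -1}"
    and dom: "\<And>k. fps_nth ?e k \<le> s ^ (k + 1) * fps_nth (limit_deriv_fps P) k"
    using dominates_normal_product by blast
  define F where "F = Abs_fps (\<lambda>r. s ^ r * fps_nth f r)"
  define d where "d = Abs_fps (\<lambda>k. s ^ (k + 1) * fps_nth (limit_deriv_fps P) k)"
  have F: "fps_deriv F = d * F" unfolding F_def d_def by (rule fps_deriv_eq_mult_dilate[OF f])
  have F0: "fps_nth F 0 = 1" by (simp add: F_def f0)
  have e0: "0 \<le> fps_nth ?e k" for k by (simp add: normal_product_deriv_fps_def)
  have de: "fps_nth ?e k \<le> fps_nth d k" for k using dom by (simp add: d_def)
  note mono = fps_deriv_eq_mult_mono[OF F normal_product_fps_deriv F0 normal_product_fps_0 e0 de]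
  \<comment> \<open>The recursion at \<open>2r = (2q + 5) + 1\<close> contains the fourth cumulant
    (\<open>k = 3\<close>) and, because \<open>r >= 3\<close>, also the sixth
    (\<open>k = 5\<close>). They are multiplied by the positive coefficients of the normal product
    at \<open>2q + 2\<close> and \<open>2q\<close>.\<close>
  obtain q where q: "r = q + 3" using assms(1) by (metis add.commute le_Suc_ex)
  have "fps_nth F (2 * r) = fps_nth f (2 * r)" using s by (auto simp: F_def power_mult)
  then have eq: "fps_nth F (Suc (2 * q + 5)) = fps_nth normal_product_fps (Suc (2 * q + 5))"
    using assms(2) by (simp add: q algebra_simps)
  note rigid = fps_deriv_eq_mult_rigid[OF F normal_product_fps_deriv F0 normal_product_fps_0 e0 de eq]
  have d3: "fps_nth d 3 = 1"
    using rigid(1)[of 3] normal_product_fps_even_pos[of "q + 1"]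
    by (simp add: normal_product_deriv_fps_def)
  then have P4': "P 4 = 1/8" using s by (auto simp: d_def limit_deriv_fps_def)
  have d5: "fps_nth d 5 = 1"
    using rigid(1)[of 5] normal_product_fps_even_pos[of q]
    by (simp add: normal_product_deriv_fps_def)
  then have P6': "P 6 = 1/32" using s by (auto simp: d_def limit_deriv_fps_def)
  \<comment> \<open>The third cumulant is paired with an odd coefficient, which for the normal
    product is 0 and so gives no positivity. Instead, a positive third cumulant would make that
    coefficient of \<open>F\<close> positive, through the term containing the even coefficient at
    \<open>2q\<close>, while rigidity forces their product to vanish.\<close>
  have "fps_nth d 2 = 0"
  proof (rule ccontr)
    assume "fps_nth d 2 \<noteq> 0"
    then have d2: "fps_nth d 2 > 0" using e0[of 2] de[of 2] by linarith
    have "fps_nth d 2 * fps_nth F (2 * q + 3) = 0"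
      using rigid(2)[of 2] by (simp add: normal_product_deriv_fps_def add.commute)
    then have "fps_nth F (Suc (2 * q + 2)) = 0" using d2 by (simp add: eval_nat_numeral)
    moreover have "fps_nth d 2 * fps_nth F (2 * q + 2 - 2) \<le> real (Suc (2 * q + 2)) * fps_nth F (Suc (2 * q + 2))"
      by (rule fps_deriv_eq_mult_ge_term[OF F])
         (use order.trans[OF e0 de] mono in \<open>auto intro: order.trans\<close>)
    moreover have "fps_nth F (2 * q) > 0"
      using mono[of "2 * q"] normal_product_fps_even_pos[of q] by linarith
    ultimately show False using mult_pos_pos[OF d2, of "fps_nth F (2 * q)"] by simp
  qed
  then have P3': "P 3 = 0" using s by (auto simp: d_def limit_deriv_fps_def)
  have step: "fps_nth (limit_deriv_fps P) (k + 2) = fps_nth (limit_deriv_fps P) k" if "1 \<le> k" for k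
    using power_sums_rigid[OF P4' P6', of "k + 1"] that by (simp add: limit_deriv_fps_def eval_nat_numeral)
  have "fps_nth (limit_deriv_fps P) k = fps_nth ?e k" for k
  proof (induction k rule: less_induct)
    case (less k)
    consider "k = 0" | "k = 1" | "k = 2" | "k \<ge> 3" by linarith
    then show ?case
    proof cases
      case 4
      then have "k - 2 + 2 = k" by simp
      then have k: "fps_nth (limit_deriv_fps P) k = fps_nth (limit_deriv_fps P) (k - 2)"
        using step[of "k - 2"] 4 by (simp only:)
      also have "\<dots> = fps_nth ?e (k - 2)" using 4 by (intro less.IH) auto
      also have "\<dots> = fps_nth ?e k" using 4 by (simp add: normal_product_deriv_fps_def)
      finally show ?thesis .
    qed (simp_all add: limit_deriv_fps_def normal_product_deriv_fps_def P2[unfolded numeral_2_eq_2] P3' P3'[unfolded numeral_3_eq_3])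
  qed
  then show de': "limit_deriv_fps P = ?e" by (rule fps_ext)
  \<comment> \<open>Both series solve the same equation with the same initial value; uniqueness
    follows from comparison in both directions.\<close>
  show "f = normal_product_fps"
  proof (rule fps_ext)
    fix n
    have f': "fps_deriv f = ?e * f" using f de' by simp
    show "fps_nth f n = fps_nth normal_product_fps n"
      using fps_deriv_eq_mult_mono[OF f' normal_product_fps_deriv f0 normal_product_fps_0 e0 order.refl, of n]
        fps_deriv_eq_mult_mono[OF normal_product_fps_deriv f' normal_product_fps_0 f0 e0 order.refl, of n]
      by linarith
  qed
qed

end

end

section \<open>Characteristic functions, cumulants and moment determinacy\<close>

text \<open>\<open>cumulant\<close> iterates derivatives of functions of a real variable, so
  knowledge at 0 alone is not enough: the induction identifies each derivative on the whole interval
  where the expansion is valid.\<close>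

lemma iterated_vector_derivative_fps:
  fixes g :: "complex fps" and L :: "real \<Rightarrow> complex"
  assumes \<delta>: "0 < \<delta>" "ereal \<delta> \<le> fps_conv_radius g"
    and L: "\<And>t. \<bar>t\<bar> < \<delta> \<Longrightarrow> L t = eval_fps g (\<i> * of_real t)"
  shows "((\<lambda>f t. vector_derivative f (at t)) ^^ n) L 0 = \<i> ^ n * fact n * fps_nth g n"
proof -
  define V :: "(real \<Rightarrow> complex) \<Rightarrow> real \<Rightarrow> complex" where "V = (\<lambda>f t. vector_derivative f (at t))"
  have rad: "ereal \<delta> \<le> fps_conv_radius ((fps_deriv ^^ n) g)" for n
  proof (induction n)
    case (Suc n)
    then show ?case using fps_conv_radius_deriv[of "(fps_deriv ^^ n) g"] by auto
  qed (use \<delta> in simp)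
  have "(V ^^ n) L t = \<i> ^ n * eval_fps ((fps_deriv ^^ n) g) (\<i> * of_real t)" if "\<bar>t\<bar> < \<delta>" for t n
    using that
  proof (induction n arbitrary: t)
    case 0
    then show ?case using L by simp
  next
    case (Suc n)
    have "ereal (norm (\<i> * of_real t :: complex)) < fps_conv_radius ((fps_deriv ^^ n) g)"
      using Suc.prems rad[of n] by (simp add: norm_mult less_le_trans[of "ereal \<bar>t\<bar>" "ereal \<delta>"])
    then have "(eval_fps ((fps_deriv ^^ n) g) has_field_derivative
        eval_fps ((fps_deriv ^^ Suc n) g) (\<i> * of_real t)) (at (\<i> * of_real t))"
      using has_field_derivative_eval_fps by simp
    moreover have "((\<lambda>t. \<i> * of_real t) has_vector_derivative \<i>) (at t)"
      by (auto intro!: derivative_eq_intros)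
    ultimately have "((\<lambda>t. eval_fps ((fps_deriv ^^ n) g) (\<i> * of_real t)) has_vector_derivative
        \<i> * eval_fps ((fps_deriv ^^ Suc n) g) (\<i> * of_real t)) (at t)"
      using field_vector_diff_chain_at[of "\<lambda>t. \<i> * of_real t" \<i> t] by (simp add: o_def)
    from has_vector_derivative_mult_right[OF this, of "\<i> ^ n"]
    have "((\<lambda>t. \<i> ^ n * eval_fps ((fps_deriv ^^ n) g) (\<i> * of_real t)) has_vector_derivative
        \<i> ^ Suc n * eval_fps ((fps_deriv ^^ Suc n) g) (\<i> * of_real t)) (at t)"
      by (simp add: mult_ac)
    then have "((V ^^ n) L has_vector_derivative
        \<i> ^ Suc n * eval_fps ((fps_deriv ^^ Suc n) g) (\<i> * of_real t)) (at t)"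
      by (rule has_vector_derivative_transform_within_open[where S = "{-\<delta><..<\<delta>}"])
         (use Suc in \<open>auto simp: abs_less_iff\<close>)
    then show ?case by (simp add: V_def vector_derivative_at)
  qed
  moreover have "fps_nth ((fps_deriv ^^ n) g) k * fact k = fact (n + k) * fps_nth g (n + k)" for n k
  proof (induction n arbitrary: k)
    case (Suc n)
    have "fps_nth ((fps_deriv ^^ Suc n) g) k = of_nat (Suc k) * fps_nth ((fps_deriv ^^ n) g) (Suc k)"
      by simp
    then have "fps_nth ((fps_deriv ^^ Suc n) g) k * fact k = fps_nth ((fps_deriv ^^ n) g) (Suc k) * fact (Suc k)"
      by (simp only: fact_Suc mult_ac)
    also have "\<dots> = fact (n + Suc k) * fps_nth g (n + Suc k)" by (rule Suc.IH)
    finally show ?case by simp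
  qed simp
  from this[of n 0] have "fps_nth ((fps_deriv ^^ n) g) 0 = fact n * fps_nth g n" by simp
  ultimately show ?thesis using \<delta> by (simp add: V_def[symmetric] eval_fps_at_0 mult.assoc)
qed

text \<open>Factorial growth of the signed moments, the form in which the recursion delivers it;
  absolute moments are recovered from it below.\<close>

definition exponential_moments :: "'a measure \<Rightarrow> ('a \<Rightarrow> real) \<Rightarrow> real \<Rightarrow> bool" where
  "exponential_moments M X a \<longleftrightarrow> prob_space M \<and> all_moments M X \<and> 0 < a
    \<and> (\<forall>r. \<bar>fps_nth (moment_fps M X) r\<bar> \<le> a ^ r)"

text \<open>The Taylor coefficients of the characteristic function about \<open>t\<close>, in the
  variable \<open>\<i> h\<close>.\<close>

definition tilted_moment_fps :: "'a measure \<Rightarrow> ('a \<Rightarrow> real) \<Rightarrow> real \<Rightarrow> complex fps" where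
  "tilted_moment_fps M X t = Abs_fps (\<lambda>k. (CLINT x|M. of_real (X x ^ k) * iexp (t * X x)) / fact k)"

lemma tilted_moment_fps_0:
  "tilted_moment_fps M X 0 = Abs_fps (\<lambda>n. of_real (fps_nth (moment_fps M X) n))"
proof (rule fps_ext)
  fix n
  have "(CLINT x|M. of_real (X x ^ n) * iexp (0 * X x)) = complex_of_real (\<integral>x. X x ^ n \<partial>M)"
    by (subst integral_complex_of_real[symmetric]) simp
  then show "fps_nth (tilted_moment_fps M X 0) n
      = fps_nth (Abs_fps (\<lambda>n. of_real (fps_nth (moment_fps M X) n))) n"
    by (simp only: tilted_moment_fps_def moment_fps_def fps_nth_Abs_fps of_real_divide of_real_fact)
qed

text \<open>An odd absolute power is at most the sum of the neighbouring even powers. Shifting the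
  index down costs \<open>1 / a\<close>, shifting it up costs \<open>(k + 1) a\<close>.\<close>

lemma exponential_moments_abs:
  assumes "exponential_moments M X a"
  shows "(\<integral>x. \<bar>X x\<bar> ^ k \<partial>M) / fact k \<le> a ^ k * (1 + 1 / a + real (k + 1) * a)"
proof -
  interpret prob_space M using assms by (simp add: exponential_moments_def)
  have a: "0 < a" and am: "all_moments M X"
    and m: "\<And>r. \<bar>expectation (\<lambda>x. X x ^ r) / fact r\<bar> \<le> a ^ r"
    using assms by (auto simp: exponential_moments_def moment_fps_def)
  show ?thesis
  proof (cases "even k")
    case True
    have "expectation (\<lambda>x. \<bar>X x\<bar> ^ k) / fact k \<le> a ^ k"
      using abs_le_D1[OF m[of k]] True by (simp add: power_even_abs)
    also have "\<dots> \<le> a ^ k * (1 + 1 / a + real (k + 1) * a)"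
      using mult_left_mono[of 1 "1 + 1 / a + real (k + 1) * a" "a ^ k"] a by simp
    finally show ?thesis .
  next
    case False
    then obtain i where k: "k = 2 * i + 1" by (rule oddE)
    have pt: "\<bar>y\<bar> ^ k \<le> y ^ (2 * i) + y ^ (2 * i + 2)" for y :: real
    proof -
      have "\<bar>y\<bar> \<le> 1 + y\<^sup>2"
        using zero_le_power2[of "\<bar>y\<bar> - 1"] by (simp add: power2_diff)
      then have "\<bar>y\<bar> ^ (2 * i) * \<bar>y\<bar> \<le> \<bar>y\<bar> ^ (2 * i) * (1 + y\<^sup>2)" by (intro mult_left_mono) auto
      then show ?thesis by (simp add: k power_even_abs power2_eq_square algebra_simps)
    qed
    have "expectation (\<lambda>x. \<bar>X x\<bar> ^ k) \<le> expectation (\<lambda>x. X x ^ (2 * i) + X x ^ (2 * i + 2))"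
    proof (rule integral_mono[OF _ _ pt])
      show "integrable M (\<lambda>x. \<bar>X x\<bar> ^ k)"
        unfolding power_abs[symmetric] by (rule integrable_abs[OF all_moments_integrable_power[OF am]])
    qed (rule Bochner_Integration.integrable_add[OF all_moments_integrable_power[OF am] all_moments_integrable_power[OF am]])
    also have "\<dots> = expectation (\<lambda>x. X x ^ (2 * i)) + expectation (\<lambda>x. X x ^ (2 * i + 2))"
      by (intro Bochner_Integration.integral_add all_moments_integrable_power[OF am])
    also have "\<dots> \<le> fact (2 * i) * a ^ (2 * i) + fact (2 * i + 2) * a ^ (2 * i + 2)"
      using m[of "2 * i"] m[of "2 * i + 2"]
      by (intro add_mono) (simp_all add: abs_le_iff divide_le_eq mult.commute del: fact_Suc)
    also have "\<dots> \<le> fact k * (a ^ (2 * i)) + fact k * (real (k + 1) * a ^ (2 * i + 2))"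
    proof (intro add_mono)
      show "fact (2 * i) * a ^ (2 * i) \<le> fact k * a ^ (2 * i)"
        using a by (intro mult_right_mono fact_mono) (auto simp: k)
      have "(fact (2 * i + 2) :: real) = real (k + 1) * fact k" by (simp add: k)
      then show "fact (2 * i + 2) * a ^ (2 * i + 2) \<le> fact k * (real (k + 1) * a ^ (2 * i + 2))"
        by simp
    qed
    also have "\<dots> = fact k * (a ^ k * (1 / a + real (k + 1) * a))"
      using a by (simp add: k distrib_left power_add power2_eq_square field_simps)
    also have "\<dots> \<le> fact k * (a ^ k * (1 + 1 / a + real (k + 1) * a))"
      using a by (intro mult_left_mono) auto
    finally show ?thesis by (simp add: divide_le_eq mult.commute)
  qed
qed

lemma exponential_moments_abs_tendsto:
  assumes "exponential_moments M X a" "0 \<le> \<rho>" "a * \<rho> < 1"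
  shows "(\<lambda>k. (\<integral>x. \<bar>X x\<bar> ^ k \<partial>M) / fact k * \<rho> ^ k) \<longlonglongrightarrow> 0"
proof (rule Lim_null_comparison[OF always_eventually])
  have a: "0 < a" using assms by (simp add: exponential_moments_def)
  define z where "z = a * \<rho>"
  have z: "norm z < 1" using assms a by (simp add: z_def)
  have "(\<lambda>k. (1 + 1 / a + a) * z ^ k + a * (real k * z ^ k)) \<longlonglongrightarrow> (1 + 1 / a + a) * 0 + a * 0"
    by (intro tendsto_intros LIMSEQ_power_zero z powser_times_n_limit_0)
  then show "(\<lambda>k. (1 + 1 / a + a) * z ^ k + a * (real k * z ^ k)) \<longlonglongrightarrow> 0" by simp
  show "\<forall>k. norm ((\<integral>x. \<bar>X x\<bar> ^ k \<partial>M) / fact k * \<rho> ^ k) \<le> (1 + 1 / a + a) * z ^ k + a * (real k * z ^ k)"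
  proof
    fix k
    have "norm ((\<integral>x. \<bar>X x\<bar> ^ k \<partial>M) / fact k * \<rho> ^ k) = (\<integral>x. \<bar>X x\<bar> ^ k \<partial>M) / fact k * \<rho> ^ k"
      using assms(2) by (simp add: integral_nonneg_AE)
    also have "\<dots> \<le> a ^ k * (1 + 1 / a + real (k + 1) * a) * \<rho> ^ k"
      using assms(2) by (intro mult_right_mono exponential_moments_abs[OF assms(1)]) simp
    also have "\<dots> = (1 + 1 / a + a) * z ^ k + a * (real k * z ^ k)"
      by (simp add: z_def power_mult_distrib algebra_simps)
    finally show "norm ((\<integral>x. \<bar>X x\<bar> ^ k \<partial>M) / fact k * \<rho> ^ k) \<le> (1 + 1 / a + a) * z ^ k + a * (real k * z ^ k)" .
  qed
qed

text \<open>The tilt has modulus 1, so the remainder of the exponential series is bounded by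
  absolute moments independently of \<open>t\<close>. Hence the same radius \<open>1 / a\<close>
  serves at every base point.\<close>

lemma char_expansion_sums:
  assumes "exponential_moments M X a" "a * \<bar>h\<bar> < 1"
  shows "(\<lambda>k. fps_nth (tilted_moment_fps M X t) k * (\<i> * of_real h) ^ k) sums char (distr M borel X) (t + h)"
proof -
  interpret prob_space M using assms by (simp add: exponential_moments_def)
  have am: "all_moments M X" using assms by (simp add: exponential_moments_def)
  have [measurable]: "X \<in> borel_measurable M" using am by (rule all_moments_measurable)
  have int_iexp: "integrable M (\<lambda>x. iexp (s * X x))" for s
    by (rule integrable_const_bound[where B = 1]) auto
  have int: "integrable M (\<lambda>x. of_real (X x ^ k) * iexp (t * X x))" for k
  proof (rule Bochner_Integration.integrable_bound)
    show "integrable M (\<lambda>x. X x ^ k)" by (rule all_moments_integrable_power[OF am])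
  qed (auto simp: norm_mult norm_power power_abs)
  define c where "c k x = (\<i> * of_real h) ^ k / fact k * (of_real (X x ^ k) * iexp (t * X x))" for k x
  have int_c: "integrable M (c k)" for k
    unfolding c_def[abs_def] by (intro integrable_mult_right int)
  have c_eq: "(CLINT x|M. c k x) = fps_nth (tilted_moment_fps M X t) k * (\<i> * of_real h) ^ k" for k
    unfolding c_def tilted_moment_fps_def by simp
  have char_eq: "char (distr M borel X) (t + h) = (CLINT x|M. iexp ((t + h) * X x))"
    unfolding char_def by (subst integral_distr) auto
  have err: "norm (char (distr M borel X) (t + h) - (\<Sum>k\<le>n. fps_nth (tilted_moment_fps M X t) k * (\<i> * of_real h) ^ k))
      \<le> (\<integral>x. \<bar>X x\<bar> ^ Suc n \<partial>M) / fact (Suc n) * \<bar>h\<bar> ^ Suc n" for n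
  proof -
    have "char (distr M borel X) (t + h) - (\<Sum>k\<le>n. fps_nth (tilted_moment_fps M X t) k * (\<i> * of_real h) ^ k)
        = (CLINT x|M. iexp ((t + h) * X x) - (\<Sum>k\<le>n. c k x))"
      unfolding char_eq c_eq[symmetric] Bochner_Integration.integral_sum[OF int_c, symmetric]
      by (rule Bochner_Integration.integral_diff[symmetric, OF int_iexp Bochner_Integration.integrable_sum[OF int_c]])
    also have "norm \<dots> \<le> (\<integral>x. norm (iexp ((t + h) * X x) - (\<Sum>k\<le>n. c k x)) \<partial>M)"
      by (rule integral_norm_bound)
    also have "\<dots> \<le> (\<integral>x. \<bar>X x\<bar> ^ Suc n * (\<bar>h\<bar> ^ Suc n / fact (Suc n)) \<partial>M)"
    proof (rule integral_mono)
      show "integrable M (\<lambda>x. norm (iexp ((t + h) * X x) - (\<Sum>k\<le>n. c k x)))"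
        by (intro integrable_norm Bochner_Integration.integrable_diff Bochner_Integration.integrable_sum int_iexp int_c)
      show "integrable M (\<lambda>x. \<bar>X x\<bar> ^ Suc n * (\<bar>h\<bar> ^ Suc n / fact (Suc n)))"
        unfolding power_abs[symmetric]
        by (intro integrable_mult_left integrable_abs all_moments_integrable_power[OF am])
      fix x
      have "iexp ((t + h) * X x) = iexp (t * X x) * iexp (h * X x)"
        by (simp add: distrib_left distrib_right exp_add)
      moreover have "(\<Sum>k\<le>n. c k x) = iexp (t * X x) * (\<Sum>k\<le>n. (\<i> * of_real (h * X x)) ^ k / fact k)"
        unfolding sum_distrib_left by (intro sum.cong refl) (simp add: c_def power_mult_distrib)
      ultimately have "norm (iexp ((t + h) * X x) - (\<Sum>k\<le>n. c k x))
          = norm (iexp (h * X x) - (\<Sum>k\<le>n. (\<i> * of_real (h * X x)) ^ k / fact k))"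
        by (simp add: norm_mult flip: right_diff_distrib)
      also have "\<dots> \<le> \<bar>h * X x\<bar> ^ Suc n / fact (Suc n)" by (rule iexp_approx1)
      finally show "norm (iexp ((t + h) * X x) - (\<Sum>k\<le>n. c k x)) \<le> \<bar>X x\<bar> ^ Suc n * (\<bar>h\<bar> ^ Suc n / fact (Suc n))"
        by (simp add: abs_mult power_mult_distrib mult_ac)
    qed
    also have "\<dots> = (\<integral>x. \<bar>X x\<bar> ^ Suc n \<partial>M) / fact (Suc n) * \<bar>h\<bar> ^ Suc n"
      by (subst integral_mult_left_zero) (simp only: times_divide_eq_right times_divide_eq_left)
    finally show ?thesis .
  qed
  have "(\<lambda>k. (\<integral>x. \<bar>X x\<bar> ^ k \<partial>M) / fact k * \<bar>h\<bar> ^ k) \<longlonglongrightarrow> 0"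
    by (rule exponential_moments_abs_tendsto[OF assms(1)]) (use assms(2) in auto)
  then have "(\<lambda>n. (\<integral>x. \<bar>X x\<bar> ^ Suc n \<partial>M) / fact (Suc n) * \<bar>h\<bar> ^ Suc n) \<longlonglongrightarrow> 0"
    by (rule LIMSEQ_Suc)
  from Lim_null_comparison[OF always_eventually[OF allI[OF err]] this]
  have "(\<lambda>n. char (distr M borel X) (t + h) - (\<Sum>k\<le>n. fps_nth (tilted_moment_fps M X t) k * (\<i> * of_real h) ^ k)) \<longlonglongrightarrow> 0" .
  from tendsto_diff[OF tendsto_const this, of "char (distr M borel X) (t + h)"]
  show ?thesis unfolding sums_def_le by simp
qed

lemma tilted_moment_fps_radius:
  assumes "exponential_moments M X a"
  shows "ereal (1 / a) \<le> fps_conv_radius (tilted_moment_fps M X t)"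
  unfolding fps_conv_radius_def
proof (rule conv_radius_geI_ex)
  fix r :: real assume r: "0 < r" "ereal r < ereal (1 / a)"
  have a: "0 < a" using assms by (simp add: exponential_moments_def)
  then have "a * \<bar>r\<bar> < 1" using r by (simp add: field_simps)
  from sums_summable[OF char_expansion_sums[OF assms this]]
  show "\<exists>z. norm z = r \<and> summable (\<lambda>n. fps_nth (tilted_moment_fps M X t) n * z ^ n)"
    using r by (intro exI[of _ "\<i> * of_real r"]) (simp add: norm_mult)
qed

lemma char_eq_eval_fps:
  assumes "exponential_moments M X a" "a * \<bar>h\<bar> < 1"
  shows "char (distr M borel X) (t + h) = eval_fps (tilted_moment_fps M X t) (\<i> * of_real h)"
  using sums_unique[OF char_expansion_sums[OF assms]] by (simp add: eval_fps_def)

text \<open>Equal moments give equal expansions of the characteristic functions only near 0. The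
  equality is continued along the real line, using that the radius of validity does not
  shrink.\<close>

theorem moment_determinacy:
  assumes X: "exponential_moments M X a" and Y: "exponential_moments N Y a"
    and eq: "moment_fps M X = moment_fps N Y"
  shows "distr M borel X = distr N borel Y"
proof (rule Levy_uniqueness)
  have a: "0 < a" using X by (simp add: exponential_moments_def)
  interpret M: prob_space M using X by (simp add: exponential_moments_def)
  interpret N: prob_space N using Y by (simp add: exponential_moments_def)
  show "real_distribution (distr M borel X)"
    using X by (auto simp: exponential_moments_def all_moments_measurable)
  show "real_distribution (distr N borel Y)"
    using Y by (auto simp: exponential_moments_def all_moments_measurable)
  let ?c = "char (distr M borel X)" and ?d = "char (distr N borel Y)"
  have ext: "?c (t + h) = ?d (t + h)"
    if "tilted_moment_fps M X t = tilted_moment_fps N Y t" "\<bar>h\<bar> < 1 / a" for t h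
    using char_eq_eval_fps[OF X, of h t] char_eq_eval_fps[OF Y, of h t] that a
    by (simp add: field_simps)
  \<comment> \<open>Agreement of the functions near \<open>t\<close> gives back agreement of the
    expansions, whose coefficients are iterated derivatives.\<close>
  have local_eq: "tilted_moment_fps M X t = tilted_moment_fps N Y t"
    if "0 < \<epsilon>" "\<And>h. \<bar>h\<bar> < \<epsilon> \<Longrightarrow> ?c (t + h) = ?d (t + h)" for t \<epsilon>
  proof (rule fps_ext)
    fix n
    define \<delta> where "\<delta> = min \<epsilon> (1 / a)"
    have \<delta>: "0 < \<delta>" using that a by (simp add: \<delta>_def)
    have \<delta>': "ereal \<delta> \<le> ereal (1 / a)" by (simp add: \<delta>_def)
    have *: "a * \<bar>h\<bar> < 1" if "\<bar>h\<bar> < \<delta>" for h using that a by (simp add: \<delta>_def field_simps)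
    have "((\<lambda>f t. vector_derivative f (at t)) ^^ n) (\<lambda>h. ?c (t + h)) 0
        = \<i> ^ n * fact n * fps_nth (tilted_moment_fps M X t) n"
      by (rule iterated_vector_derivative_fps[OF \<delta> order.trans[OF \<delta>' tilted_moment_fps_radius[OF X]]])
         (rule char_eq_eval_fps[OF X *])
    moreover have "((\<lambda>f t. vector_derivative f (at t)) ^^ n) (\<lambda>h. ?c (t + h)) 0
        = \<i> ^ n * fact n * fps_nth (tilted_moment_fps N Y t) n"
      by (rule iterated_vector_derivative_fps[OF \<delta> order.trans[OF \<delta>' tilted_moment_fps_radius[OF Y]]])
         (use that(2) char_eq_eval_fps[OF Y *] in \<open>auto simp: \<delta>_def\<close>)
    ultimately show "fps_nth (tilted_moment_fps M X t) n = fps_nth (tilted_moment_fps N Y t) n" by simp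
  qed
  define S where "S = {t. tilted_moment_fps M X t = tilted_moment_fps N Y t}"
  \<comment> \<open>Half the radius: points within \<open>1 / (2 * a)\<close> of \<open>s\<close>
    are still within \<open>1 / a\<close> of \<open>t\<close>.\<close>
  have near: "s \<in> S" if "t \<in> S" "\<bar>s - t\<bar> < 1 / (2 * a)" for s t
  proof -
    have "?c (s + h) = ?d (s + h)" if h: "\<bar>h\<bar> < 1 / (2 * a)" for h
    proof -
      have "\<bar>s - t + h\<bar> < 1 / (2 * a) + 1 / (2 * a)"
        using abs_triangle_ineq[of "s - t" h] \<open>\<bar>s - t\<bar> < 1 / (2 * a)\<close> h by linarith
      also have "\<dots> = 1 / a" using a by simp
      finally show ?thesis using ext[of t "s - t + h"] \<open>t \<in> S\<close> by (simp add: S_def)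
    qed
    then show ?thesis unfolding S_def using local_eq[of "1 / (2 * a)" s] a by simp
  qed
  have "0 \<in> S"
    unfolding S_def
  proof (intro CollectI fps_ext)
    fix n
    have "fps_nth (tilted_moment_fps M X 0) n = of_real (fps_nth (moment_fps M X) n)"
      "fps_nth (tilted_moment_fps N Y 0) n = of_real (fps_nth (moment_fps N Y) n)"
      by (simp_all add: tilted_moment_fps_0)
    then show "fps_nth (tilted_moment_fps M X 0) n = fps_nth (tilted_moment_fps N Y 0) n"
      by (simp add: eq)
  qed
  have "t \<in> S" for t
  proof -
    obtain n where n: "\<bar>t\<bar> * (2 * a) < real n" using reals_Archimedean2 by blast
    then have n0: "real n > 0" using mult_nonneg_nonneg[OF abs_ge_zero[of t], of "2 * a"] a by linarith
    have "t * real k / real n \<in> S" for k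
    proof (induction k)
      case (Suc k)
      have "\<bar>t * real (Suc k) / real n - t * real k / real n\<bar> = \<bar>t\<bar> / real n"
        using n0 by (simp add: field_simps)
      also have "\<dots> < 1 / (2 * a)" using n n0 a by (simp add: field_simps)
      finally show ?case by (rule near[OF Suc.IH])
    qed (use \<open>0 \<in> S\<close> in simp)
    from this[of n] show "t \<in> S" using n0 by simp
  qed
  then show "?c = ?d" using ext[of _ 0] a by (auto simp: S_def fun_eq_iff)
qed

section \<open>From the moment series to the logarithm of the characteristic function\<close>

lemma fps_conv_radius_geometric:
  fixes g :: "complex fps"
  assumes a: "0 < a" and g: "\<And>n. norm (fps_nth g n) \<le> C * a ^ n"
  shows "ereal (1 / a) \<le> fps_conv_radius g"
  unfolding fps_conv_radius_def
proof (rule conv_radius_geI_ex')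
  fix r :: real assume r: "0 < r" "ereal r < ereal (1 / a)"
  then have "a * r < 1" using a by (simp add: field_simps)
  show "summable (\<lambda>n. fps_nth g n * of_real r ^ n)"
  proof (rule summable_comparison_test')
    show "summable (\<lambda>n. C * (a * r) ^ n)"
      using r a \<open>a * r < 1\<close> by (intro summable_mult summable_geometric) simp
    show "norm (fps_nth g n * of_real r ^ n) \<le> C * (a * r) ^ n" for n
      using mult_right_mono[OF g[of n], of "r ^ n"] r
      by (simp add: norm_mult norm_power power_mult_distrib mult_ac)
  qed
qed

text \<open>The exponential formula: the moment series solves \<open>f' = d f\<close>, hence is the exponential of the
  antiderivative of \<open>d\<close>, so that \<open>d\<close> collects the cumulants.\<close>

lemma cumulant_eq_fps:
  assumes X: "exponential_moments M X a"
    and d: "fps_deriv (moment_fps M X) = d * moment_fps M X"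
    and bound: "\<And>k. \<bar>fps_nth d k\<bar> \<le> a ^ Suc k" and r: "1 \<le> r"
  shows "cumulant M X r = fact (r - 1) * fps_nth d (r - 1)"
proof -
  interpret prob_space M using X by (simp add: exponential_moments_def)
  have a: "0 < a" using X by (simp add: exponential_moments_def)
  define f where "f = tilted_moment_fps M X 0"
  define D :: "complex fps" where "D = Abs_fps (\<lambda>n. of_real (fps_nth d n))"
  define K where "K = fps_integral0 D"
  define R where "R = ereal (1 / a)"
  have f_nth: "fps_nth f n = of_real (fps_nth (moment_fps M X) n)" for n
    by (simp add: f_def tilted_moment_fps_0)
  have ode: "fps_deriv f = D * f"
  proof (rule fps_ext)
    fix n
    have "fps_nth (fps_deriv f) n = of_real (fps_nth (fps_deriv (moment_fps M X)) n)"
      by (simp add: f_nth)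
    then show "fps_nth (fps_deriv f) n = fps_nth (D * f) n"
      unfolding d by (simp add: fps_mult_nth D_def f_nth)
  qed
  have Rf: "R \<le> fps_conv_radius f"
    unfolding R_def f_def by (rule tilted_moment_fps_radius[OF X])
  have RD: "R \<le> fps_conv_radius D"
    unfolding R_def
  proof (rule fps_conv_radius_geometric[OF a])
    show "norm (fps_nth D n) \<le> a * a ^ n" for n using bound[of n] by (simp add: D_def)
  qed
  have K_deriv: "fps_deriv K = D" unfolding K_def by (rule fps_deriv_fps_integral)
  have RK: "R \<le> fps_conv_radius K"
    unfolding R_def
  proof (rule fps_conv_radius_geometric[OF a])
    show "norm (fps_nth K n) \<le> 1 * a ^ n" for n
    proof (cases n)
      case (Suc m)
      have "inverse (real (Suc m)) * \<bar>fps_nth d m\<bar> \<le> 1 * a ^ Suc m"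
        by (intro mult_mono bound) (simp_all add: inverse_le_1_iff)
      then show ?thesis
        by (simp add: K_def D_def Suc norm_mult norm_inverse del: of_nat_Suc)
    qed (simp add: K_def)
  qed
  have K0: "fps_nth K 0 = 0" by (simp add: K_def)
  \<comment> \<open>The quotient of \<open>f\<close> by the exponential of \<open>K\<close> has
    derivative zero, which proves the exponential formula without taking a logarithm of
    \<open>f\<close>.\<close>
  have "\<exists>c. \<forall>z\<in>ball 0 (1 / a). eval_fps f z * exp (- eval_fps K z) = c"
  proof (rule has_field_derivative_zero_constant)
    fix z :: complex assume "z \<in> ball 0 (1 / a)"
    then have z: "ereal (norm z) < R" by (simp add: R_def)
    note zf = less_le_trans[OF z Rf] and zD = less_le_trans[OF z RD] and zK = less_le_trans[OF z RK]
    have "((\<lambda>z. eval_fps f z * exp (- eval_fps K z)) has_field_derivative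
        eval_fps (fps_deriv f) z * exp (- eval_fps K z)
        + eval_fps f z * (exp (- eval_fps K z) * (- eval_fps (fps_deriv K) z))) (at z within ball 0 (1 / a))"
      by (auto intro!: derivative_eq_intros has_field_derivative_eval_fps zf zK)
    then show "((\<lambda>z. eval_fps f z * exp (- eval_fps K z)) has_field_derivative 0) (at z within ball 0 (1 / a))"
      unfolding ode K_deriv eval_fps_mult[OF zD zf] by (simp add: mult_ac)
  qed simp
  then obtain c where c: "\<And>z. norm z < 1 / a \<Longrightarrow> eval_fps f z * exp (- eval_fps K z) = c"
    by (auto simp: dist_norm)
  have "c = 1"
    using c[of 0] a by (simp add: eval_fps_at_0 K0 f_nth moment_fps_def prob_space)
  have char_exp: "char (distr M borel X) t = exp (eval_fps K (\<i> * of_real t))" if "\<bar>t\<bar> < 1 / a" for t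
  proof -
    have "char (distr M borel X) t = eval_fps f (\<i> * of_real t)"
      using char_eq_eval_fps[OF X, of t 0] that a by (simp add: f_def field_simps)
    moreover have "eval_fps f (\<i> * of_real t) * exp (- eval_fps K (\<i> * of_real t)) = 1"
      using c[of "\<i> * of_real t"] that \<open>c = 1\<close> by (simp add: norm_mult)
    ultimately show ?thesis by (simp add: exp_minus field_simps)
  qed
  \<comment> \<open>Near 0 the values of \<open>K\<close> have imaginary part below
    \<open>pi\<close> in absolute value, which is what the principal logarithm needs to invert the
    exponential.\<close>
  have "isCont (eval_fps K) 0"
    using a by (intro continuous_eval_fps less_le_trans[OF _ RK]) (simp add: R_def zero_ereal_def)
  then have "((\<lambda>z. norm (eval_fps K z)) \<longlongrightarrow> norm (eval_fps K 0)) (nhds 0)"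
    by (intro tendsto_norm) (simp add: continuous_at_imp_continuous_at_within isCont_def tendsto_at_iff_tendsto_nhds)
  then have "eventually (\<lambda>z. norm (eval_fps K z) < pi) (nhds 0)"
    by (rule order_tendstoD) (simp add: eval_fps_at_0 K0)
  then obtain \<delta>0 where \<delta>0: "0 < \<delta>0" "\<And>z. norm z < \<delta>0 \<Longrightarrow> norm (eval_fps K z) < pi"
    unfolding eventually_nhds_metric by (auto simp: dist_norm)
  define \<delta> where "\<delta> = min \<delta>0 (1 / a)"
  have \<delta>: "0 < \<delta>" using \<delta>0 a by (simp add: \<delta>_def)
  have "ereal \<delta> \<le> fps_conv_radius K" using RK by (intro order.trans[OF _ RK]) (simp add: \<delta>_def R_def)
  moreover have "Ln (char (distr M borel X) t) = eval_fps K (\<i> * of_real t)" if "\<bar>t\<bar> < \<delta>" for t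
  proof -
    have "norm (eval_fps K (\<i> * of_real t)) < pi"
      using that by (intro \<delta>0(2)) (simp add: \<delta>_def norm_mult)
    then have "\<bar>Im (eval_fps K (\<i> * of_real t))\<bar> < pi"
      using abs_Im_le_cmod[of "eval_fps K (\<i> * of_real t)"] by linarith
    then show ?thesis
      using that by (subst char_exp) (auto simp: \<delta>_def abs_less_iff intro!: Ln_exp)
  qed
  ultimately have "((\<lambda>g t. vector_derivative g (at t)) ^^ r) (\<lambda>t. Ln (char (distr M borel X) t)) 0
      = \<i> ^ r * fact r * fps_nth K r"
    by (rule iterated_vector_derivative_fps[OF \<delta>])
  then have "cumulant M X r = Re ((- \<i>) ^ r * (\<i> ^ r * fact r * fps_nth K r))"
    unfolding cumulant_def by (simp only:)
  also have "(- \<i>) ^ r * (\<i> ^ r * fact r * fps_nth K r) = fact r * fps_nth K r"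
    by (simp add: mult.assoc[symmetric] power_mult_distrib[symmetric])
  also have "\<dots> = of_real (fact (r - 1) * fps_nth d (r - 1))"
  proof -
    obtain m where m: "r = Suc m" using r by (cases r) auto
    have "fact r * fps_nth K r = (of_nat (Suc m) * inverse (of_nat (Suc m))) * (fact m * of_real (fps_nth d m))"
      by (simp only: m K_def D_def fps_integral_nth_0_Suc fps_nth_Abs_fps fact_Suc mult_ac)
    also have "of_nat (Suc m) * inverse (of_nat (Suc m)) = (1 :: complex)"
      by (simp del: of_nat_Suc)
    finally show ?thesis by (simp add: m)
  qed
  finally show ?thesis by simp
qed

section \<open>The second chaos and the normal product\<close>

lemma double_fact_odd:
  assumes "1 \<le> r"
  shows "real (double_fact (2 * r - 1)) = fact (2 * r) / (fact r * 2 ^ r)"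
  using assms
proof (induction r rule: nat_induct_at_least)
  case (Suc r)
  then obtain s where s: "r = Suc s" by (cases r) auto
  have "real (double_fact (2 * Suc r - 1)) = real (2 * r + 1) * real (double_fact (2 * r - 1))"
    by (simp add: s algebra_simps)
  also have "\<dots> = real (2 * r + 1) * fact (2 * r) / (fact r * 2 ^ r)"
    using Suc.IH by simp
  also have "\<dots> = (2 * real (r + 1)) * (real (2 * r + 1) * fact (2 * r)) / ((2 * real (r + 1)) * (fact r * 2 ^ r))"
    by (subst mult_divide_mult_cancel_left) auto
  also have "\<dots> = fact (2 * Suc r) / (fact (Suc r) * 2 ^ Suc r)"
    by (simp add: algebra_simps)
  finally show ?case .
qed simp

lemma gauss_moment_even: "gauss_moment (2 * r) = fact (2 * r) / (fact r * 2 ^ r)"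
  by (simp add: gauss_moment_def mult.commute)

lemma standard_normal_moments:
  assumes "prob_space P" "distributed P lborel N std_normal_density"
  shows "all_moments P N" "(\<integral>x. N x ^ n \<partial>P) = gauss_moment n"
proof -
  interpret prob_space P by fact
  have meas: "N \<in> borel_measurable P"
    using distributed_measurable[OF assms(2)] by simp
  have "distr P borel N = distr P lborel N" by (rule distr_cong) auto
  also have "\<dots> = density lborel (normal_density 0 1)"
    using distributed_distr_eq_density[OF assms(2)] .
  finally have g: "gaussian_rv P N"
    using meas unfolding gaussian_rv_def by (intro conjI exI[of _ 0] disjI2 exI[of _ 1]) auto
  have mean: "expectation N = 0" by (rule standard_normal_distributed_expectation[OF assms(2)])
  have "variance N = 1" by (rule standard_normal_distributed_variance[OF assms(2)])
  then have var: "expectation (\<lambda>x. (N x)\<^sup>2) = 1" by (simp add: mean)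
  show "all_moments P N" by (rule gaussian_rv_moments(1)[OF assms(1) g mean])
  show "expectation (\<lambda>x. N x ^ n) = gauss_moment n"
    using gaussian_rv_moments(2)[OF assms(1) g mean, of n] unfolding var by simp
qed

lemma normal_product_moments:
  assumes "prob_space P" "distributed P lborel N1 std_normal_density"
    "distributed P lborel N2 std_normal_density" "prob_space.indep_var P borel N1 borel N2"
  shows "all_moments P (\<lambda>x. N1 x * N2 x)" "moment P (\<lambda>x. N1 x * N2 x) n = (gauss_moment n)\<^sup>2"
    "moment_fps P (\<lambda>x. N1 x * N2 x) = normal_product_fps"
proof -
  interpret prob_space P by fact
  note am = standard_normal_moments(1)[OF assms(1,2)] standard_normal_moments(1)[OF assms(1,3)]
  show "all_moments P (\<lambda>x. N1 x * N2 x)" by (intro all_moments_mult am)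
  have eq: "expectation (\<lambda>x. (N1 x * N2 x) ^ n) = (gauss_moment n)\<^sup>2" for n
  proof -
    have "indep_var borel ((\<lambda>y. y ^ n) \<circ> N1) borel ((\<lambda>y. y ^ n) \<circ> N2)"
      by (rule indep_var_compose[OF assms(4)]) auto
    then have "indep_var borel (\<lambda>x. N1 x ^ n) borel (\<lambda>x. N2 x ^ n)" by (simp add: o_def)
    from indep_var_lebesgue_integral[OF this]
    show ?thesis
      using am[THEN all_moments_integrable_power, of n]
      by (simp add: power_mult_distrib power2_eq_square standard_normal_moments(2)[OF assms(1,2)]
          standard_normal_moments(2)[OF assms(1,3)])
  qed
  then show "moment P (\<lambda>x. N1 x * N2 x) n = (gauss_moment n)\<^sup>2" by (simp add: moment_def)
  show "moment_fps P (\<lambda>x. N1 x * N2 x) = normal_product_fps"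
    by (rule fps_ext) (simp add: moment_fps_def normal_product_fps_def eq)
qed

lemma moment_eq_fps: "moment M X r = fact r * fps_nth (moment_fps M X) r"
  by (simp add: moment_def moment_fps_def)

theorem proposition3p4:
  fixes M :: "'a measure" and W :: "'h::{real_inner, polish_space} \<Rightarrow> 'a \<Rightarrow> real"
    and F :: "'a \<Rightarrow> real"
    and P :: "'b measure" and N1 N2 :: "'b \<Rightarrow> real"
  assumes "isonormal M W"
    and "F \<in> second_wiener_chaos M W"
    and "moment M F 2 = 1"
    and "prob_space P"
    and "distributed P lborel N1 std_normal_density"
    and "distributed P lborel N2 std_normal_density"
    and "prob_space.indep_var P borel N1 borel N2"
  shows "cumulant M F 2 = 1 \<and>
    (moment M F 4 \<ge> 9 \<longleftrightarrow> cumulant M F 4 \<ge> 6) \<and>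
    (moment M F 4 \<ge> 9 \<longrightarrow>
      (\<forall>r\<ge>1. moment M F (2 * r) \<ge> moment P (\<lambda>x. N1 x * N2 x) (2 * r) \<and>
             moment P (\<lambda>x. N1 x * N2 x) (2 * r) = (real (double_fact (2 * r - 1)))\<^sup>2 \<and>
             (real (double_fact (2 * r - 1)))\<^sup>2 = (fact (2 * r) / (fact r * 2 ^ r))\<^sup>2) \<and>
      ((\<exists>r\<ge>3. moment M F (2 * r) = moment P (\<lambda>x. N1 x * N2 x) (2 * r)) \<longrightarrow>
         (\<forall>r\<ge>1. moment M F (2 * r) = moment P (\<lambda>x. N1 x * N2 x) (2 * r)) \<and>
         (\<forall>r\<ge>1. moment M F (2 * r + 1) = 0 \<and> cumulant M F (2 * r + 1) = 0) \<and>
         distr M borel F = distr P borel (\<lambda>x. N1 x * N2 x)))"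
proof -
  interpret isonormal_process M W by unfold_locales (rule assms(1))
  let ?N = "\<lambda>x. N1 x * N2 x"
  note N = normal_product_moments[OF assms(4-7)]
  have F2: "expectation (\<lambda>x. (F x)\<^sup>2) = 1" using assms(3) by (simp add: moment_def)
  obtain B :: "nat \<Rightarrow> 'h set" and l C where fin: "\<And>n. finite (B n)"
    and lim: "\<And>r. 2 \<le> r \<Longrightarrow> (\<lambda>n. \<Sum>b\<in>B n. l n b ^ r) \<longlonglongrightarrow> C r" and C2: "C 2 = 1/2"
    and am: "all_moments M F" and ode: "fps_deriv (moment_fps M F) = limit_deriv_fps C * moment_fps M F"
    and C_bound: "\<And>r. 2 \<le> r \<Longrightarrow> \<bar>C r\<bar> \<le> sqrt (1/2) ^ r"
  proof (rule chaos_spectral_limit[OF assms(2) F2], goal_cases)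
    case (1 B l C)
    show thesis by (rule 1(1)[OF 1(2-7)])
  qed
  define f where "f = moment_fps M F"
  define d where "d = limit_deriv_fps C"
  \<comment> \<open>The square root of \<open>C 2\<close>, which bounds the power sums;
    \<open>2 * q\<close> becomes the growth rate of the moment series.\<close>
  define q :: real where "q = sqrt (1/2)"
  have ode: "fps_deriv f = d * f" using ode by (simp add: f_def d_def)
  have f0: "fps_nth f 0 = 1" by (simp add: f_def moment_fps_def prob_space)
  have q: "0 < q" "q\<^sup>2 = 1/2" by (simp_all add: q_def)
  have "1 \<le> 2 * q" using real_le_rsqrt[of "1/2" "1/2"] by (simp add: q_def power2_eq_square)
  have d_bound: "\<bar>fps_nth d k\<bar> \<le> q * (2 * q) ^ k" for k
    using C_bound[of "k + 1"] q(1)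
    by (cases k) (auto simp: d_def limit_deriv_fps_def abs_mult power_mult_distrib q_def[symmetric])
  have f_bound: "\<bar>fps_nth f r\<bar> \<le> (2 * q) ^ r" for r
    by (rule fps_deriv_eq_mult_bound[OF ode f0 d_bound]) (use q in simp)
  have em: "exponential_moments M F (2 * q)"
    using am f_bound q by (simp add: exponential_moments_def prob_space_axioms f_def)
  have cum: "cumulant M F r = fact (r - 1) * fps_nth d (r - 1)" if "1 \<le> r" for r
  proof (rule cumulant_eq_fps[OF em ode[unfolded f_def] _ that])
    fix k
    have "q * (2 * q) ^ k \<le> (2 * q) ^ Suc k" using q by simp
    then show "\<bar>fps_nth d k\<bar> \<le> (2 * q) ^ Suc k" using d_bound[of k] by linarith
  qed
  have mom: "moment M F r = fact r * fps_nth f r" for r by (simp add: moment_eq_fps f_def)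
  have d_nth: "fps_nth d 0 = 0" "fps_nth d 1 = 1" "fps_nth d 3 = 8 * C 4"
    using C2 by (simp_all add: d_def limit_deriv_fps_def numeral_2_eq_2)
  have c2: "cumulant M F 2 = 1" using cum[of 2] d_nth by simp
  have c4: "cumulant M F 4 = 48 * C 4" using cum[of 4] d_nth by (simp add: fact_numeral)
  \<comment> \<open>For a centred variable the fourth moment is three times the squared variance
    plus the fourth cumulant, so the threshold 9 means 6 for the cumulant and 1/8 for
    \<open>C 4\<close>.\<close>
  have m4: "moment M F 4 = 3 + 48 * C 4"
  proof -
    have "fps_nth f 1 = 0" using fps_deriv_eq_mult_nth[OF ode, of 0] d_nth by simp
    moreover from this have "2 * fps_nth f 2 = 1"
      using fps_deriv_eq_mult_nth[OF ode, of 1] d_nth f0 by (simp add: numeral_2_eq_2)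
    ultimately have "4 * fps_nth f 4 = 1/2 + 8 * C 4"
      using fps_deriv_eq_mult_nth[OF ode, of 3] d_nth f0
      by (simp add: numeral_2_eq_2 numeral_3_eq_3 eval_nat_numeral)
    then show ?thesis unfolding mom by (simp add: fact_numeral)
  qed
  have normal: "moment P ?N (2 * r) = (real (double_fact (2 * r - 1)))\<^sup>2 \<and>
      (real (double_fact (2 * r - 1)))\<^sup>2 = (fact (2 * r) / (fact r * 2 ^ r))\<^sup>2" if "1 \<le> r" for r
    unfolding N(2) double_fact_odd[OF that] gauss_moment_even by simp
  have normal_fps: "moment P ?N r = fact r * fps_nth normal_product_fps r" for r
    unfolding moment_eq_fps N(3) ..
  have large: "(\<forall>r. moment P ?N (2 * r) \<le> moment M F (2 * r)) \<and>
      ((\<exists>r\<ge>3. moment M F (2 * r) = moment P ?N (2 * r)) \<longrightarrow>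
        d = normal_product_deriv_fps \<and> f = normal_product_fps)" if "9 \<le> moment M F 4"
  proof -
    interpret spectral_limit B l C
    proof
      show "1 / 8 \<le> C 4" using that m4 by linarith
    qed (fact fin lim C2)+
    show ?thesis
      using normal_product_fps_le[OF ode[unfolded d_def] f0] normal_product_fps_eq[OF ode[unfolded d_def] f0]
      unfolding mom normal_fps d_def by auto
  qed
  have rigid: "(\<forall>r\<ge>1. moment M F (2 * r) = moment P ?N (2 * r)) \<and>
      (\<forall>r\<ge>1. moment M F (2 * r + 1) = 0 \<and> cumulant M F (2 * r + 1) = 0) \<and>
      distr M borel F = distr P borel ?N"
    if "d = normal_product_deriv_fps" "f = normal_product_fps"
  proof (intro conjI allI impI)
    show "moment M F (2 * r) = moment P ?N (2 * r)" for r by (simp add: mom normal_fps that)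
    show "moment M F (2 * r + 1) = 0" for r
      by (simp add: mom that normal_product_fps_def gauss_moment_def)
    show "cumulant M F (2 * r + 1) = 0" for r
      using cum[of "2 * r + 1"] by (simp add: that normal_product_deriv_fps_def)
    show "distr M borel F = distr P borel ?N"
    proof (rule moment_determinacy[OF em])
      \<comment> \<open>The normal product inherits the growth bound of \<open>F\<close>, the two
        series being equal here.\<close>
      show "exponential_moments P ?N (2 * q)"
        using assms(4) N(1) q f_bound by (simp add: exponential_moments_def N(3) that)
      show "moment_fps M F = moment_fps P ?N" using that(2) by (simp add: f_def N(3))
    qed
  qed
  show ?thesis
  proof (intro conjI impI)
    show "cumulant M F 2 = 1" by (rule c2)
    show "9 \<le> moment M F 4 \<longleftrightarrow> 6 \<le> cumulant M F 4" unfolding m4 c4 by linarith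
    assume ge: "9 \<le> moment M F 4"
    show "\<forall>r\<ge>1. moment P ?N (2 * r) \<le> moment M F (2 * r) \<and>
        moment P ?N (2 * r) = (real (double_fact (2 * r - 1)))\<^sup>2 \<and>
        (real (double_fact (2 * r - 1)))\<^sup>2 = (fact (2 * r) / (fact r * 2 ^ r))\<^sup>2"
      using large[OF ge] normal by blast
    assume "\<exists>r\<ge>3. moment M F (2 * r) = moment P ?N (2 * r)"
    then have eq: "d = normal_product_deriv_fps" "f = normal_product_fps"
      using large[OF ge] by blast+
    note rigid = rigid[OF eq]
    from rigid show "\<forall>r\<ge>1. moment M F (2 * r) = moment P ?N (2 * r)" by (rule conjunct1)
    from rigid show "\<forall>r\<ge>1. moment M F (2 * r + 1) = 0 \<and> cumulant M F (2 * r + 1) = 0"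
      by (rule conjunct1[OF conjunct2])
    from rigid show "distr M borel F = distr P borel ?N" by (rule conjunct2[OF conjunct2])
  qed
qed

end
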